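(* Let $A=T(V)/I$ be a graded algebra and let $Q\to K\to 0$ be a minimal graded projective resolution of the trivial left $A$-module $K$. Then the following are equivalent: (1) $A$ is $\mathcal{K}_2$. (2) For every $n$ with $2<n\le \mathrm{pd}_A(K)$, $Q^n$ is finitely generated and the rows of the matrix $[L_n:E_n]$ are linearly independent over $K$.
   Context: Conventions. $K$ is a field. A "graded algebra" is a connected $\mathbb{N}$-graded $K$-algebra of the form $A=T(V)/I$, where $V$ is a finite-dimensional $K$-vector space placed in degree 1, $T(V)$ is its tensor algebra, and $I$ is an ideal generated by a minimal finite set of homogeneous elements $r_1,\dots,r_s$ of degree at least 2 (not necessarily all of the same degree). The field $K$ is identified with the trivial $A$-module $A/A_+$. The bigraded Yoneda algebra is $E(A)=\bigoplus_{n,m} E^{n,m}(A)$ with $E^{n,m}(A)=\mathrm{Ext}_A^{n}(K,K)_{-m}$ ($n$ is the cohomological degree, $-m$ the internal degree; Ext is computed in the category of $\mathbb{Z}$-graded locally finite $A$-modules with graded Hom spaces), with the Yoneda (cup) product; $E^n(A)=\bigoplus_m E^{n,m}(A)$. The graded algebra $A$ is called $\mathcal{K}_2$ if $E(A)$ is generated as an algebra by $E^1(A)$ and $E^2(A)$. $\mathrm{pd}_A(K)$ denotes the projective dimension of $K$ (possibly infinite). Matrices. Put $I'=I\otimes V+V\otimes I\subset I$. Each $Q^n$ is graded free; choose a homogeneous $A$-basis of each $Q^n$, with $t_n$ elements, and let $M_n$ be the $t_n\times t_{n-1}$ matrix representing $d_n:Q^n\to Q^{n-1}$ with respect to these bases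 (elements of $Q^n$ are row vectors and maps act by right multiplication by matrices). Let $\hat M_n$ be a lift of $M_n$ to a matrix over $T(V)$ with homogeneous entries; the entries of $\hat M_1$ form a basis of $V$, and the basis of $Q^2$ and the lift $\hat M_2$ are chosen so that $\hat M_2\hat M_1=(r_1\ r_2\ \cdots\ r_s)^{T}$. For $n\ge 2$ let $L_n$ be the image of $\hat M_n$ modulo the ideal $T(V)_{\ge 2}$ (the linear part of $\hat M_n$, with entries in $V$), and let $E_n$ be the image of $\hat M_n\hat M_{n-1}$ (whose entries lie in $I$) modulo $I'$, so that $E_n$ has entries in $I/I'$. Finally $[L_n:E_n]$ is the $t_n\times(t_{n-1}+t_{n-2})$ matrix obtained by concatenating the rows of $L_n$ and $E_n$; its rows are regarded as elements of the $K$-vector space $V^{t_{n-1}}\oplus (I/I')^{t_{n-2}}$. *)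

theory Defs
  imports
    "HOL-Algebra.QuotRing"
    "HOL-Algebra.Module"
    "HOL-Library.Poly_Mapping"
    "HOL-Library.Extended_Nat"
begin

section \<open>The tensor algebra\<close>

text \<open>
  A finite-dimensional vector space with a chosen basis \<open>X\<close> (a finite set of letters, possibly
  empty) has as its tensor algebra the free algebra on \<open>X\<close>, i.e. the monoid algebra of the free
  monoid on \<open>X\<close>.  Words over the whole letter type are wrapped in a type of their own, so that
  \<open>'x fword \<Rightarrow>\<^sub>0 'k\<close> carries the convolution product of \<^theory>\<open>HOL-Library.Poly_Mapping\<close>.
\<close>

datatype 'x fword = FWord (letters: "'x list")

instantiation fword :: (type) monoid_add
begin
definition zero_fword :: "'a fword" where "0 = FWord []"
definition plus_fword :: "'a fword \<Rightarrow> 'a fword \<Rightarrow> 'a fword"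
  where "u + v = FWord (letters u @ letters v)"
instance by standard (simp_all add: zero_fword_def plus_fword_def)
end

type_synonym ('x, 'k) free_alg = "'x fword \<Rightarrow>\<^sub>0 'k"

definition const :: "'k \<Rightarrow> ('x, 'k::field) free_alg"
  where "const c = Poly_Mapping.single 0 c"

definition letter :: "'x \<Rightarrow> ('x, 'k::field) free_alg"
  where "letter x = Poly_Mapping.single (FWord [x]) 1"

definition tensor_algebra :: "'x set \<Rightarrow> ('x, 'k::field) free_alg ring"
  where "tensor_algebra X =
    \<lparr>carrier = {p. \<forall>w \<in> Poly_Mapping.keys p. set (letters w) \<subseteq> X},
     mult = (*), one = 1, zero = 0, add = (+)\<rparr>"

definition tensor_comp :: "'x set \<Rightarrow> nat \<Rightarrow> ('x, 'k::field) free_alg set"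
  where "tensor_comp X i =
    {p \<in> carrier (tensor_algebra X). \<forall>w \<in> Poly_Mapping.keys p. length (letters w) = i}"

definition tensor_ge2 :: "'x set \<Rightarrow> ('x, 'k::field) free_alg set"
  where "tensor_ge2 X =
    {p \<in> carrier (tensor_algebra X). \<forall>w \<in> Poly_Mapping.keys p. length (letters w) \<ge> 2}"

definition relation_ideal ::
    "'x set \<Rightarrow> ('x, 'k::field) free_alg set \<Rightarrow> ('x, 'k) free_alg set"
  where "relation_ideal X R = genideal (tensor_algebra X) R"

definition minimal_relations :: "'x set \<Rightarrow> ('x, 'k::field) free_alg set \<Rightarrow> bool"
  where "minimal_relations X R \<longleftrightarrow>
    finite R \<and> (\<forall>r \<in> R. \<exists>i \<ge> 2. r \<in> tensor_comp X i) \<and>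
    (\<forall>S. S \<subset> R \<longrightarrow> relation_ideal X S \<noteq> relation_ideal X R)"

text \<open>
  \<open>I' = I \<otimes> V + V \<otimes> I\<close>; since \<open>V\<close> has basis \<open>X\<close>, we have \<open>I \<otimes> V = \<Oplus>\<^sub>x I x\<close> and \<open>V \<otimes> I = \<Oplus>\<^sub>x x I\<close>.
\<close>

definition decomposable_ideal ::
    "'x set \<Rightarrow> ('x, 'k::field) free_alg set \<Rightarrow> ('x, 'k) free_alg set"
  where "decomposable_ideal X I =
    {(\<Sum>x\<in>X. f x * letter x) + (\<Sum>x\<in>X. letter x * g x) | f g. f ` X \<subseteq> I \<and> g ` X \<subseteq> I}"


section \<open>Graded algebras, graded modules and resolutions\<close>

record ('a, 'k) graded_algebra = "'a ring" +
  acomp :: "nat \<Rightarrow> 'a set"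
  aug :: "'a \<Rightarrow> 'k"

text \<open>
  The augmentation of a coset is the common constant coefficient of its elements; it is
  well defined when the relations live in degrees at least 2.
\<close>

definition presented_algebra ::
    "'x set \<Rightarrow> ('x, 'k::field) free_alg set \<Rightarrow> (('x, 'k) free_alg set, 'k) graded_algebra"
  where "presented_algebra X R =
    ring.extend (tensor_algebra X Quot relation_ideal X R)
      \<lparr>acomp = (\<lambda>i. (\<lambda>p. relation_ideal X R +>\<^bsub>tensor_algebra X\<^esub> p) ` tensor_comp X i),
       aug = (\<lambda>S. the_elem ((\<lambda>p. Poly_Mapping.lookup p 0) ` S))\<rparr>"

definition aug_ideal :: "('a, 'k::field) graded_algebra \<Rightarrow> 'a set"
  where "aug_ideal A = {a \<in> carrier A. aug A a = 0}"

record ('a, 'm) gmodule = "('a, 'm) module" +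
  mcomp :: "int \<Rightarrow> 'm set"

text \<open>
  The locale \<^locale>\<open>module\<close> is restricted to commutative rings.  Of the module record only the
  carrier, the additive structure and the scalar multiplication are meaningful.
\<close>

locale left_module = R?: ring R + M?: abelian_group M for R (structure) and M (structure) +
  assumes smult_closed:
      "\<lbrakk>a \<in> carrier R; x \<in> carrier M\<rbrakk> \<Longrightarrow> a \<odot>\<^bsub>M\<^esub> x \<in> carrier M"
    and smult_l_distr:
      "\<lbrakk>a \<in> carrier R; b \<in> carrier R; x \<in> carrier M\<rbrakk>
        \<Longrightarrow> (a \<oplus> b) \<odot>\<^bsub>M\<^esub> x = (a \<odot>\<^bsub>M\<^esub> x) \<oplus>\<^bsub>M\<^esub> (b \<odot>\<^bsub>M\<^esub> x)"
    and smult_r_distr: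
      "\<lbrakk>a \<in> carrier R; x \<in> carrier M; y \<in> carrier M\<rbrakk>
        \<Longrightarrow> a \<odot>\<^bsub>M\<^esub> (x \<oplus>\<^bsub>M\<^esub> y) = (a \<odot>\<^bsub>M\<^esub> x) \<oplus>\<^bsub>M\<^esub> (a \<odot>\<^bsub>M\<^esub> y)"
    and smult_assoc:
      "\<lbrakk>a \<in> carrier R; b \<in> carrier R; x \<in> carrier M\<rbrakk>
        \<Longrightarrow> (a \<otimes> b) \<odot>\<^bsub>M\<^esub> x = a \<odot>\<^bsub>M\<^esub> (b \<odot>\<^bsub>M\<^esub> x)"
    and smult_one: "x \<in> carrier M \<Longrightarrow> \<one> \<odot>\<^bsub>M\<^esub> x = x"

definition graded_left_module ::
    "('a, 'k::field) graded_algebra \<Rightarrow> ('a, 'm) gmodule \<Rightarrow> bool"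
  where "graded_left_module A M \<longleftrightarrow>
    left_module A M \<and>
    (\<forall>d. additive_subgroup (mcomp M d) M) \<and>
    (\<forall>x \<in> carrier M. \<exists>!h. (\<forall>d. h d \<in> mcomp M d) \<and> finite {d. h d \<noteq> \<zero>\<^bsub>M\<^esub>} \<and>
        x = finsum M h {d. h d \<noteq> \<zero>\<^bsub>M\<^esub>}) \<and>
    (\<forall>i d. \<forall>a \<in> acomp A i. \<forall>x \<in> mcomp M d. a \<odot>\<^bsub>M\<^esub> x \<in> mcomp M (int i + d))"

text \<open>The degree 0 component of \<open>A\<close> is the ground field.\<close>

definition locally_finite :: "('a, 'k::field) graded_algebra \<Rightarrow> ('a, 'm) gmodule \<Rightarrow> bool"
  where "locally_finite A M \<longleftrightarrow>
    (\<forall>d. \<exists>S. finite S \<and> S \<subseteq> mcomp M d \<and>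
      (\<forall>x \<in> mcomp M d. \<exists>c \<in> S \<rightarrow> acomp A 0. x = (\<Oplus>\<^bsub>M\<^esub>s\<in>S. c s \<odot>\<^bsub>M\<^esub> s)))"

definition finitely_generated :: "('a, 'k::field) graded_algebra \<Rightarrow> ('a, 'm) gmodule \<Rightarrow> bool"
  where "finitely_generated A M \<longleftrightarrow>
    (\<exists>S. finite S \<and> S \<subseteq> carrier M \<and>
      (\<forall>x \<in> carrier M. \<exists>a \<in> S \<rightarrow> carrier A. x = (\<Oplus>\<^bsub>M\<^esub>s\<in>S. a s \<odot>\<^bsub>M\<^esub> s)))"

definition hom_deg ::
    "('a, 'k::field) graded_algebra \<Rightarrow> ('a, 'm) gmodule \<Rightarrow> ('a, 'n) gmodule \<Rightarrow> int \<Rightarrow> ('m \<Rightarrow> 'n) set"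
  where "hom_deg A M N e =
    {f. f \<in> carrier M \<rightarrow> carrier N \<and> (\<forall>x. x \<notin> carrier M \<longrightarrow> f x = \<zero>\<^bsub>N\<^esub>) \<and>
        (\<forall>x \<in> carrier M. \<forall>y \<in> carrier M. f (x \<oplus>\<^bsub>M\<^esub> y) = f x \<oplus>\<^bsub>N\<^esub> f y) \<and>
        (\<forall>a \<in> carrier A. \<forall>x \<in> carrier M. f (a \<odot>\<^bsub>M\<^esub> x) = a \<odot>\<^bsub>N\<^esub> f x) \<and>
        (\<forall>d. \<forall>x \<in> mcomp M d. f x \<in> mcomp N (d + e))}"

text \<open>The graded Hom space, i.e. the direct sum of the spaces \<^const>\<open>hom_deg\<close> over all degrees.\<close>

definition graded_hom ::
    "('a, 'k::field) graded_algebra \<Rightarrow> ('a, 'm) gmodule \<Rightarrow> ('a, 'n) gmodule \<Rightarrow> ('m \<Rightarrow> 'n) set"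
  where "graded_hom A M N =
    {(\<lambda>x. \<Oplus>\<^bsub>N\<^esub>e\<in>D. f e x) | D f. finite D \<and> (\<forall>e \<in> D. f e \<in> hom_deg A M N e)}"

definition homogeneous_basis ::
    "('a, 'k::field) graded_algebra \<Rightarrow> ('a, 'm) gmodule \<Rightarrow> 'm set \<Rightarrow> bool"
  where "homogeneous_basis A M B \<longleftrightarrow>
    B \<subseteq> (\<Union>d. mcomp M d) \<and>
    (\<forall>x \<in> carrier M. \<exists>!a. (\<forall>b \<in> B. a b \<in> carrier A) \<and> (\<forall>b. b \<notin> B \<longrightarrow> a b = \<zero>\<^bsub>A\<^esub>) \<and>
        finite {b. a b \<noteq> \<zero>\<^bsub>A\<^esub>} \<and> x = (\<Oplus>\<^bsub>M\<^esub>b\<in>{b. a b \<noteq> \<zero>\<^bsub>A\<^esub>}. a b \<odot>\<^bsub>M\<^esub> b))"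

text \<open>
  Graded projective: a graded direct summand of a graded free module.  The free module may be taken
  on a set of homogeneous elements of \<open>M\<close>, hence realised by finitely supported functions
  \<^typ>\<open>'m \<Rightarrow> 'a\<close>, so fixing the element type loses nothing.
\<close>

definition graded_projective :: "('a, 'k::field) graded_algebra \<Rightarrow> ('a, 'm) gmodule \<Rightarrow> bool"
  where "graded_projective A M \<longleftrightarrow>
    (\<exists>(F :: ('a, 'm \<Rightarrow> 'a) gmodule) B. graded_left_module A F \<and> homogeneous_basis A F B \<and>
      (\<exists>i \<in> hom_deg A M F 0. \<exists>p \<in> hom_deg A F M 0. \<forall>x \<in> carrier M. p (i x) = x))"

definition trivial_module :: "('a, 'k::field) graded_algebra \<Rightarrow> ('a, 'k) gmodule"
  where "trivial_module A =
    \<lparr>carrier = UNIV, mult = (*), one = 1, zero = 0, add = (+),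
     smult = (\<lambda>a c. aug A a * c), mcomp = (\<lambda>d. if d = 0 then UNIV else {0})\<rparr>"

text \<open>
  \<open>res_diff P n\<close> is the map \<open>P\<^sup>n \<rightarrow> P\<^sup>n\<^sup>-\<^sup>1\<close> for \<open>n \<ge> 1\<close> (\<open>res_diff P 0\<close> is not used), and
  \<open>res_aug P\<close> is the map \<open>P\<^sup>0 \<rightarrow> K\<close>.
\<close>

record ('a, 'm, 'k) resolution =
  res_mod :: "nat \<Rightarrow> ('a, 'm) gmodule"
  res_diff :: "nat \<Rightarrow> 'm \<Rightarrow> 'm"
  res_aug :: "'m \<Rightarrow> 'k"

definition graded_projective_resolution ::
    "('a, 'k::field) graded_algebra \<Rightarrow> ('a, 'm, 'k) resolution \<Rightarrow> bool"
  where "graded_projective_resolution A P \<longleftrightarrow>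
    (\<forall>n. graded_left_module A (res_mod P n) \<and> locally_finite A (res_mod P n) \<and>
         graded_projective A (res_mod P n)) \<and>
    (\<forall>n \<ge> 1. res_diff P n \<in> hom_deg A (res_mod P n) (res_mod P (n - 1)) 0) \<and>
    res_aug P \<in> hom_deg A (res_mod P 0) (trivial_module A) 0 \<and>
    res_aug P ` carrier (res_mod P 0) = UNIV \<and>
    {x \<in> carrier (res_mod P 0). res_aug P x = 0} = res_diff P 1 ` carrier (res_mod P 1) \<and>
    (\<forall>n \<ge> 1. {x \<in> carrier (res_mod P n). res_diff P n x = \<zero>\<^bsub>res_mod P (n - 1)\<^esub>} =
             res_diff P (n + 1) ` carrier (res_mod P (n + 1)))"

definition aug_submodule :: "('a, 'k::field) graded_algebra \<Rightarrow> ('a, 'm) gmodule \<Rightarrow> 'm set"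
  where "aug_submodule A M =
    {(\<Oplus>\<^bsub>M\<^esub>s\<in>S. a s \<odot>\<^bsub>M\<^esub> s) | S a. finite S \<and> S \<subseteq> carrier M \<and> a \<in> S \<rightarrow> aug_ideal A}"

definition minimal_graded_projective_resolution ::
    "('a, 'k::field) graded_algebra \<Rightarrow> ('a, 'm, 'k) resolution \<Rightarrow> bool"
  where "minimal_graded_projective_resolution A Q \<longleftrightarrow>
    graded_projective_resolution A Q \<and>
    (\<forall>n \<ge> 1. res_diff Q n ` carrier (res_mod Q n) \<subseteq> aug_submodule A (res_mod Q (n - 1)))"

definition res_length :: "('a, 'm, 'k) resolution \<Rightarrow> enat"
  where "res_length P = (SUP n \<in> {n. carrier (res_mod P n) \<noteq> {\<zero>\<^bsub>res_mod P n\<^esub>}}. enat n)"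

text \<open>
  The projective dimension of the trivial module: the least length of a projective resolution.
  The infimum is taken over resolutions with elements in \<^typ>\<open>nat \<Rightarrow> 'a\<close>; this type contains the
  graded free modules on countable bases (as finitely supported functions), in particular a copy of
  the minimal resolution, which realises the least length.
\<close>

definition proj_dim :: "('a, 'k::field) graded_algebra \<Rightarrow> enat"
  where "proj_dim A =
    (INF P \<in> {P :: ('a, nat \<Rightarrow> 'a, 'k) resolution. graded_projective_resolution A P}. res_length P)"


section \<open>The Yoneda algebra\<close>

text \<open>
  \<open>E\<^sup>n(A)\<close> is the cohomology in degree \<open>n\<close> of the graded Hom complex from a graded projective
  resolution \<open>P\<close> of \<open>K\<close> to \<open>K\<close>.  A class is represented as a coset of coboundaries.
\<close>

definition cochains ::
    "('a, 'k::field) graded_algebra \<Rightarrow> ('a, 'm, 'k) resolution \<Rightarrow> nat \<Rightarrow> ('m \<Rightarrow> 'k) set"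
  where "cochains A P n = graded_hom A (res_mod P n) (trivial_module A)"

definition cocycles ::
    "('a, 'k::field) graded_algebra \<Rightarrow> ('a, 'm, 'k) resolution \<Rightarrow> nat \<Rightarrow> ('m \<Rightarrow> 'k) set"
  where "cocycles A P n =
    {f \<in> cochains A P n. \<forall>x \<in> carrier (res_mod P (n + 1)). f (res_diff P (n + 1) x) = 0}"

definition coboundaries ::
    "('a, 'k::field) graded_algebra \<Rightarrow> ('a, 'm, 'k) resolution \<Rightarrow> nat \<Rightarrow> ('m \<Rightarrow> 'k) set"
  where "coboundaries A P n =
    (if n = 0 then {\<lambda>x. 0} else {g \<circ> res_diff P n | g. g \<in> cochains A P (n - 1)})"

definition coh_class ::
    "('a, 'k::field) graded_algebra \<Rightarrow> ('a, 'm, 'k) resolution \<Rightarrow> nat \<Rightarrow> ('m \<Rightarrow> 'k) \<Rightarrow> ('m \<Rightarrow> 'k) set"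
  where "coh_class A P n f = {\<lambda>x. f x + b x | b. b \<in> coboundaries A P n}"

definition Ext ::
    "('a, 'k::field) graded_algebra \<Rightarrow> ('a, 'm, 'k) resolution \<Rightarrow> nat \<Rightarrow> ('m \<Rightarrow> 'k) set set"
  where "Ext A P n = coh_class A P n ` cocycles A P n"

definition chain_lift ::
    "('a, 'k::field) graded_algebra \<Rightarrow> ('a, 'm, 'k) resolution \<Rightarrow> nat \<Rightarrow> ('m \<Rightarrow> 'k) \<Rightarrow>
     (nat \<Rightarrow> 'm \<Rightarrow> 'm) \<Rightarrow> bool"
  where "chain_lift A P q g \<phi> \<longleftrightarrow>
    (\<forall>i. \<phi> i \<in> graded_hom A (res_mod P (i + q)) (res_mod P i)) \<and>
    (\<forall>x \<in> carrier (res_mod P q). res_aug P (\<phi> 0 x) = g x) \<and>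
    (\<forall>i. \<forall>x \<in> carrier (res_mod P (i + 1 + q)).
        res_diff P (i + 1) (\<phi> (i + 1) x) = \<phi> i (res_diff P (i + 1 + q) x))"

text \<open>
  The Yoneda product of \<open>[f]\<close> and \<open>[g]\<close> is \<open>[f \<circ> \<phi>\<^sub>p]\<close>, where \<open>\<phi>\<close> lifts \<open>g\<close> to a chain map.  The
  union is over all choices of representatives and of lifts, which all give the same class.
\<close>

definition yoneda_product ::
    "('a, 'k::field) graded_algebra \<Rightarrow> ('a, 'm, 'k) resolution \<Rightarrow> nat \<Rightarrow> nat \<Rightarrow>
     ('m \<Rightarrow> 'k) set \<Rightarrow> ('m \<Rightarrow> 'k) set \<Rightarrow> ('m \<Rightarrow> 'k) set"
  where "yoneda_product A P p q u v =
    \<Union>{coh_class A P (p + q) (f \<circ> \<phi> p) | f g \<phi>. f \<in> u \<and> g \<in> v \<and> chain_lift A P q g \<phi>}"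

text \<open>
  An element of \<open>E(A) = \<Oplus>\<^sub>n E\<^sup>n(A)\<close> is a sequence \<open>u\<close> of classes \<open>u n \<in> E\<^sup>n(A)\<close>, almost all of them
  zero.  The zero class in degree \<open>n\<close> is the set of coboundaries.
\<close>

definition yoneda_algebra ::
    "('a, 'k::field) graded_algebra \<Rightarrow> ('a, 'm, 'k) resolution \<Rightarrow>
     ('k, nat \<Rightarrow> ('m \<Rightarrow> 'k) set) module"
  where "yoneda_algebra A P =
    \<lparr>carrier = {u. (\<forall>n. u n \<in> Ext A P n) \<and> finite {n. u n \<noteq> coboundaries A P n}},
     mult = (\<lambda>u v n. {\<lambda>x. \<Sum>p\<le>n. h p x | h.
               \<forall>p \<le> n. h p \<in> yoneda_product A P p (n - p) (u p) (v (n - p))}),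
     one = (\<lambda>n. if n = 0 then coh_class A P 0 (res_aug P) else coboundaries A P n),
     zero = coboundaries A P,
     add = (\<lambda>u v n. {\<lambda>x. f x + g x | f g. f \<in> u n \<and> g \<in> v n}),
     smult = (\<lambda>c u n. \<Union>f \<in> u n. coh_class A P n (\<lambda>x. c * f x))\<rparr>"

definition yoneda_comp ::
    "('a, 'k::field) graded_algebra \<Rightarrow> ('a, 'm, 'k) resolution \<Rightarrow> nat \<Rightarrow>
     (nat \<Rightarrow> ('m \<Rightarrow> 'k) set) set"
  where "yoneda_comp A P n =
    {u \<in> carrier (yoneda_algebra A P). \<forall>m. m \<noteq> n \<longrightarrow> u m = coboundaries A P m}"

inductive_set generated_subalgebra :: "('k, 'e) module \<Rightarrow> 'e set \<Rightarrow> 'e set"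
  for E :: "('k, 'e) module" and S :: "'e set"
  where
    one: "\<one>\<^bsub>E\<^esub> \<in> generated_subalgebra E S"
  | incl: "u \<in> S \<Longrightarrow> u \<in> generated_subalgebra E S"
  | add: "\<lbrakk>u \<in> generated_subalgebra E S; v \<in> generated_subalgebra E S\<rbrakk>
      \<Longrightarrow> u \<oplus>\<^bsub>E\<^esub> v \<in> generated_subalgebra E S"
  | smult: "u \<in> generated_subalgebra E S \<Longrightarrow> c \<odot>\<^bsub>E\<^esub> u \<in> generated_subalgebra E S"
  | mult: "\<lbrakk>u \<in> generated_subalgebra E S; v \<in> generated_subalgebra E S\<rbrakk>
      \<Longrightarrow> u \<otimes>\<^bsub>E\<^esub> v \<in> generated_subalgebra E S"

text \<open>
  The property \<open>K\<^sub>2\<close> of \<open>A\<close>, with the Yoneda algebra computed from the graded projective resolution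
  \<open>P\<close> of \<open>K\<close>.  Up to isomorphism the Yoneda algebra does not depend on \<open>P\<close>.
\<close>

definition K2 :: "('a, 'k::field) graded_algebra \<Rightarrow> ('a, 'm, 'k) resolution \<Rightarrow> bool"
  where "K2 A P \<longleftrightarrow>
    generated_subalgebra (yoneda_algebra A P) (yoneda_comp A P 1 \<union> yoneda_comp A P 2) =
    carrier (yoneda_algebra A P)"


section \<open>Matrices\<close>

text \<open>
  Rows and columns are indexed by the basis elements themselves.  Basis elements are row vectors,
  so the row of \<open>b\<close> lists the coordinates of \<open>d b\<close>.
\<close>

definition represents ::
    "('a, 'k::field) graded_algebra \<Rightarrow> ('a, 'm) gmodule \<Rightarrow> 'm set \<Rightarrow> 'm set \<Rightarrow> ('m \<Rightarrow> 'm) \<Rightarrow>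
     ('m \<Rightarrow> 'm \<Rightarrow> 'a) \<Rightarrow> bool"
  where "represents A N B C d M \<longleftrightarrow>
    (\<forall>b \<in> B. (\<forall>c \<in> C. M b c \<in> carrier A) \<and> finite {c \<in> C. M b c \<noteq> \<zero>\<^bsub>A\<^esub>} \<and>
       d b = (\<Oplus>\<^bsub>N\<^esub>c\<in>{c \<in> C. M b c \<noteq> \<zero>\<^bsub>A\<^esub>}. M b c \<odot>\<^bsub>N\<^esub> c))"

definition homogeneous_lift ::
    "'x set \<Rightarrow> ('x, 'k::field) free_alg set \<Rightarrow> 'm set \<Rightarrow> 'm set \<Rightarrow>
     ('m \<Rightarrow> 'm \<Rightarrow> ('x, 'k) free_alg set) \<Rightarrow> ('m \<Rightarrow> 'm \<Rightarrow> ('x, 'k) free_alg) \<Rightarrow> bool"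
  where "homogeneous_lift X R B C M Mh \<longleftrightarrow>
    (\<forall>b \<in> B. finite {c \<in> C. Mh b c \<noteq> 0} \<and>
       (\<forall>c \<in> C. (\<exists>i. Mh b c \<in> tensor_comp X i) \<and>
          relation_ideal X R +>\<^bsub>tensor_algebra X\<^esub> Mh b c = M b c))"

definition mat_mult ::
    "'m set \<Rightarrow> ('m \<Rightarrow> 'm \<Rightarrow> ('x, 'k::field) free_alg) \<Rightarrow> ('m \<Rightarrow> 'm \<Rightarrow> ('x, 'k) free_alg) \<Rightarrow>
     'm \<Rightarrow> 'm \<Rightarrow> ('x, 'k) free_alg"
  where "mat_mult C M N b e = (\<Sum>c | c \<in> C \<and> M b c \<noteq> 0. M b c * N c e)"

definition entries_basis_of_V ::
    "'x set \<Rightarrow> 'm set \<Rightarrow> 'm set \<Rightarrow> ('m \<Rightarrow> 'm \<Rightarrow> ('x, 'k::field) free_alg) \<Rightarrow> bool"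
  where "entries_basis_of_V X B C M \<longleftrightarrow>
    inj_on (\<lambda>(b, c). M b c) (B \<times> C) \<and>
    \<not> Modules.module.dependent (\<lambda>k p. const k * p) ((\<lambda>(b, c). M b c) ` (B \<times> C)) \<and>
    Modules.module.span (\<lambda>k p. const k * p) ((\<lambda>(b, c). M b c) ` (B \<times> C)) = tensor_comp X 1"

definition linear_part ::
    "'x set \<Rightarrow> ('m \<Rightarrow> 'm \<Rightarrow> ('x, 'k::field) free_alg) \<Rightarrow> 'm \<Rightarrow> 'm \<Rightarrow> ('x, 'k) free_alg set"
  where "linear_part X Mh b c = tensor_ge2 X +>\<^bsub>tensor_algebra X\<^esub> Mh b c"

definition essential_part ::
    "'x set \<Rightarrow> ('x, 'k::field) free_alg set \<Rightarrow> 'm set \<Rightarrow>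
     ('m \<Rightarrow> 'm \<Rightarrow> ('x, 'k) free_alg) \<Rightarrow> ('m \<Rightarrow> 'm \<Rightarrow> ('x, 'k) free_alg) \<Rightarrow>
     'm \<Rightarrow> 'm \<Rightarrow> ('x, 'k) free_alg set"
  where "essential_part X R C Mh Nh b e =
    decomposable_ideal X (relation_ideal X R) +>\<^bsub>tensor_algebra X\<^esub> mat_mult C Mh Nh b e"

text \<open>
  Linear combinations over \<open>K\<close> in the quotient of the tensor algebra by the two-sided ideal \<open>J\<close>:
  a scalar acts as multiplication by its image in the quotient.
\<close>

definition quot_lincomb ::
    "'x set \<Rightarrow> ('x, 'k::field) free_alg set \<Rightarrow> 'm set \<Rightarrow> ('m \<Rightarrow> 'k) \<Rightarrow>
     ('m \<Rightarrow> ('x, 'k) free_alg set) \<Rightarrow> ('x, 'k) free_alg set"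
  where "quot_lincomb X J F k h =
    (let T = tensor_algebra X in
      \<Oplus>\<^bsub>T Quot J\<^esub>b\<in>F. (J +>\<^bsub>T\<^esub> const (k b)) \<otimes>\<^bsub>T Quot J\<^esub> h b)"

text \<open>
  Linear independence over \<open>K\<close> of the family, indexed by \<open>b \<in> B\<close>, of rows
  \<open>((L b c)\<^sub>c, (E b e)\<^sub>e)\<close>, with \<open>L b c\<close> a class modulo \<^const>\<open>tensor_ge2\<close> and \<open>E b e\<close> a class
  modulo \<open>I'\<close>.
\<close>

definition rows_independent ::
    "'x set \<Rightarrow> ('x, 'k::field) free_alg set \<Rightarrow> 'm set \<Rightarrow> 'm set \<Rightarrow> 'm set \<Rightarrow>
     ('m \<Rightarrow> 'm \<Rightarrow> ('x, 'k) free_alg set) \<Rightarrow> ('m \<Rightarrow> 'm \<Rightarrow> ('x, 'k) free_alg set) \<Rightarrow> bool"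
  where "rows_independent X R B C D L E \<longleftrightarrow>
    (let T = tensor_algebra X; I' = decomposable_ideal X (relation_ideal X R) in
      \<forall>F k. finite F \<and> F \<subseteq> B \<and>
        (\<forall>c \<in> C. quot_lincomb X (tensor_ge2 X) F k (\<lambda>b. L b c) = \<zero>\<^bsub>T Quot tensor_ge2 X\<^esub>) \<and>
        (\<forall>e \<in> D. quot_lincomb X I' F k (\<lambda>b. E b e) = \<zero>\<^bsub>T Quot I'\<^esub>)
        \<longrightarrow> (\<forall>b \<in> F. k b = 0))"

end

theory Submission
  imports Defs "HOL-Library.Function_Algebras"
begin

text \<open>
  The proof reduces the criterion to the equality of row rank and column rank of one finite matrix
  over \<open>K\<close> in each cohomological degree.

  The Yoneda algebra may be computed from any resolution. Projectivity of one resolution and exactness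
  of the other give chain maps in both directions, and these carry cocycles to cocycles, coboundaries
  to coboundaries and products to products (\<open>lift_exists\<close>, \<open>lift_unique\<close>, \<open>transfer_decomposables\<close>).
  So \<open>P\<close> may be replaced by the minimal resolution \<open>Q\<close>, and a comparison with a resolution of length
  less than \<open>n\<close> shows that \<open>E\<^sup>n\<close> vanishes for \<open>n > proj_dim A\<close>.

  Since \<open>E\<^sup>0 = K\<close> and the product is associative, \<open>E(A)\<close> is generated by \<open>E\<^sup>1\<close> and \<open>E\<^sup>2\<close> if and only if
  \<open>E\<^sup>n = E\<^sup>1 E\<^sup>n\<^sup>-\<^sup>1 + E\<^sup>2 E\<^sup>n\<^sup>-\<^sup>2\<close> for all \<open>n > 2\<close> (\<open>K2_iff_decomposables\<close>).

  On \<open>Q\<close> every cochain kills the image of the differential, because that image lies in \<open>A\<^sub>+ Q\<close>. Hence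
  \<open>E\<^sup>n\<close> consists of cochains determined by their values on the basis \<open>B n\<close>, and it contains the
  dual basis. Products become matrix products, as follows, up to one nonzero scalar. If \<open>\<phi>\<close> lifts a cocycle \<open>g\<close> on \<open>Q\<^sup>n\<^sup>-\<^sup>1\<close>, then the
  coordinates of \<open>\<phi>\<^sub>1 b\<close> modulo \<open>A\<^sub>+\<close> are the coefficients of \<open>\<Sum>\<^sub>c g(c) L\<^sub>n(b,c)\<close> in the basis of \<open>V\<close>
  given by \<open>M\<^sub>1\<close> (\<open>product_1\<close>). If \<open>\<phi>\<close> lifts a cocycle \<open>g\<close> on \<open>Q\<^sup>n\<^sup>-\<^sup>2\<close>, then the coordinates of
  \<open>\<phi>\<^sub>2 b\<close> modulo \<open>A\<^sub>+\<close> are the coefficients of \<open>\<Sum>\<^sub>e g(e) E\<^sub>n(b,e)\<close> with respect to the relations, which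
  are linearly independent in \<open>I/I'\<close> (\<open>product_2\<close>, \<open>rel_independent\<close>). Therefore the scalars obtained
  by expanding the row of \<open>b\<close> in \<open>[L\<^sub>n : E\<^sub>n]\<close> form the row of \<open>b\<close> in a matrix \<open>v\<close> whose columns span
  \<open>E\<^sup>1 E\<^sup>n\<^sup>-\<^sup>1 + E\<^sup>2 E\<^sup>n\<^sup>-\<^sup>2\<close>, as functions on \<open>B n\<close> (\<open>coefficient_matrix\<close>).

  If the rows are independent and \<open>B n\<close> is finite, the columns span all functions on \<open>B n\<close>. Conversely,
  if the columns span the dual basis of \<open>B n\<close>, then \<open>B n\<close> is finite, because there are finitely many
  columns as soon as \<open>B (n - 1)\<close> and \<open>B (n - 2)\<close> are finite; moreover every column, hence every element
  of the dual basis, pairs to zero with a linear relation between the rows, which is therefore trivial.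
\<close>


section \<open>Graded modules and homogeneous parts\<close>

locale gmod =
  fixes A :: "('a, 'k::field) graded_algebra" and M :: "('a, 'm) gmodule"
  assumes graded: "graded_left_module A M"
begin

sublocale left_module A M
  using graded by (simp add: graded_left_module_def)

lemma mcomp_subgroup: "additive_subgroup (mcomp M d) M"
  using graded by (simp add: graded_left_module_def)

lemma mcomp_carrier: "x \<in> mcomp M d \<Longrightarrow> x \<in> carrier M"
  using additive_subgroup.a_Hcarr[OF mcomp_subgroup] by blast

lemma mcomp_zero [simp]: "\<zero>\<^bsub>M\<^esub> \<in> mcomp M d"
  using additive_subgroup.zero_closed[OF mcomp_subgroup] by blast

lemma mcomp_add: "\<lbrakk>x \<in> mcomp M d; y \<in> mcomp M d\<rbrakk> \<Longrightarrow> x \<oplus>\<^bsub>M\<^esub> y \<in> mcomp M d"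
  using additive_subgroup.a_closed[OF mcomp_subgroup] by blast

lemma mcomp_smult: "\<lbrakk>a \<in> acomp A i; x \<in> mcomp M d\<rbrakk> \<Longrightarrow> a \<odot>\<^bsub>M\<^esub> x \<in> mcomp M (int i + d)"
  using graded by (simp add: graded_left_module_def)

lemma smult_zero_right [simp]: "a \<in> carrier A \<Longrightarrow> a \<odot>\<^bsub>M\<^esub> \<zero>\<^bsub>M\<^esub> = \<zero>\<^bsub>M\<^esub>"
  using smult_r_distr[of a "\<zero>\<^bsub>M\<^esub>" "\<zero>\<^bsub>M\<^esub>"] smult_closed[of a "\<zero>\<^bsub>M\<^esub>"]
  by (metis M.add.l_cancel_one' M.l_zero M.zero_closed)

lemma smult_zero_left [simp]: "x \<in> carrier M \<Longrightarrow> \<zero>\<^bsub>A\<^esub> \<odot>\<^bsub>M\<^esub> x = \<zero>\<^bsub>M\<^esub>"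
  using smult_l_distr[of "\<zero>\<^bsub>A\<^esub>" "\<zero>\<^bsub>A\<^esub>" x] smult_closed[of "\<zero>\<^bsub>A\<^esub>" x]
  by (metis M.add.l_cancel_one' R.l_zero R.zero_closed)

definition hpart :: "int \<Rightarrow> 'm \<Rightarrow> 'm" where
  "hpart d x = (THE h. (\<forall>d. h d \<in> mcomp M d) \<and> finite {d. h d \<noteq> \<zero>\<^bsub>M\<^esub>} \<and>
        x = finsum M h {d. h d \<noteq> \<zero>\<^bsub>M\<^esub>}) d"

lemma hpart_ex1: "x \<in> carrier M \<Longrightarrow> \<exists>!h. (\<forall>d. h d \<in> mcomp M d) \<and> finite {d. h d \<noteq> \<zero>\<^bsub>M\<^esub>} \<and>
        x = finsum M h {d. h d \<noteq> \<zero>\<^bsub>M\<^esub>}"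
  using graded unfolding graded_left_module_def by blast

lemma hpart_spec:
  assumes "x \<in> carrier M"
  shows "(\<forall>d. hpart d x \<in> mcomp M d) \<and> finite {d. hpart d x \<noteq> \<zero>\<^bsub>M\<^esub>} \<and>
        x = finsum M (\<lambda>d. hpart d x) {d. hpart d x \<noteq> \<zero>\<^bsub>M\<^esub>}"
  using theI'[OF hpart_ex1[OF assms]] unfolding hpart_def by simp

lemma hpart_mcomp: "x \<in> carrier M \<Longrightarrow> hpart d x \<in> mcomp M d"
  using hpart_spec by blast

lemma hpart_carrier: "x \<in> carrier M \<Longrightarrow> hpart d x \<in> carrier M"
  using hpart_mcomp mcomp_carrier by blast

lemma finsum_support:
  assumes "finite D" "\<And>d. d \<in> D \<Longrightarrow> h d \<in> carrier M"
    and "E \<subseteq> D" "\<And>d. d \<in> D - E \<Longrightarrow> h d = \<zero>\<^bsub>M\<^esub>"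
  shows "finsum M h D = finsum M h E"
  using assms by (intro M.add.finprod_mono_neutral_cong_right) auto

lemma hpart_eqI:
  assumes D: "finite D" "\<And>d. d \<in> D \<Longrightarrow> h d \<in> mcomp M d"
  shows "hpart d (finsum M h D) = (if d \<in> D then h d else \<zero>\<^bsub>M\<^esub>)"
proof -
  define h' where "h' = (\<lambda>d. if d \<in> D then h d else \<zero>\<^bsub>M\<^esub>)"
  have hc: "\<And>d. d \<in> D \<Longrightarrow> h d \<in> carrier M" using D mcomp_carrier by blast
  have x: "finsum M h D \<in> carrier M" using hc by (intro M.finsum_closed) auto
  have sub: "{d. h' d \<noteq> \<zero>\<^bsub>M\<^esub>} \<subseteq> D" by (auto simp: h'_def)
  have "finsum M h D = finsum M h' D"
    using hc by (intro M.finsum_cong') (auto simp: h'_def)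
  also have "\<dots> = finsum M h' {d. h' d \<noteq> \<zero>\<^bsub>M\<^esub>}"
    using D(1) hc sub by (intro finsum_support) (auto simp: h'_def)
  finally have e: "finsum M h D = finsum M h' {d. h' d \<noteq> \<zero>\<^bsub>M\<^esub>}" .
  have "(\<forall>d. h' d \<in> mcomp M d) \<and> finite {d. h' d \<noteq> \<zero>\<^bsub>M\<^esub>}"
    using D finite_subset[OF sub] by (simp add: h'_def)
  with e have "(\<forall>d. h' d \<in> mcomp M d) \<and> finite {d. h' d \<noteq> \<zero>\<^bsub>M\<^esub>} \<and>
        finsum M h D = finsum M h' {d. h' d \<noteq> \<zero>\<^bsub>M\<^esub>}"
    by blast
  then have "(\<lambda>d. hpart d (finsum M h D)) = h'"
    using the1_equality[OF hpart_ex1[OF x], of h'] unfolding hpart_def by presburger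
  then show ?thesis by (metis h'_def)
qed

lemma hpart_homog: "x \<in> mcomp M e \<Longrightarrow> hpart d x = (if d = e then x else \<zero>\<^bsub>M\<^esub>)"
  using hpart_eqI[of "{e}" "\<lambda>_. x" d] mcomp_carrier by (auto split: if_splits)

text \<open>
  Adding the two decompositions over a common finite set of degrees gives a decomposition of the
  sum, and decompositions are unique.
\<close>

lemma hpart_add:
  assumes "x \<in> carrier M" "y \<in> carrier M"
  shows "hpart d (x \<oplus>\<^bsub>M\<^esub> y) = hpart d x \<oplus>\<^bsub>M\<^esub> hpart d y"
proof -
  let ?D = "insert d ({d. hpart d x \<noteq> \<zero>\<^bsub>M\<^esub>} \<union> {d. hpart d y \<noteq> \<zero>\<^bsub>M\<^esub>})"
  have fin: "finite ?D" using hpart_spec assms by auto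
  have "x = finsum M (\<lambda>d. hpart d x) {d. hpart d x \<noteq> \<zero>\<^bsub>M\<^esub>}" using hpart_spec assms by blast
  also have "\<dots> = finsum M (\<lambda>d. hpart d x) ?D"
    using assms hpart_carrier fin by (intro finsum_support[symmetric]) auto
  finally have x: "x = finsum M (\<lambda>d. hpart d x) ?D" .
  have "y = finsum M (\<lambda>d. hpart d y) {d. hpart d y \<noteq> \<zero>\<^bsub>M\<^esub>}" using hpart_spec assms by blast
  also have "\<dots> = finsum M (\<lambda>d. hpart d y) ?D"
    using assms hpart_carrier fin by (intro finsum_support[symmetric]) auto
  finally have y: "y = finsum M (\<lambda>d. hpart d y) ?D" .
  have "x \<oplus>\<^bsub>M\<^esub> y = finsum M (\<lambda>d. hpart d x \<oplus>\<^bsub>M\<^esub> hpart d y) ?D"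
    by (subst x, subst y, rule M.finsum_addf[symmetric]) (use assms hpart_carrier in auto)
  then show ?thesis
    using hpart_eqI[OF fin, of "\<lambda>d. hpart d x \<oplus>\<^bsub>M\<^esub> hpart d y" d] hpart_mcomp mcomp_add assms by auto
qed

lemma finsum_induct:
  assumes "finite D" "\<And>d. d \<in> D \<Longrightarrow> h d \<in> carrier M" "\<And>d. d \<in> D \<Longrightarrow> Pr (h d)" "Pr \<zero>\<^bsub>M\<^esub>"
    and "\<And>x y. \<lbrakk>x \<in> carrier M; y \<in> carrier M; Pr x; Pr y\<rbrakk> \<Longrightarrow> Pr (x \<oplus>\<^bsub>M\<^esub> y)"
  shows "Pr (finsum M h D)"
  using assms(1-3)
proof (induction D rule: finite_induct)
  case empty
  then show ?case using assms(4) by simp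
next
  case (insert d D)
  then have "finsum M h (insert d D) = h d \<oplus>\<^bsub>M\<^esub> finsum M h D"
    by (intro M.finsum_insert) auto
  moreover have "finsum M h D \<in> carrier M" using insert.prems by (intro M.finsum_closed) auto
  ultimately show ?case using insert assms(5) by auto
qed

text \<open>
  An additive statement needs a proof for homogeneous elements only; with this rule most arguments
  about decompositions avoid finite sums.
\<close>

lemma homogeneous_induct [consumes 1, case_names homogeneous add]:
  assumes "x \<in> carrier M" "\<And>d x. x \<in> mcomp M d \<Longrightarrow> Pr x"
    and "\<And>x y. \<lbrakk>x \<in> carrier M; y \<in> carrier M; Pr x; Pr y\<rbrakk> \<Longrightarrow> Pr (x \<oplus>\<^bsub>M\<^esub> y)"
  shows "Pr x"
proof -
  let ?D = "{d. hpart d x \<noteq> \<zero>\<^bsub>M\<^esub>}"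
  have "Pr (finsum M (\<lambda>d. hpart d x) ?D)"
  proof (rule finsum_induct)
    show "finite ?D" using hpart_spec[OF assms(1)] by blast
  qed (use hpart_mcomp[OF assms(1)] hpart_carrier[OF assms(1)] assms(2,3) mcomp_zero in auto)
  then show ?thesis using hpart_spec[OF assms(1)] by simp
qed

end


section \<open>Homogeneous bases and coordinates\<close>

locale gfree = gmod A M for A :: "('a, 'k::field) graded_algebra" and M :: "('a, 'm) gmodule" +
  fixes B :: "'m set"
  assumes basis: "homogeneous_basis A M B"
begin

lemma basis_homogeneous: "b \<in> B \<Longrightarrow> \<exists>d. b \<in> mcomp M d"
  using basis unfolding homogeneous_basis_def by blast

lemma basis_carrier: "b \<in> B \<Longrightarrow> b \<in> carrier M"
  using basis_homogeneous mcomp_carrier by blast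

definition coord :: "'m \<Rightarrow> 'm \<Rightarrow> 'a" where
  "coord x = (THE a. (\<forall>b \<in> B. a b \<in> carrier A) \<and> (\<forall>b. b \<notin> B \<longrightarrow> a b = \<zero>\<^bsub>A\<^esub>) \<and>
        finite {b. a b \<noteq> \<zero>\<^bsub>A\<^esub>} \<and> x = (\<Oplus>\<^bsub>M\<^esub>b\<in>{b. a b \<noteq> \<zero>\<^bsub>A\<^esub>}. a b \<odot>\<^bsub>M\<^esub> b))"

lemma coord_ex1: "x \<in> carrier M \<Longrightarrow>
    \<exists>!a. (\<forall>b \<in> B. a b \<in> carrier A) \<and> (\<forall>b. b \<notin> B \<longrightarrow> a b = \<zero>\<^bsub>A\<^esub>) \<and>
        finite {b. a b \<noteq> \<zero>\<^bsub>A\<^esub>} \<and> x = (\<Oplus>\<^bsub>M\<^esub>b\<in>{b. a b \<noteq> \<zero>\<^bsub>A\<^esub>}. a b \<odot>\<^bsub>M\<^esub> b)"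
  using basis unfolding homogeneous_basis_def by blast

lemma coord_spec:
  assumes "x \<in> carrier M"
  shows "(\<forall>b \<in> B. coord x b \<in> carrier A) \<and> (\<forall>b. b \<notin> B \<longrightarrow> coord x b = \<zero>\<^bsub>A\<^esub>) \<and>
        finite {b. coord x b \<noteq> \<zero>\<^bsub>A\<^esub>} \<and>
        x = (\<Oplus>\<^bsub>M\<^esub>b\<in>{b. coord x b \<noteq> \<zero>\<^bsub>A\<^esub>}. coord x b \<odot>\<^bsub>M\<^esub> b)"
  using theI'[OF coord_ex1[OF assms]] unfolding coord_def by simp

lemma coord_carrier: "x \<in> carrier M \<Longrightarrow> coord x b \<in> carrier A"
  using coord_spec by (metis R.zero_closed)

lemma coord_support: "x \<in> carrier M \<Longrightarrow> finite {b. coord x b \<noteq> \<zero>\<^bsub>A\<^esub>} \<and> {b. coord x b \<noteq> \<zero>\<^bsub>A\<^esub>} \<subseteq> B"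
  using coord_spec by blast

lemma coord_expansion:
  assumes "x \<in> carrier M" "finite D" "{b. coord x b \<noteq> \<zero>\<^bsub>A\<^esub>} \<subseteq> D" "D \<subseteq> B"
  shows "x = (\<Oplus>\<^bsub>M\<^esub>b\<in>D. coord x b \<odot>\<^bsub>M\<^esub> b)"
proof -
  have "x = (\<Oplus>\<^bsub>M\<^esub>b\<in>{b. coord x b \<noteq> \<zero>\<^bsub>A\<^esub>}. coord x b \<odot>\<^bsub>M\<^esub> b)" using coord_spec assms by blast
  also have "\<dots> = (\<Oplus>\<^bsub>M\<^esub>b\<in>D. coord x b \<odot>\<^bsub>M\<^esub> b)"
    using assms coord_carrier basis_carrier smult_closed
    by (intro finsum_support[symmetric]) (auto simp: subset_iff)
  finally show ?thesis .
qed

lemma coord_eqI: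
  assumes D: "finite D" "D \<subseteq> B" "\<And>b. b \<in> D \<Longrightarrow> a b \<in> carrier A"
  shows "coord (\<Oplus>\<^bsub>M\<^esub>b\<in>D. a b \<odot>\<^bsub>M\<^esub> b) b = (if b \<in> D then a b else \<zero>\<^bsub>A\<^esub>)"
proof -
  define a' where "a' = (\<lambda>d. if d \<in> D then a d else \<zero>\<^bsub>A\<^esub>)"
  let ?x = "\<Oplus>\<^bsub>M\<^esub>b\<in>D. a b \<odot>\<^bsub>M\<^esub> b"
  have c: "\<And>b. b \<in> D \<Longrightarrow> a b \<odot>\<^bsub>M\<^esub> b \<in> carrier M"
    using D basis_carrier smult_closed by blast
  have x: "?x \<in> carrier M" using c by (intro M.finsum_closed) auto
  have sub: "{d. a' d \<noteq> \<zero>\<^bsub>A\<^esub>} \<subseteq> D" by (auto simp: a'_def)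
  have "?x = (\<Oplus>\<^bsub>M\<^esub>b\<in>D. a' b \<odot>\<^bsub>M\<^esub> b)"
    using c by (intro M.finsum_cong') (auto simp: a'_def)
  also have "\<dots> = (\<Oplus>\<^bsub>M\<^esub>b\<in>{d. a' d \<noteq> \<zero>\<^bsub>A\<^esub>}. a' b \<odot>\<^bsub>M\<^esub> b)"
    using D c sub basis_carrier by (intro finsum_support) (auto simp: a'_def)
  finally have e: "?x = (\<Oplus>\<^bsub>M\<^esub>b\<in>{b. a' b \<noteq> \<zero>\<^bsub>A\<^esub>}. a' b \<odot>\<^bsub>M\<^esub> b)" .
  have "(\<forall>b \<in> B. a' b \<in> carrier A) \<and> (\<forall>b. b \<notin> B \<longrightarrow> a' b = \<zero>\<^bsub>A\<^esub>) \<and> finite {b. a' b \<noteq> \<zero>\<^bsub>A\<^esub>}"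
    using D finite_subset[OF sub] by (auto simp: a'_def)
  with e have "(\<forall>b \<in> B. a' b \<in> carrier A) \<and> (\<forall>b. b \<notin> B \<longrightarrow> a' b = \<zero>\<^bsub>A\<^esub>) \<and>
        finite {b. a' b \<noteq> \<zero>\<^bsub>A\<^esub>} \<and> ?x = (\<Oplus>\<^bsub>M\<^esub>b\<in>{b. a' b \<noteq> \<zero>\<^bsub>A\<^esub>}. a' b \<odot>\<^bsub>M\<^esub> b)"
    by blast
  then have "coord ?x = a'"
    using the1_equality[OF coord_ex1[OF x], of a'] unfolding coord_def by presburger
  then show ?thesis by (metis a'_def)
qed

lemma coord_basis: "b \<in> B \<Longrightarrow> coord b c = (if c = b then \<one>\<^bsub>A\<^esub> else \<zero>\<^bsub>A\<^esub>)"
  using coord_eqI[of "{b}" "\<lambda>_. \<one>\<^bsub>A\<^esub>" c] basis_carrier smult_one by auto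

lemma coord_smult_basis: "\<lbrakk>b \<in> B; a \<in> carrier A\<rbrakk> \<Longrightarrow> coord (a \<odot>\<^bsub>M\<^esub> b) c = (if c = b then a else \<zero>\<^bsub>A\<^esub>)"
  using coord_eqI[of "{b}" "\<lambda>_. a" c] basis_carrier smult_closed by auto

lemma coord_zero [simp]: "coord \<zero>\<^bsub>M\<^esub> c = \<zero>\<^bsub>A\<^esub>"
  using coord_eqI[of "{}" "\<lambda>_. \<zero>\<^bsub>A\<^esub>" c] by simp

text \<open>
  As for homogeneous parts: the sum of two expansions over a common finite set of basis elements is
  an expansion.
\<close>

lemma coord_add:
  assumes "x \<in> carrier M" "y \<in> carrier M"
  shows "coord (x \<oplus>\<^bsub>M\<^esub> y) b = coord x b \<oplus>\<^bsub>A\<^esub> coord y b"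
proof -
  let ?D = "{b. coord x b \<noteq> \<zero>\<^bsub>A\<^esub>} \<union> {b. coord y b \<noteq> \<zero>\<^bsub>A\<^esub>}"
  have D: "finite ?D" "?D \<subseteq> B" using coord_support assms by auto
  have c: "coord x b \<in> carrier A" "coord y b \<in> carrier A" for b
    using assms coord_carrier by auto
  have bc: "b \<in> ?D \<Longrightarrow> b \<in> carrier M" for b using D(2) basis_carrier by blast
  have "x \<oplus>\<^bsub>M\<^esub> y = (\<Oplus>\<^bsub>M\<^esub>b\<in>?D. coord x b \<odot>\<^bsub>M\<^esub> b) \<oplus>\<^bsub>M\<^esub> (\<Oplus>\<^bsub>M\<^esub>b\<in>?D. coord y b \<odot>\<^bsub>M\<^esub> b)"
    using coord_expansion[of x ?D] coord_expansion[of y ?D] assms D by auto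
  also have "\<dots> = (\<Oplus>\<^bsub>M\<^esub>b\<in>?D. coord x b \<odot>\<^bsub>M\<^esub> b \<oplus>\<^bsub>M\<^esub> coord y b \<odot>\<^bsub>M\<^esub> b)"
    using c bc smult_closed by (intro M.finsum_addf[symmetric]) auto
  also have "\<dots> = (\<Oplus>\<^bsub>M\<^esub>b\<in>?D. (coord x b \<oplus>\<^bsub>A\<^esub> coord y b) \<odot>\<^bsub>M\<^esub> b)"
    using c bc smult_closed smult_l_distr by (intro M.finsum_cong') auto
  finally have "coord (x \<oplus>\<^bsub>M\<^esub> y) b = (if b \<in> ?D then coord x b \<oplus>\<^bsub>A\<^esub> coord y b else \<zero>\<^bsub>A\<^esub>)"
    using coord_eqI[OF D, of "\<lambda>b. coord x b \<oplus>\<^bsub>A\<^esub> coord y b" b] c by auto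
  then show ?thesis using c by auto
qed

text \<open>
  The counterpart of \<open>homogeneous_induct\<close> for a basis: additive statements are checked on multiples
  of basis elements.
\<close>

lemma basis_induct [consumes 1, case_names multiple zero add]:
  assumes "x \<in> carrier M" "\<And>a b. \<lbrakk>b \<in> B; a \<in> carrier A\<rbrakk> \<Longrightarrow> Pr (a \<odot>\<^bsub>M\<^esub> b)" "Pr \<zero>\<^bsub>M\<^esub>"
    and "\<And>x y. \<lbrakk>x \<in> carrier M; y \<in> carrier M; Pr x; Pr y\<rbrakk> \<Longrightarrow> Pr (x \<oplus>\<^bsub>M\<^esub> y)"
  shows "Pr x"
proof -
  let ?D = "{b. coord x b \<noteq> \<zero>\<^bsub>A\<^esub>}"
  have D: "finite ?D" "?D \<subseteq> B" using coord_support assms by auto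
  have "Pr (finsum M (\<lambda>b. coord x b \<odot>\<^bsub>M\<^esub> b) ?D)"
  proof (rule finsum_induct)
    show "finite ?D" by (rule D(1))
    show "coord x b \<odot>\<^bsub>M\<^esub> b \<in> carrier M" if "b \<in> ?D" for b
      using that D(2) coord_carrier[OF assms(1)] basis_carrier smult_closed by blast
    show "Pr (coord x b \<odot>\<^bsub>M\<^esub> b)" if "b \<in> ?D" for b
      using that D(2) coord_carrier[OF assms(1)] assms(2) by blast
  qed (use assms(3,4) in auto)
  then show ?thesis using coord_spec[OF assms(1)] by simp
qed

lemma coord_smult:
  assumes "a \<in> carrier A" "x \<in> carrier M"
  shows "coord (a \<odot>\<^bsub>M\<^esub> x) c = a \<otimes>\<^bsub>A\<^esub> coord x c"
  using assms(2)
proof (induction rule: basis_induct)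
  case (multiple a' b)
  then have "a \<odot>\<^bsub>M\<^esub> (a' \<odot>\<^bsub>M\<^esub> b) = (a \<otimes>\<^bsub>A\<^esub> a') \<odot>\<^bsub>M\<^esub> b"
    using smult_assoc assms basis_carrier by simp
  then show ?case using multiple assms coord_smult_basis by auto
next
  case zero
  then show ?case using assms by simp
next
  case (add x y)
  then show ?case
    using assms coord_add coord_carrier smult_closed smult_r_distr R.r_distr by simp
qed

end


section \<open>Linear maps\<close>

text \<open>
  Vanishing outside the carrier makes two linear maps that agree on the carrier equal as functions,
  and makes their values total.
\<close>

definition lin_map :: "('a, 'k::field) graded_algebra \<Rightarrow> ('a, 'm) gmodule \<Rightarrow> ('a, 'n) gmodule \<Rightarrow> ('m \<Rightarrow> 'n) \<Rightarrow> bool"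
  where "lin_map A M N f \<longleftrightarrow> f \<in> carrier M \<rightarrow> carrier N \<and> (\<forall>x. x \<notin> carrier M \<longrightarrow> f x = \<zero>\<^bsub>N\<^esub>) \<and>
        (\<forall>x \<in> carrier M. \<forall>y \<in> carrier M. f (x \<oplus>\<^bsub>M\<^esub> y) = f x \<oplus>\<^bsub>N\<^esub> f y) \<and>
        (\<forall>a \<in> carrier A. \<forall>x \<in> carrier M. f (a \<odot>\<^bsub>M\<^esub> x) = a \<odot>\<^bsub>N\<^esub> f x)"

lemma hom_deg_iff: "f \<in> hom_deg A M N e \<longleftrightarrow>
    lin_map A M N f \<and> (\<forall>d. \<forall>x \<in> mcomp M d. f x \<in> mcomp N (d + e))"
  by (auto simp: hom_deg_def lin_map_def)

lemma lin_map_carrier: "lin_map A M N f \<Longrightarrow> x \<in> carrier M \<Longrightarrow> f x \<in> carrier N"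
  and lin_map_outside: "lin_map A M N f \<Longrightarrow> x \<notin> carrier M \<Longrightarrow> f x = \<zero>\<^bsub>N\<^esub>"
  and lin_map_add: "lin_map A M N f \<Longrightarrow> x \<in> carrier M \<Longrightarrow> y \<in> carrier M \<Longrightarrow> f (x \<oplus>\<^bsub>M\<^esub> y) = f x \<oplus>\<^bsub>N\<^esub> f y"
  and lin_map_smult: "lin_map A M N f \<Longrightarrow> a \<in> carrier A \<Longrightarrow> x \<in> carrier M \<Longrightarrow> f (a \<odot>\<^bsub>M\<^esub> x) = a \<odot>\<^bsub>N\<^esub> f x"
  by (auto simp: lin_map_def)

lemma lin_map_zero:
  assumes "abelian_group M" "abelian_group N" "lin_map A M N f"
  shows "f \<zero>\<^bsub>M\<^esub> = \<zero>\<^bsub>N\<^esub>"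
proof -
  interpret M: abelian_group M by fact
  interpret N: abelian_group N by fact
  have "f \<zero>\<^bsub>M\<^esub> = f \<zero>\<^bsub>M\<^esub> \<oplus>\<^bsub>N\<^esub> f \<zero>\<^bsub>M\<^esub>" using lin_map_add[OF assms(3), of "\<zero>\<^bsub>M\<^esub>" "\<zero>\<^bsub>M\<^esub>"] by simp
  then show ?thesis
    using lin_map_carrier[OF assms(3), of "\<zero>\<^bsub>M\<^esub>"] by simp
qed

lemma lin_map_finsum:
  assumes "abelian_group M" "abelian_group N" "lin_map A M N f"
    and "finite D" "\<And>d. d \<in> D \<Longrightarrow> h d \<in> carrier M"
  shows "f (finsum M h D) = finsum N (\<lambda>d. f (h d)) D"
proof -
  interpret M: abelian_group M by fact
  interpret N: abelian_group N by fact
  show ?thesis using assms(4,5)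
  proof (induction D rule: finite_induct)
    case empty
    then show ?case using lin_map_zero[OF assms(1-3)] by simp
  next
    case (insert d D)
    then have "finsum M h (insert d D) = h d \<oplus>\<^bsub>M\<^esub> finsum M h D"
      by (intro M.finsum_insert) auto
    moreover have "finsum N (\<lambda>d. f (h d)) (insert d D) = f (h d) \<oplus>\<^bsub>N\<^esub> finsum N (\<lambda>d. f (h d)) D"
      using insert lin_map_carrier[OF assms(3)] by (intro N.finsum_insert) auto
    moreover have "finsum M h D \<in> carrier M" using insert.prems by (intro M.finsum_closed) auto
    ultimately show ?case using insert lin_map_add[OF assms(3)] by auto
  qed
qed

lemma lin_map_minus:
  assumes "abelian_group M" "abelian_group N" "lin_map A M N f" "x \<in> carrier M" "y \<in> carrier M"
  shows "f (x \<ominus>\<^bsub>M\<^esub> y) = f x \<ominus>\<^bsub>N\<^esub> f y"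
proof -
  interpret M: abelian_group M by fact
  interpret N: abelian_group N by fact
  have "f (x \<ominus>\<^bsub>M\<^esub> y) \<oplus>\<^bsub>N\<^esub> f y = f ((x \<ominus>\<^bsub>M\<^esub> y) \<oplus>\<^bsub>M\<^esub> y)"
    using lin_map_add[OF assms(3)] assms by simp
  also have "(x \<ominus>\<^bsub>M\<^esub> y) \<oplus>\<^bsub>M\<^esub> y = x"
    using assms by (simp add: a_minus_def M.a_assoc M.l_neg)
  finally show ?thesis
    using lin_map_carrier[OF assms(3)] assms
    by (metis M.minus_closed N.add.inv_solve_right a_minus_def)
qed

lemma lin_map_comp:
  assumes "lin_map A M N f" "lin_map A L M g" "abelian_group M" "abelian_group N"
  shows "lin_map A L N (f \<circ> g)"
  using assms lin_map_zero[OF assms(3,4,1)] by (auto simp: lin_map_def Pi_iff)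

text \<open>
  Both sides are additive in \<open>x\<close>, and for homogeneous \<open>x\<close> both are \<open>f x\<close> or zero, according to the
  degree.
\<close>

lemma hpart_shift:
  assumes "gmod A M" "gmod A N" "f \<in> hom_deg A M N e" "x \<in> carrier M"
  shows "gmod.hpart N (d + e) (f x) = f (gmod.hpart M d x)"
proof -
  interpret M: gmod A M by fact
  interpret N: gmod A N by fact
  have f: "lin_map A M N f" and fd: "\<And>d x. x \<in> mcomp M d \<Longrightarrow> f x \<in> mcomp N (d + e)"
    using assms(3) by (auto simp: hom_deg_iff)
  note f0 = lin_map_zero[OF M.M.abelian_group_axioms N.M.abelian_group_axioms f]
  show ?thesis using assms(4)
  proof (induction rule: M.homogeneous_induct)
    case (homogeneous d' x)
    then show ?case using N.hpart_homog[OF fd[OF homogeneous]] M.hpart_homog[OF homogeneous] f0 by simp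
  next
    case (add x y)
    then show ?case
      using f by (simp add: lin_map_add lin_map_carrier M.hpart_add N.hpart_add M.hpart_carrier)
  qed
qed


section \<open>Graded homomorphisms\<close>

lemma (in gmod) smult_finsum:
  assumes "finite D" "a \<in> carrier A" "\<And>d. d \<in> D \<Longrightarrow> h d \<in> carrier M"
  shows "a \<odot>\<^bsub>M\<^esub> finsum M h D = (\<Oplus>\<^bsub>M\<^esub>d\<in>D. a \<odot>\<^bsub>M\<^esub> h d)"
  using assms(1,3)
proof (induction D rule: finite_induct)
  case empty
  then show ?case using assms by simp
next
  case (insert d D)
  have "finsum M h (insert d D) = h d \<oplus>\<^bsub>M\<^esub> finsum M h D"
    using insert by (intro M.finsum_insert) auto
  moreover have "(\<Oplus>\<^bsub>M\<^esub>d\<in>insert d D. a \<odot>\<^bsub>M\<^esub> h d) = a \<odot>\<^bsub>M\<^esub> h d \<oplus>\<^bsub>M\<^esub> (\<Oplus>\<^bsub>M\<^esub>d\<in>D. a \<odot>\<^bsub>M\<^esub> h d)"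
    using insert assms smult_closed by (intro M.finsum_insert) auto
  moreover have "finsum M h D \<in> carrier M" using insert.prems by (intro M.finsum_closed) auto
  ultimately show ?case using insert assms smult_r_distr by auto
qed

lemma (in gmod) a_inv_zero [simp]: "\<ominus>\<^bsub>M\<^esub> \<zero>\<^bsub>M\<^esub> = \<zero>\<^bsub>M\<^esub>"
  using M.r_neg[of "\<zero>\<^bsub>M\<^esub>"] by (metis M.a_inv_closed M.l_zero M.zero_closed)

lemma (in gmod) abelian: "abelian_group M" by (rule M.abelian_group_axioms)

lemma hom_deg_lin: "f \<in> hom_deg A M N e \<Longrightarrow> lin_map A M N f"
  by (simp add: hom_deg_iff)

lemma lin_map_closed:
  assumes "gmod A N" "lin_map A M N f"
  shows "f x \<in> carrier N"
proof -
  interpret N: gmod A N by fact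
  show ?thesis using assms(2) lin_map_carrier lin_map_outside N.M.zero_closed by metis
qed

lemma hom_deg_closed: "\<lbrakk>gmod A N; f \<in> hom_deg A M N e\<rbrakk> \<Longrightarrow> f x \<in> carrier N"
  by (rule lin_map_closed[OF _ hom_deg_lin])

lemma hom_deg_comp:
  assumes "gmod A M" "gmod A N" "f \<in> hom_deg A M N e" "g \<in> hom_deg A L M e'"
  shows "f \<circ> g \<in> hom_deg A L N (e' + e)"
proof -
  have "lin_map A L N (f \<circ> g)"
    using lin_map_comp[OF hom_deg_lin[OF assms(3)] hom_deg_lin[OF assms(4)] gmod.abelian[OF assms(1)] gmod.abelian[OF assms(2)]] .
  moreover have "(f \<circ> g) x \<in> mcomp N (d + (e' + e))" if "x \<in> mcomp L d" for x d
  proof -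
    have "g x \<in> mcomp M (d + e')" using assms(4) that by (simp add: hom_deg_iff)
    then have "f (g x) \<in> mcomp N (d + e' + e)" using assms(3) by (simp add: hom_deg_iff)
    then show ?thesis by (simp add: add.assoc)
  qed
  ultimately show ?thesis by (simp add: hom_deg_iff)
qed

lemma hom_deg_zero:
  assumes "gmod A M" "gmod A N"
  shows "(\<lambda>x. \<zero>\<^bsub>N\<^esub>) \<in> hom_deg A M N e"
proof -
  interpret N: gmod A N by fact
  show ?thesis by (auto simp: hom_deg_iff lin_map_def)
qed

lemma graded_hom_zero: "(\<lambda>x. \<zero>\<^bsub>N\<^esub>) \<in> graded_hom A M N" if "gmod A N"
proof -
  interpret N: gmod A N by fact
  show ?thesis unfolding graded_hom_def
    by (rule CollectI, rule exI[of _ "{}"]) simp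
qed

lemma hom_deg_graded_hom:
  assumes "gmod A N" "f \<in> hom_deg A M N e"
  shows "f \<in> graded_hom A M N"
proof -
  interpret N: gmod A N by fact
  have "f = (\<lambda>x. \<Oplus>\<^bsub>N\<^esub>e\<in>{e}. f x)"
    using lin_map_closed[OF assms(1) hom_deg_lin[OF assms(2)]] by simp
  then show ?thesis using assms(2) unfolding graded_hom_def by (intro CollectI exI[of _ "{e}"] exI[of _ "\<lambda>_. f"]) simp
qed

text \<open>
  A graded homomorphism is a finite sum of homogeneous ones, so closure properties can be proved by
  adding one homogeneous summand at a time.
\<close>

lemma graded_hom_induct [consumes 2, case_names zero add]:
  assumes "gmod A N" "f \<in> graded_hom A M N" "Pr (\<lambda>x. \<zero>\<^bsub>N\<^esub>)"
    and step: "\<And>f g e. \<lbrakk>f \<in> hom_deg A M N e; g \<in> graded_hom A M N; Pr g\<rbrakk> \<Longrightarrow> Pr (\<lambda>x. f x \<oplus>\<^bsub>N\<^esub> g x)"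
  shows "Pr f"
proof -
  interpret N: gmod A N by fact
  obtain D h where D: "finite D" "\<forall>e\<in>D. h e \<in> hom_deg A M N e" and f: "f = (\<lambda>x. \<Oplus>\<^bsub>N\<^esub>e\<in>D. h e x)"
    using assms(2) unfolding graded_hom_def by blast
  have "Pr (\<lambda>x. \<Oplus>\<^bsub>N\<^esub>e\<in>D. h e x)" using D
  proof (induction D rule: finite_induct)
    case empty
    then show ?case using assms(3) by simp
  next
    case (insert e D)
    have "h e' x \<in> carrier N" if "e' \<in> insert e D" for x e'
      by (rule hom_deg_closed[OF assms(1) insert.prems[rule_format, OF that]])
    then have "(\<Oplus>\<^bsub>N\<^esub>e\<in>insert e D. h e x) = h e x \<oplus>\<^bsub>N\<^esub> (\<Oplus>\<^bsub>N\<^esub>e\<in>D. h e x)" for x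
      using insert.hyps by (intro N.M.finsum_insert) auto
    moreover have "(\<lambda>x. \<Oplus>\<^bsub>N\<^esub>e\<in>D. h e x) \<in> graded_hom A M N"
      using insert unfolding graded_hom_def by blast
    ultimately show ?case using step[of "h e" e "\<lambda>x. \<Oplus>\<^bsub>N\<^esub>e\<in>D. h e x"] insert by simp
  qed
  then show ?thesis using f by simp
qed

lemma lin_map_plus:
  assumes "gmod A M" "gmod A N" "lin_map A M N f" "lin_map A M N g"
  shows "lin_map A M N (\<lambda>x. f x \<oplus>\<^bsub>N\<^esub> g x)"
proof -
  interpret M: gmod A M by fact
  interpret N: gmod A N by fact
  note c = lin_map_closed[OF assms(2,3)] lin_map_closed[OF assms(2,4)]
  show ?thesis
    using assms(3,4) c unfolding lin_map_def
    by (auto simp: N.M.a_ac N.smult_r_distr)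
qed

lemma graded_hom_lin:
  assumes "gmod A M" "gmod A N" "f \<in> graded_hom A M N"
  shows "lin_map A M N f"
  using assms(2,3)
proof (induction rule: graded_hom_induct)
  case zero
  then show ?case using hom_deg_lin[OF hom_deg_zero[OF assms(1,2)]] by simp
next
  case (add f g e)
  then show ?case using lin_map_plus[OF assms(1,2) hom_deg_lin] by simp
qed

lemma hom_deg_plus:
  assumes "gmod A M" "gmod A N" "f \<in> hom_deg A M N e" "g \<in> hom_deg A M N e"
  shows "(\<lambda>x. f x \<oplus>\<^bsub>N\<^esub> g x) \<in> hom_deg A M N e"
  using assms lin_map_plus[OF assms(1,2)] gmod.mcomp_add[OF assms(2)] by (auto simp: hom_deg_iff)

text \<open>
  The degree of the new summand may already occur in the decomposition of \<open>g\<close>; in that case the two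
  summands of this degree are merged.
\<close>

lemma hom_deg_plus_graded_hom:
  assumes "gmod A M" "gmod A N" "f \<in> hom_deg A M N e" "g \<in> graded_hom A M N"
  shows "(\<lambda>x. f x \<oplus>\<^bsub>N\<^esub> g x) \<in> graded_hom A M N"
proof -
  interpret N: gmod A N by fact
  obtain D h where D: "finite D" "\<forall>e\<in>D. h e \<in> hom_deg A M N e" and g: "g = (\<lambda>x. \<Oplus>\<^bsub>N\<^esub>e\<in>D. h e x)"
    using assms(4) unfolding graded_hom_def by blast
  note fc = lin_map_closed[OF assms(2) hom_deg_lin[OF assms(3)]]
  have hc: "h e' x \<in> carrier N" if "e' \<in> D" for x e'
    by (rule hom_deg_closed[OF assms(2) D(2)[rule_format, OF that]])
  define h' where "h' = h(e := if e \<in> D then (\<lambda>x. f x \<oplus>\<^bsub>N\<^esub> h e x) else f)"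
  have "h' e' \<in> hom_deg A M N e'" if "e' \<in> insert e D" for e'
    using that D assms(3) hom_deg_plus[OF assms(1,2,3)] by (auto simp: h'_def)
  moreover have "f x \<oplus>\<^bsub>N\<^esub> g x = (\<Oplus>\<^bsub>N\<^esub>e'\<in>insert e D. h' e' x)" for x
  proof -
    have rest: "(\<Oplus>\<^bsub>N\<^esub>e'\<in>D - {e}. h' e' x) = (\<Oplus>\<^bsub>N\<^esub>e'\<in>D - {e}. h e' x)"
      using hc by (intro N.M.finsum_cong') (auto simp: h'_def)
    have cl: "(\<Oplus>\<^bsub>N\<^esub>e'\<in>D - {e}. h e' x) \<in> carrier N"
      using hc by (intro N.M.finsum_closed) auto
    have h'c: "h' e x \<in> carrier N" "e' \<in> D - {e} \<Longrightarrow> h' e' x \<in> carrier N" for e'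
      using fc hc by (auto simp: h'_def)
    have "(\<Oplus>\<^bsub>N\<^esub>e'\<in>insert e (D - {e}). h' e' x) = h' e x \<oplus>\<^bsub>N\<^esub> (\<Oplus>\<^bsub>N\<^esub>e'\<in>D - {e}. h' e' x)"
      using D h'c by (intro N.M.finsum_insert) auto
    then have 1: "(\<Oplus>\<^bsub>N\<^esub>e'\<in>insert e D. h' e' x) = h' e x \<oplus>\<^bsub>N\<^esub> (\<Oplus>\<^bsub>N\<^esub>e'\<in>D - {e}. h e' x)"
      using rest by simp
    show ?thesis
    proof (cases "e \<in> D")
      case True
      have "(\<Oplus>\<^bsub>N\<^esub>e'\<in>insert e (D - {e}). h e' x) = h e x \<oplus>\<^bsub>N\<^esub> (\<Oplus>\<^bsub>N\<^esub>e'\<in>D - {e}. h e' x)"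
        using D hc True by (intro N.M.finsum_insert) auto
      moreover have "insert e (D - {e}) = D" using True by blast
      ultimately show ?thesis using 1 True fc hc cl by (simp add: g h'_def N.M.a_assoc)
    next
      case False
      then show ?thesis using 1 by (simp add: g h'_def)
    qed
  qed
  ultimately show ?thesis using D unfolding graded_hom_def
    by (intro CollectI exI[of _ "insert e D"] exI[of _ h']) auto
qed

lemma graded_hom_plus:
  assumes "gmod A M" "gmod A N" "f \<in> graded_hom A M N" "g \<in> graded_hom A M N"
  shows "(\<lambda>x. f x \<oplus>\<^bsub>N\<^esub> g x) \<in> graded_hom A M N"
proof -
  interpret N: gmod A N by fact
  note gc = lin_map_closed[OF assms(2) graded_hom_lin[OF assms(1,2,4)]]
  show ?thesis using assms(2,3)
  proof (induction rule: graded_hom_induct)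
    case zero
    then show ?case using gc assms(4) by simp
  next
    case (add f f' e)
    have "(f x \<oplus>\<^bsub>N\<^esub> f' x) \<oplus>\<^bsub>N\<^esub> g x = f x \<oplus>\<^bsub>N\<^esub> (f' x \<oplus>\<^bsub>N\<^esub> g x)" for x
      using gc hom_deg_closed[OF assms(2) add.hyps(1)] lin_map_closed[OF assms(2) graded_hom_lin[OF assms(1,2) add.hyps(2)]]
      by (simp add: N.M.a_assoc)
    then show ?case using hom_deg_plus_graded_hom[OF assms(1,2) add.hyps(1) add.IH] by simp
  qed
qed

lemma graded_hom_uminus:
  assumes "gmod A M" "gmod A N" "f \<in> graded_hom A M N"
  shows "(\<lambda>x. \<ominus>\<^bsub>N\<^esub> f x) \<in> graded_hom A M N"
proof -
  interpret M: gmod A M by fact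
  interpret N: gmod A N by fact
  have sm: "\<ominus>\<^bsub>N\<^esub> (a \<odot>\<^bsub>N\<^esub> y) = a \<odot>\<^bsub>N\<^esub> (\<ominus>\<^bsub>N\<^esub> y)" if "a \<in> carrier A" "y \<in> carrier N" for a y
    using N.smult_r_distr[of a "\<ominus>\<^bsub>N\<^esub> y" y] that N.smult_closed
    by (metis N.M.add.inv_closed N.M.l_neg N.M.minus_equality N.smult_zero_right)
  have mc: "\<ominus>\<^bsub>N\<^esub> y \<in> mcomp N d" if "y \<in> mcomp N d" for y d
    using additive_subgroup.a_inv_closed[OF N.mcomp_subgroup that] .
  have hd: "(\<lambda>x. \<ominus>\<^bsub>N\<^esub> f x) \<in> hom_deg A M N e" if "f \<in> hom_deg A M N e" for f e
    using that lin_map_closed[OF assms(2) hom_deg_lin[OF that]] mc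
    unfolding hom_deg_iff lin_map_def by (auto simp: N.M.minus_add sm Pi_iff)
  show ?thesis using assms(2,3)
  proof (induction rule: graded_hom_induct)
    case zero
    then show ?case using graded_hom_zero[OF assms(2), of M] by simp
  next
    case (add f g e)
    have "\<ominus>\<^bsub>N\<^esub> (f x \<oplus>\<^bsub>N\<^esub> g x) = \<ominus>\<^bsub>N\<^esub> f x \<oplus>\<^bsub>N\<^esub> \<ominus>\<^bsub>N\<^esub> g x" for x
      using hom_deg_closed[OF assms(2) add.hyps(1)] lin_map_closed[OF assms(2) graded_hom_lin[OF assms(1,2) add.hyps(2)]]
      by (simp add: N.M.minus_add)
    then show ?case using hom_deg_plus_graded_hom[OF assms(1,2) hd[OF add.hyps(1)] add.IH] by simp
  qed
qed

lemma graded_hom_minus: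
  assumes "gmod A M" "gmod A N" "f \<in> graded_hom A M N" "g \<in> graded_hom A M N"
  shows "(\<lambda>x. f x \<ominus>\<^bsub>N\<^esub> g x) \<in> graded_hom A M N"
  unfolding a_minus_def
  using graded_hom_plus[OF assms(1,2,3) graded_hom_uminus[OF assms(1,2,4)]] .

lemma graded_hom_comp:
  assumes "gmod A L" "gmod A M" "gmod A N" "f \<in> graded_hom A M N" "g \<in> graded_hom A L M"
  shows "f \<circ> g \<in> graded_hom A L N"
proof -
  interpret L: gmod A L by fact
  interpret M: gmod A M by fact
  interpret N: gmod A N by fact
  have 1: "f \<circ> g \<in> graded_hom A L N" if "g \<in> hom_deg A L M e" for g e
    using assms(3,4)
  proof (induction rule: graded_hom_induct)
    case zero
    then show ?case using graded_hom_zero[OF assms(3)] by (simp add: comp_def)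
  next
    case (add f f' e')
    then show ?case
      using hom_deg_plus_graded_hom[OF assms(1,3) hom_deg_comp[OF assms(2,3) add.hyps(1) that] add.IH]
      by (simp add: comp_def)
  qed
  note fl = graded_hom_lin[OF assms(2,3,4)]
  show ?thesis using assms(2,5)
  proof (induction rule: graded_hom_induct)
    case zero
    then show ?case using graded_hom_zero[OF assms(3)] lin_map_zero[OF M.abelian N.abelian fl] by (simp add: comp_def)
  next
    case (add g g' e')
    have "f (g x \<oplus>\<^bsub>M\<^esub> g' x) = f (g x) \<oplus>\<^bsub>N\<^esub> f (g' x)" for x
      using hom_deg_closed[OF assms(2) add.hyps(1)] lin_map_closed[OF assms(2) graded_hom_lin[OF assms(1,2) add.hyps(2)]]
      by (simp add: lin_map_add[OF fl])
    then show ?case using graded_hom_plus[OF assms(1,3) 1[OF add.hyps(1)] add.IH] by (simp add: comp_def)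
  qed
qed


section \<open>Connected graded algebras and lifting along projectives\<close>

text \<open>
  That \<open>A\<close> is spanned by its components is stated as an induction rule, because it is applied to
  additive statements about the scalars of a module.
\<close>

locale graded_alg =
  fixes A :: "('a, 'k::field) graded_algebra"
  assumes ring_A: "ring A"
    and acomp_carrier: "\<And>i a. a \<in> acomp A i \<Longrightarrow> a \<in> carrier A"
    and acomp_generate: "\<And>Pr a. \<lbrakk>a \<in> carrier A; \<And>i a. a \<in> acomp A i \<Longrightarrow> Pr a;
        \<And>a b. \<lbrakk>a \<in> carrier A; b \<in> carrier A; Pr a; Pr b\<rbrakk> \<Longrightarrow> Pr (a \<oplus>\<^bsub>A\<^esub> b)\<rbrakk> \<Longrightarrow> Pr a"
    and aug_add: "\<And>a b. \<lbrakk>a \<in> carrier A; b \<in> carrier A\<rbrakk> \<Longrightarrow> aug A (a \<oplus>\<^bsub>A\<^esub> b) = aug A a + aug A b"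
    and aug_mult: "\<And>a b. \<lbrakk>a \<in> carrier A; b \<in> carrier A\<rbrakk> \<Longrightarrow> aug A (a \<otimes>\<^bsub>A\<^esub> b) = aug A a * aug A b"
    and aug_one: "aug A \<one>\<^bsub>A\<^esub> = 1"
    and aug_acomp: "\<And>i a. a \<in> acomp A i \<Longrightarrow> i > 0 \<Longrightarrow> aug A a = 0"
    and aug_surj: "\<And>c. \<exists>a \<in> carrier A. aug A a = c"
begin

sublocale A: ring A by (rule ring_A)

lemma aug_zero [simp]: "aug A \<zero>\<^bsub>A\<^esub> = 0"
  using aug_add[of "\<zero>\<^bsub>A\<^esub>" "\<zero>\<^bsub>A\<^esub>"] by (metis A.l_zero A.zero_closed add_cancel_right_left)

text \<open>
  Freeness gives the linear map \<open>H x = \<Sum> coord x b \<odot> m b\<close>. It shifts degrees by \<open>e\<close> because it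
  commutes with homogeneous parts: this holds on multiples of basis elements by homogeneous scalars,
  these span the module, and both sides are additive.
\<close>

lemma extend_from_basis:
  fixes M :: "('a, 'm) gmodule" and N :: "('a, 'n) gmodule" and m :: "'m \<Rightarrow> 'n"
  assumes "gfree A M B" "gmod A N" "\<And>b. b \<in> B \<Longrightarrow> \<exists>d. b \<in> mcomp M d \<and> m b \<in> mcomp N (d + e)"
  obtains H where "H \<in> hom_deg A M N e" "\<And>b. b \<in> B \<Longrightarrow> H b = m b"
proof -
  interpret M: gfree A M B by fact
  interpret N: gmod A N by fact
  define H where "H = (\<lambda>x. if x \<in> carrier M
      then \<Oplus>\<^bsub>N\<^esub>b\<in>{b. M.coord x b \<noteq> \<zero>\<^bsub>A\<^esub>}. M.coord x b \<odot>\<^bsub>N\<^esub> m b else \<zero>\<^bsub>N\<^esub>)"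
  have mc: "m b \<in> carrier N" if "b \<in> B" for b using assms(3)[OF that] N.mcomp_carrier by blast
  have cm: "x \<in> carrier M \<Longrightarrow> b \<in> B \<Longrightarrow> M.coord x b \<odot>\<^bsub>N\<^esub> m b \<in> carrier N" for x b
    using mc M.coord_carrier N.smult_closed by blast
  have HD: "H x = (\<Oplus>\<^bsub>N\<^esub>b\<in>D. M.coord x b \<odot>\<^bsub>N\<^esub> m b)"
    if "x \<in> carrier M" "finite D" "{b. M.coord x b \<noteq> \<zero>\<^bsub>A\<^esub>} \<subseteq> D" "D \<subseteq> B" for x D
    unfolding H_def using that mc cm
    by (simp, intro N.finsum_support[symmetric]) (auto simp: subset_iff)
  have Hc: "H x \<in> carrier N" for x
  proof (cases "x \<in> carrier M")
    case True
    show ?thesis using HD[OF True _ subset_refl] M.coord_support[OF True] cm[OF True]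
      by (auto intro!: N.M.finsum_closed)
  qed (simp add: H_def)
  have Hadd: "H (x \<oplus>\<^bsub>M\<^esub> y) = H x \<oplus>\<^bsub>N\<^esub> H y" if x: "x \<in> carrier M" and y: "y \<in> carrier M" for x y
  proof -
    let ?D = "{b. M.coord x b \<noteq> \<zero>\<^bsub>A\<^esub>} \<union> {b. M.coord y b \<noteq> \<zero>\<^bsub>A\<^esub>}"
    have D: "finite ?D" "?D \<subseteq> B" using M.coord_support x y by auto
    have sub: "{b. M.coord (x \<oplus>\<^bsub>M\<^esub> y) b \<noteq> \<zero>\<^bsub>A\<^esub>} \<subseteq> ?D" using x y by (auto simp: M.coord_add)
    have "H (x \<oplus>\<^bsub>M\<^esub> y) = (\<Oplus>\<^bsub>N\<^esub>b\<in>?D. M.coord (x \<oplus>\<^bsub>M\<^esub> y) b \<odot>\<^bsub>N\<^esub> m b)"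
      using HD[OF _ D(1) sub D(2)] x y by simp
    also have "\<dots> = (\<Oplus>\<^bsub>N\<^esub>b\<in>?D. M.coord x b \<odot>\<^bsub>N\<^esub> m b \<oplus>\<^bsub>N\<^esub> M.coord y b \<odot>\<^bsub>N\<^esub> m b)"
    proof (rule N.M.finsum_cong'[OF refl])
      fix b assume "b \<in> ?D"
      then have "b \<in> B" using D(2) by blast
      then show "M.coord (x \<oplus>\<^bsub>M\<^esub> y) b \<odot>\<^bsub>N\<^esub> m b = M.coord x b \<odot>\<^bsub>N\<^esub> m b \<oplus>\<^bsub>N\<^esub> M.coord y b \<odot>\<^bsub>N\<^esub> m b"
        using x y mc M.coord_carrier by (simp add: M.coord_add N.smult_l_distr)
    qed (use cm x y D(2) in blast)
    also have "\<dots> = (\<Oplus>\<^bsub>N\<^esub>b\<in>?D. M.coord x b \<odot>\<^bsub>N\<^esub> m b) \<oplus>\<^bsub>N\<^esub> (\<Oplus>\<^bsub>N\<^esub>b\<in>?D. M.coord y b \<odot>\<^bsub>N\<^esub> m b)"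
      using D(2) cm x y by (intro N.M.finsum_addf) (auto simp: subset_iff)
    finally show ?thesis using HD[OF x D(1) _ D(2)] HD[OF y D(1) _ D(2)] by simp
  qed
  have Hsm: "H (a \<odot>\<^bsub>M\<^esub> x) = a \<odot>\<^bsub>N\<^esub> H x" if a: "a \<in> carrier A" and x: "x \<in> carrier M" for a x
  proof -
    let ?D = "{b. M.coord x b \<noteq> \<zero>\<^bsub>A\<^esub>}"
    have D: "finite ?D" "?D \<subseteq> B" using M.coord_support x by auto
    have sub: "{b. M.coord (a \<odot>\<^bsub>M\<^esub> x) b \<noteq> \<zero>\<^bsub>A\<^esub>} \<subseteq> ?D" using a x by (auto simp: M.coord_smult)
    have "H (a \<odot>\<^bsub>M\<^esub> x) = (\<Oplus>\<^bsub>N\<^esub>b\<in>?D. M.coord (a \<odot>\<^bsub>M\<^esub> x) b \<odot>\<^bsub>N\<^esub> m b)"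
      using HD[OF _ D(1) sub D(2)] x a M.smult_closed by simp
    also have "\<dots> = (\<Oplus>\<^bsub>N\<^esub>b\<in>?D. a \<odot>\<^bsub>N\<^esub> (M.coord x b \<odot>\<^bsub>N\<^esub> m b))"
    proof (rule N.M.finsum_cong'[OF refl])
      fix b assume "b \<in> ?D"
      then have "b \<in> B" using D(2) by blast
      then show "M.coord (a \<odot>\<^bsub>M\<^esub> x) b \<odot>\<^bsub>N\<^esub> m b = a \<odot>\<^bsub>N\<^esub> (M.coord x b \<odot>\<^bsub>N\<^esub> m b)"
        using x a mc M.coord_carrier by (simp add: M.coord_smult N.smult_assoc)
    qed (use cm x a D(2) N.smult_closed in blast)
    also have "\<dots> = a \<odot>\<^bsub>N\<^esub> (\<Oplus>\<^bsub>N\<^esub>b\<in>?D. M.coord x b \<odot>\<^bsub>N\<^esub> m b)"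
      using D cm x a by (intro N.smult_finsum[symmetric]) auto
    finally show ?thesis using HD[OF x D(1) _ D(2)] by simp
  qed
  have lin: "lin_map A M N H"
    using Hc Hadd Hsm by (auto simp: lin_map_def H_def)
  note H0 = lin_map_zero[OF M.abelian N.abelian lin]
  have Hb: "H b = m b" if "b \<in> B" for b
  proof -
    have "{c. M.coord b c \<noteq> \<zero>\<^bsub>A\<^esub>} \<subseteq> {b}" using that by (auto simp: M.coord_basis)
    then show ?thesis
      using HD[of b "{b}"] that M.basis_carrier mc by (simp add: M.coord_basis N.smult_one)
  qed
  have "N.hpart (d + e) (H x) = H (M.hpart d x)" if "x \<in> carrier M" for x d
    using that
  proof (induction rule: M.basis_induct)
    case (multiple a b)
    obtain d' where d': "b \<in> mcomp M d'" "m b \<in> mcomp N (d' + e)" using assms(3)[OF multiple(1)] by blast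
    have bc: "b \<in> carrier M" using multiple M.basis_carrier by blast
    show ?case using multiple(2)
    proof (rule acomp_generate)
      fix i a assume a: "a \<in> acomp A i"
      have 1: "a \<odot>\<^bsub>M\<^esub> b \<in> mcomp M (int i + d')" using M.mcomp_smult[OF a d'(1)] .
      have 2: "H (a \<odot>\<^bsub>M\<^esub> b) \<in> mcomp N (int i + d' + e)"
        using Hsm[of a b] acomp_carrier[OF a] bc Hb[OF multiple(1)] N.mcomp_smult[OF a d'(2)]
        by (simp add: add.assoc)
      show "N.hpart (d + e) (H (a \<odot>\<^bsub>M\<^esub> b)) = H (M.hpart d (a \<odot>\<^bsub>M\<^esub> b))"
        using M.hpart_homog[OF 1, of d] N.hpart_homog[OF 2, of "d + e"] H0 by simp
    next
      fix a a' assume a: "a \<in> carrier A" "a' \<in> carrier A"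
        and "N.hpart (d + e) (H (a \<odot>\<^bsub>M\<^esub> b)) = H (M.hpart d (a \<odot>\<^bsub>M\<^esub> b))"
        and "N.hpart (d + e) (H (a' \<odot>\<^bsub>M\<^esub> b)) = H (M.hpart d (a' \<odot>\<^bsub>M\<^esub> b))"
      then show "N.hpart (d + e) (H ((a \<oplus>\<^bsub>A\<^esub> a') \<odot>\<^bsub>M\<^esub> b)) = H (M.hpart d ((a \<oplus>\<^bsub>A\<^esub> a') \<odot>\<^bsub>M\<^esub> b))"
        using bc by (simp add: M.smult_l_distr M.smult_closed Hadd M.hpart_add N.hpart_add Hc M.hpart_carrier)
    qed
  next
    case zero
    then show ?case using N.hpart_homog[OF N.mcomp_zero] M.hpart_homog[OF M.mcomp_zero] H0 by simp
  next
    case (add x y)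
    then show ?case by (simp add: Hadd M.hpart_add N.hpart_add Hc M.hpart_carrier)
  qed
  then have "H x \<in> mcomp N (d + e)" if "x \<in> mcomp M d" for x d
    using N.hpart_mcomp[OF Hc, of "d + e" x] M.hpart_homog[OF that, of d] M.mcomp_carrier[OF that] by simp
  then show ?thesis using that[of H] lin Hb by (simp add: hom_deg_iff)
qed

text \<open>
  On \<open>x\<close> of degree \<open>d\<close> the summands take values in the distinct degrees \<open>d + e\<close>, so each of them can be
  recovered from the value of the sum.
\<close>

lemma graded_hom_component:
  assumes "gmod A M" "gmod A N" "finite D" "\<forall>e\<in>D. h e \<in> hom_deg A M N e" "x \<in> mcomp M d" "e \<in> D"
  shows "gmod.hpart N (d + e) (\<Oplus>\<^bsub>N\<^esub>e\<in>D. h e x) = h e x"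
proof -
  interpret M: gmod A M by fact
  interpret N: gmod A N by fact
  have c: "h e x \<in> mcomp N (d + e)" if "e \<in> D" for e
    using assms(4,5) that by (auto simp: hom_deg_iff)
  have c': "e \<in> D \<Longrightarrow> h e x \<in> carrier N" for e using c N.mcomp_carrier by blast
  have "(\<Oplus>\<^bsub>N\<^esub>e\<in>D. h e x) = (\<Oplus>\<^bsub>N\<^esub>c\<in>(\<lambda>e. d + e) ` D. h (c - d) x)"
    using c' N.M.finsum_reindex[of "\<lambda>c. h (c - d) x" "\<lambda>e. d + e" D] by (auto simp: Pi_iff)
  moreover have "h (c' - d) x \<in> mcomp N c'" if "c' \<in> (\<lambda>e. d + e) ` D" for c'
    using that c by auto
  ultimately show ?thesis
    using N.hpart_eqI[of "(\<lambda>e. d + e) ` D" "\<lambda>c. h (c - d) x" "d + e"] assms(3,6) by simp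
qed

text \<open>
  The homogeneous components \<open>h e\<close> of \<open>f\<close> are lifted one at a time. The image of \<open>g\<close> contains the
  homogeneous parts of its elements, hence it contains the values of each \<open>h e\<close> on the homogeneous
  elements \<open>p b\<close>, where \<open>b\<close> runs through a basis of a graded free module with \<open>P\<close> as a direct summand.
  Preimages of the right degree are chosen for these values, extended linearly and restricted to \<open>P\<close>.
\<close>

lemma lift_projective:
  fixes P :: "('a, 'm) gmodule" and M :: "('a, 'n) gmodule" and N :: "('a, 'l) gmodule"
  assumes P: "gmod A P" "graded_projective A P" and MN: "gmod A M" "gmod A N"
    and f: "f \<in> graded_hom A P N" and g: "g \<in> hom_deg A M N 0"
    and im: "\<And>x. x \<in> carrier P \<Longrightarrow> f x \<in> g ` carrier M"
  obtains h where "h \<in> graded_hom A P M" "\<And>x. x \<in> carrier P \<Longrightarrow> g (h x) = f x"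
proof -
  interpret P: gmod A P by fact
  interpret M: gmod A M by fact
  interpret N: gmod A N by fact
  obtain D h where D: "finite D" "\<forall>e\<in>D. h e \<in> hom_deg A P N e" and fe: "f = (\<lambda>x. \<Oplus>\<^bsub>N\<^esub>e\<in>D. h e x)"
    using f unfolding graded_hom_def by blast
  obtain F :: "('a, 'm \<Rightarrow> 'a) gmodule" and B i p where F: "graded_left_module A F" "homogeneous_basis A F B"
    and ip: "i \<in> hom_deg A P F 0" "p \<in> hom_deg A F P 0" "\<forall>x \<in> carrier P. p (i x) = x"
    using P(2) unfolding graded_projective_def by blast
  interpret F: gfree A F B using F by (simp add: gfree_def gmod_def gfree_axioms_def)
  note gl = hom_deg_lin[OF g] and il = hom_deg_lin[OF ip(1)] and pl = hom_deg_lin[OF ip(2)]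
  have "\<exists>k. k \<in> hom_deg A P M e \<and> (\<forall>x \<in> carrier P. g (k x) = h e x)" if e: "e \<in> D" for e
  proof -
    have he: "h e \<in> hom_deg A P N e" using D e by blast
    note hel = hom_deg_lin[OF he]
    have "\<exists>m d. b \<in> mcomp F d \<and> m \<in> mcomp M (d + e) \<and> g m = h e (p b)" if b: "b \<in> B" for b
    proof -
      obtain d where d: "b \<in> mcomp F d" using F.basis_homogeneous[OF b] by blast
      have pb: "p b \<in> mcomp P d" using ip(2) d by (auto simp: hom_deg_iff)
      obtain m where m: "m \<in> carrier M" "f (p b) = g m" using im P.mcomp_carrier[OF pb] by blast
      \<comment> \<open>both \<open>h e (p b)\<close> and its preimage are found as homogeneous parts, the latter of a preimage of \<open>f (p b)\<close>\<close>
      have "h e (p b) = N.hpart (d + e) (f (p b))"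
        using graded_hom_component[OF P(1) MN(2) D pb e] fe by simp
      also have "\<dots> = g (M.hpart (d + e) m)"
        using hpart_shift[OF MN g m(1), of "d + e"] m(2) by simp
      finally show ?thesis using d M.hpart_mcomp[OF m(1)] by metis
    qed
    then obtain m where m: "\<And>b. b \<in> B \<Longrightarrow> \<exists>d. b \<in> mcomp F d \<and> m b \<in> mcomp M (d + e) \<and> g (m b) = h e (p b)"
      by metis
    then obtain H where H: "H \<in> hom_deg A F M e" "\<And>b. b \<in> B \<Longrightarrow> H b = m b"
      using extend_from_basis[of F B M m e] F.gfree_axioms MN(1) by metis
    note Hl = hom_deg_lin[OF H(1)]
    have "g (H y) = h e (p y)" if "y \<in> carrier F" for y
      using that
    proof (induction rule: F.basis_induct)
      case (multiple a b)
      then show ?case using m[of b] H(2)[of b] F.basis_carrier M.mcomp_carrier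
        by (auto simp: lin_map_smult[OF Hl] lin_map_smult[OF pl] lin_map_smult[OF gl] lin_map_smult[OF hel]
            lin_map_carrier[OF Hl] lin_map_carrier[OF pl])
    next
      case zero
      then show ?case using lin_map_zero F.abelian P.abelian M.abelian N.abelian Hl pl gl hel by metis
    next
      case (add x y)
      then show ?case
        by (simp add: lin_map_add[OF Hl] lin_map_add[OF pl] lin_map_add[OF gl] lin_map_add[OF hel]
            lin_map_carrier[OF Hl] lin_map_carrier[OF pl])
    qed
    then have "\<forall>x\<in>carrier P. g ((H \<circ> i) x) = h e x"
      using ip(3) lin_map_carrier[OF il] by simp
    moreover have "H \<circ> i \<in> hom_deg A P M e"
      using hom_deg_comp[OF F.gmod_axioms MN(1) H(1) ip(1)] by simp
    ultimately show ?thesis by blast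
  qed
  then obtain k where k: "\<And>e. e \<in> D \<Longrightarrow> k e \<in> hom_deg A P M e"
    "\<And>e x. e \<in> D \<Longrightarrow> x \<in> carrier P \<Longrightarrow> g (k e x) = h e x" by metis
  define kk where "kk = (\<lambda>x. \<Oplus>\<^bsub>M\<^esub>e\<in>D. k e x)"
  have "kk \<in> graded_hom A P M" unfolding kk_def graded_hom_def using D(1) k(1) by blast
  moreover have "g (kk x) = f x" if x: "x \<in> carrier P" for x
  proof -
    have "g (kk x) = (\<Oplus>\<^bsub>N\<^esub>e\<in>D. g (k e x))" unfolding kk_def
      using hom_deg_closed[OF MN(1) k(1)] by (intro lin_map_finsum[OF M.abelian N.abelian gl D(1)]) auto
    also have "\<dots> = f x" unfolding fe
      using k(2) x hom_deg_closed[OF MN(2) D(2)[rule_format]] by (intro N.M.finsum_cong') auto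
    finally show ?thesis .
  qed
  ultimately show ?thesis using that by blast
qed

end


section \<open>The trivial module\<close>

lemma trivial_module_simps [simp]:
  "carrier (trivial_module A) = UNIV" "\<zero>\<^bsub>trivial_module A\<^esub> = 0"
  "x \<oplus>\<^bsub>trivial_module A\<^esub> y = x + y" "a \<odot>\<^bsub>trivial_module A\<^esub> x = aug A a * x"
  "mcomp (trivial_module A) d = (if d = 0 then UNIV else {0})"
  by (simp_all add: trivial_module_def)

lemma trivial_module_abelian: "abelian_group (trivial_module A)"
  by (rule abelian_groupI) (auto simp: algebra_simps intro: exI[of _ "- x" for x])

lemma trivial_module_uminus [simp]: "\<ominus>\<^bsub>trivial_module A\<^esub> y = - y"
proof -
  interpret K: abelian_group "trivial_module A" by (rule trivial_module_abelian)
  show ?thesis by (rule K.minus_equality) auto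
qed

lemma trivial_module_minus [simp]: "x \<ominus>\<^bsub>trivial_module A\<^esub> y = x - y"
  by (simp add: a_minus_def)

lemma trivial_module_finsum [simp]: "finite D \<Longrightarrow> finsum (trivial_module A) h D = sum h D"
proof -
  interpret K: abelian_group "trivial_module A" by (rule trivial_module_abelian)
  show "finite D \<Longrightarrow> finsum (trivial_module A) h D = sum h D"
    by (induction D rule: finite_induct) (simp_all add: K.finsum_insert)
qed

context graded_alg
begin

lemma trivial_gmod: "gmod A (trivial_module A)"
proof -
  interpret K: abelian_group "trivial_module A" by (rule trivial_module_abelian)
  have "left_module A (trivial_module A)"
    by (intro left_module.intro left_module_axioms.intro ring_A trivial_module_abelian)
      (auto simp: aug_add aug_mult aug_one algebra_simps)
  moreover have "additive_subgroup (mcomp (trivial_module A) d) (trivial_module A)" for d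
    by (intro additive_subgroup.intro K.add.subgroupI) (auto split: if_splits)
  moreover have "\<exists>!h. (\<forall>d. h d \<in> mcomp (trivial_module A) d) \<and> finite {d. h d \<noteq> 0} \<and>
        x = finsum (trivial_module A) h {d. h d \<noteq> 0}" for x :: 'k
  proof (intro ex1I[of _ "\<lambda>d::int. if d = 0 then x else 0"] conjI allI)
    have "{d::int. (if d = 0 then x else 0) \<noteq> 0} \<subseteq> {0}" by auto
    then show "finite {d::int. (if d = 0 then x else 0) \<noteq> 0}" by (rule finite_subset) simp
    then show "x = finsum (trivial_module A) (\<lambda>d::int. if d = 0 then x else 0) {d. (if d = 0 then x else 0) \<noteq> 0}"
      by (cases "x = 0") (auto simp: if_distrib cong: if_cong)
  next
    fix h :: "int \<Rightarrow> 'k" assume h: "(\<forall>d. h d \<in> mcomp (trivial_module A) d) \<and> finite {d. h d \<noteq> 0} \<and>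
        x = finsum (trivial_module A) h {d. h d \<noteq> 0}"
    then have z: "d \<noteq> 0 \<Longrightarrow> h d = 0" for d by (metis singletonD trivial_module_simps(5))
    have "x = (\<Sum>d\<in>{d. h d \<noteq> 0}. h d)" using h by simp
    also have "\<dots> = (\<Sum>d\<in>{0}. h d)"
      by (rule sum.mono_neutral_left) (use z in auto)
    finally show "h = (\<lambda>d. if d = 0 then x else 0)" using z by auto
  qed auto
  moreover have "a \<odot>\<^bsub>trivial_module A\<^esub> x \<in> mcomp (trivial_module A) (int i + d)"
    if "a \<in> acomp A i" "x \<in> mcomp (trivial_module A) d" for i d a x
    using that aug_acomp[OF that(1)] by (auto split: if_splits)
  ultimately show ?thesis
    unfolding gmod_def graded_left_module_def by simp
qed

end


section \<open>Resolutions and their cochains\<close>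

locale resol = graded_alg A for A :: "('a, 'k::field) graded_algebra" +
  fixes P :: "('a, 'm, 'k) resolution"
  assumes res: "graded_projective_resolution A P"
begin

lemma is_gmod: "gmod A (res_mod P n)"
  and is_projective: "graded_projective A (res_mod P n)"
  and diff_hom: "res_diff P (Suc n) \<in> hom_deg A (res_mod P (Suc n)) (res_mod P n) 0"
  and aug_hom: "res_aug P \<in> hom_deg A (res_mod P 0) (trivial_module A) 0"
  and res_aug_surj: "res_aug P ` carrier (res_mod P 0) = UNIV"
  and exact_0: "{x \<in> carrier (res_mod P 0). res_aug P x = 0} = res_diff P (Suc 0) ` carrier (res_mod P (Suc 0))"
  and exact_Suc: "{x \<in> carrier (res_mod P (Suc n)). res_diff P (Suc n) x = \<zero>\<^bsub>res_mod P n\<^esub>} =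
             res_diff P (Suc (Suc n)) ` carrier (res_mod P (Suc (Suc n)))"
proof -
  note r = res[unfolded graded_projective_resolution_def]
  show "gmod A (res_mod P n)" "graded_projective A (res_mod P n)" using r by (simp_all add: gmod_def)
  show "res_diff P (Suc n) \<in> hom_deg A (res_mod P (Suc n)) (res_mod P n) 0"
    using r[THEN conjunct2, THEN conjunct1, rule_format, of "Suc n"] by simp
  show "res_aug P \<in> hom_deg A (res_mod P 0) (trivial_module A) 0"
    "res_aug P ` carrier (res_mod P 0) = UNIV"
    "{x \<in> carrier (res_mod P 0). res_aug P x = 0} = res_diff P (Suc 0) ` carrier (res_mod P (Suc 0))"
    using r by simp_all
  have "\<forall>n \<ge> 1. {x \<in> carrier (res_mod P n). res_diff P n x = \<zero>\<^bsub>res_mod P (n - 1)\<^esub>} =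
             res_diff P (n + 1) ` carrier (res_mod P (n + 1))" using r by simp
  from this[rule_format, of "Suc n"]
  show "{x \<in> carrier (res_mod P (Suc n)). res_diff P (Suc n) x = \<zero>\<^bsub>res_mod P n\<^esub>} =
             res_diff P (Suc (Suc n)) ` carrier (res_mod P (Suc (Suc n)))" by simp
qed

lemma is_abelian: "abelian_group (res_mod P n)" using gmod.abelian[OF is_gmod] .

lemma diff_lin: "lin_map A (res_mod P (Suc n)) (res_mod P n) (res_diff P (Suc n))"
  using hom_deg_lin[OF diff_hom] .

lemma diff_closed: "res_diff P (Suc n) x \<in> carrier (res_mod P n)"
  using lin_map_closed[OF is_gmod diff_lin] .

lemma aug_lin: "lin_map A (res_mod P 0) (trivial_module A) (res_aug P)"
  using hom_deg_lin[OF aug_hom] .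

lemma diff_diff: "x \<in> carrier (res_mod P (Suc (Suc n))) \<Longrightarrow>
    res_diff P (Suc n) (res_diff P (Suc (Suc n)) x) = \<zero>\<^bsub>res_mod P n\<^esub>"
  using exact_Suc[of n] by blast

lemma aug_diff: "x \<in> carrier (res_mod P (Suc 0)) \<Longrightarrow> res_aug P (res_diff P (Suc 0) x) = 0"
  using exact_0 by blast

lemma cochain_lin: "f \<in> cochains A P n \<Longrightarrow> lin_map A (res_mod P n) (trivial_module A) f"
  unfolding cochains_def using graded_hom_lin[OF is_gmod trivial_gmod] .

lemma cochain_zero_val: "f \<in> cochains A P n \<Longrightarrow> f \<zero>\<^bsub>res_mod P n\<^esub> = 0"
  using lin_map_zero[OF is_abelian trivial_module_abelian cochain_lin] by simp

lemma cochain_minus: "f \<in> cochains A P n \<Longrightarrow> x \<in> carrier (res_mod P n) \<Longrightarrow> y \<in> carrier (res_mod P n) \<Longrightarrow>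
    f (x \<ominus>\<^bsub>res_mod P n\<^esub> y) = f x - f y"
  using lin_map_minus[OF is_abelian trivial_module_abelian cochain_lin] by simp

lemma cochains_zero: "(\<lambda>x. 0) \<in> cochains A P n"
  unfolding cochains_def using graded_hom_zero[OF trivial_gmod] by simp

lemma cochains_add: "f \<in> cochains A P n \<Longrightarrow> g \<in> cochains A P n \<Longrightarrow> (\<lambda>x. f x + g x) \<in> cochains A P n"
  unfolding cochains_def using graded_hom_plus[OF is_gmod trivial_gmod] by simp

lemma cochains_scale:
  assumes "f \<in> cochains A P n"
  shows "(\<lambda>x. c * f x) \<in> cochains A P n"
  using trivial_gmod assms unfolding cochains_def
proof (induction rule: graded_hom_induct)
  case zero
  then show ?case using cochains_zero by (simp add: cochains_def)
next
  case (add f g e)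
  have "(\<lambda>x. c * f x) \<in> hom_deg A (res_mod P n) (trivial_module A) e"
    using add.hyps(1) by (auto simp: hom_deg_iff lin_map_def algebra_simps split: if_splits)
  from hom_deg_plus_graded_hom[OF is_gmod trivial_gmod this add.IH]
  show ?case by (simp add: algebra_simps)
qed

lemma cocycleD: "f \<in> cocycles A P n \<Longrightarrow> f \<in> cochains A P n"
  "f \<in> cocycles A P n \<Longrightarrow> x \<in> carrier (res_mod P (Suc n)) \<Longrightarrow> f (res_diff P (Suc n) x) = 0"
  by (simp_all add: cocycles_def)

lemma cocycleI: "f \<in> cochains A P n \<Longrightarrow> (\<And>x. x \<in> carrier (res_mod P (Suc n)) \<Longrightarrow> f (res_diff P (Suc n) x) = 0) \<Longrightarrow>
    f \<in> cocycles A P n"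
  by (simp add: cocycles_def)

lemma cocycles_zero: "(\<lambda>x. 0) \<in> cocycles A P n"
  and cocycles_add: "f \<in> cocycles A P n \<Longrightarrow> g \<in> cocycles A P n \<Longrightarrow> (\<lambda>x. f x + g x) \<in> cocycles A P n"
  and cocycles_scale: "f \<in> cocycles A P n \<Longrightarrow> (\<lambda>x. c * f x) \<in> cocycles A P n"
  by (auto simp: cocycles_def cochains_zero cochains_add cochains_scale)

lemma coboundaries_0: "coboundaries A P 0 = {\<lambda>x. 0}"
  and coboundaries_Suc: "coboundaries A P (Suc n) = {g \<circ> res_diff P (Suc n) | g. g \<in> cochains A P n}"
  by (simp_all add: coboundaries_def)

lemma coboundaries_zero: "(\<lambda>x. 0) \<in> coboundaries A P n"
proof (cases n)
  case (Suc m)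
  have "(\<lambda>x. 0) = (\<lambda>x. 0) \<circ> res_diff P (Suc m)" by auto
  then show ?thesis using cochains_zero[of m] unfolding Suc coboundaries_Suc by blast
qed (simp add: coboundaries_0)

lemma coboundaries_add:
  "f \<in> coboundaries A P n \<Longrightarrow> g \<in> coboundaries A P n \<Longrightarrow> (\<lambda>x. f x + g x) \<in> coboundaries A P n"
proof (cases n)
  case (Suc m)
  assume "f \<in> coboundaries A P n" "g \<in> coboundaries A P n"
  then obtain f' g' where "f' \<in> cochains A P m" "g' \<in> cochains A P m"
      "f = f' \<circ> res_diff P (Suc m)" "g = g' \<circ> res_diff P (Suc m)"
    unfolding Suc coboundaries_Suc by blast
  then show ?thesis unfolding Suc coboundaries_Suc
    by (intro CollectI exI[of _ "\<lambda>x. f' x + g' x"]) (auto simp: cochains_add)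
qed (simp add: coboundaries_0)

lemma coboundaries_scale: "f \<in> coboundaries A P n \<Longrightarrow> (\<lambda>x. c * f x) \<in> coboundaries A P n"
proof (cases n)
  case (Suc m)
  assume "f \<in> coboundaries A P n"
  then obtain f' where "f' \<in> cochains A P m" "f = f' \<circ> res_diff P (Suc m)"
    unfolding Suc coboundaries_Suc by blast
  then show ?thesis unfolding Suc coboundaries_Suc
    by (intro CollectI exI[of _ "\<lambda>x. c * f' x"]) (auto simp: cochains_scale)
qed (simp add: coboundaries_0)

lemma coboundaries_sum:
  "(\<And>i. i \<in> S \<Longrightarrow> f i \<in> coboundaries A P n) \<Longrightarrow> (\<lambda>x. \<Sum>i\<in>S. f i x) \<in> coboundaries A P n"
  by (induction S rule: infinite_finite_induct) (simp_all add: coboundaries_zero coboundaries_add)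

lemma cocycles_sum:
  "(\<And>i. i \<in> S \<Longrightarrow> f i \<in> cocycles A P n) \<Longrightarrow> (\<lambda>x. \<Sum>i\<in>S. f i x) \<in> cocycles A P n"
  by (induction S rule: infinite_finite_induct) (simp_all add: cocycles_zero cocycles_add)

lemma coboundaries_cocycles: "f \<in> coboundaries A P n \<Longrightarrow> f \<in> cocycles A P n"
proof (cases n)
  case 0
  assume "f \<in> coboundaries A P n"
  then show ?thesis by (simp add: 0 coboundaries_0 cocycles_zero)
next
  case (Suc m)
  assume "f \<in> coboundaries A P n"
  then obtain f' where f': "f' \<in> cochains A P m" "f = f' \<circ> res_diff P (Suc m)"
    unfolding Suc coboundaries_Suc by blast
  have "f \<in> cochains A P (Suc m)" unfolding f'(2) cochains_def
    by (rule graded_hom_comp[OF is_gmod is_gmod trivial_gmod f'(1)[unfolded cochains_def] hom_deg_graded_hom[OF is_gmod diff_hom]])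
  moreover have "f (res_diff P (Suc (Suc m)) x) = 0" if "x \<in> carrier (res_mod P (Suc (Suc m)))" for x
    using diff_diff[OF that] cochain_zero_val[OF f'(1)] f'(2) by simp
  ultimately show ?thesis unfolding Suc by (rule cocycleI)
qed

lemma aug_cocycle: "res_aug P \<in> cocycles A P 0"
  using hom_deg_graded_hom[OF trivial_gmod aug_hom] aug_diff by (auto intro!: cocycleI simp: cochains_def)

end


section \<open>Comparison of resolutions\<close>

text \<open>
  The same as \<^const>\<open>chain_lift\<close>, with a second resolution as target of the chain map.
\<close>

definition cross_lift :: "('a, 'k::field) graded_algebra \<Rightarrow> ('a, 'm, 'k) resolution \<Rightarrow> ('a, 'n, 'k) resolution \<Rightarrow>
    nat \<Rightarrow> ('m \<Rightarrow> 'k) \<Rightarrow> (nat \<Rightarrow> 'm \<Rightarrow> 'n) \<Rightarrow> bool"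
  where "cross_lift A P Q q g \<phi> \<longleftrightarrow>
    (\<forall>i. \<phi> i \<in> graded_hom A (res_mod P (i + q)) (res_mod Q i)) \<and>
    (\<forall>x \<in> carrier (res_mod P q). res_aug Q (\<phi> 0 x) = g x) \<and>
    (\<forall>i. \<forall>x \<in> carrier (res_mod P (Suc (i + q))).
        res_diff Q (Suc i) (\<phi> (Suc i) x) = \<phi> i (res_diff P (Suc (i + q)) x))"

lemma chain_lift_iff: "chain_lift A P q g \<phi> \<longleftrightarrow> cross_lift A P P q g \<phi>"
  by (simp add: chain_lift_def cross_lift_def)

lemma cross_liftD:
  assumes "cross_lift A P Q q g \<phi>"
  shows "\<phi> i \<in> graded_hom A (res_mod P (i + q)) (res_mod Q i)"
    and "x \<in> carrier (res_mod P q) \<Longrightarrow> res_aug Q (\<phi> 0 x) = g x"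
    and "x \<in> carrier (res_mod P (Suc (i + q))) \<Longrightarrow>
        res_diff Q (Suc i) (\<phi> (Suc i) x) = \<phi> i (res_diff P (Suc (i + q)) x)"
  using assms by (auto simp: cross_lift_def)

locale two_resol = P: resol A P + Q: resol A Q
  for A :: "('a, 'k::field) graded_algebra" and P :: "('a, 'm, 'k) resolution" and Q :: "('a, 'n, 'k) resolution"
begin

text \<open>
  The comparison theorem. The lift is built degree by degree; the invariant is that \<open>\<phi> i \<circ> d\<close> takes
  values in the boundaries of \<open>Q\<close>, so that projectivity yields \<open>\<phi> (i + 1)\<close>.
\<close>

lemma lift_exists:
  assumes g: "g \<in> cocycles A P q"
  shows "\<exists>\<phi>. cross_lift A P Q q g \<phi>"
proof -
  define Inv where "Inv = (\<lambda>i \<phi>. \<phi> \<in> graded_hom A (res_mod P (i + q)) (res_mod Q i) \<and>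
    (\<forall>x \<in> carrier (res_mod P (Suc (i + q))). \<phi> (res_diff P (Suc (i + q)) x) \<in> res_diff Q (Suc i) ` carrier (res_mod Q (Suc i))) \<and>
    (i = 0 \<longrightarrow> (\<forall>x \<in> carrier (res_mod P q). res_aug Q (\<phi> x) = g x)))"
  define Step where "Step = (\<lambda>i \<phi> \<phi>'. \<forall>x \<in> carrier (res_mod P (Suc (i + q))).
        res_diff Q (Suc i) (\<phi>' x) = \<phi> (res_diff P (Suc (i + q)) x))"
  have base: "\<exists>\<phi>. Inv 0 \<phi>"
  proof -
    have gc: "g \<in> graded_hom A (res_mod P q) (trivial_module A)"
      using P.cocycleD(1)[OF g] by (simp add: cochains_def)
    obtain \<phi> where \<phi>: "\<phi> \<in> graded_hom A (res_mod P q) (res_mod Q 0)"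
        "\<And>x. x \<in> carrier (res_mod P q) \<Longrightarrow> res_aug Q (\<phi> x) = g x"
      using P.lift_projective[OF P.is_gmod P.is_projective Q.is_gmod P.trivial_gmod gc Q.aug_hom] Q.res_aug_surj by auto
    have "\<phi> (res_diff P (Suc q) x) \<in> res_diff Q (Suc 0) ` carrier (res_mod Q (Suc 0))"
      if "x \<in> carrier (res_mod P (Suc q))" for x
      using \<phi>(2)[OF P.diff_closed] P.cocycleD(2)[OF g that] lin_map_closed[OF Q.is_gmod graded_hom_lin[OF P.is_gmod Q.is_gmod \<phi>(1)]]
        Q.exact_0 by auto
    then show ?thesis unfolding Inv_def using \<phi> by auto
  qed
  have step: "\<exists>\<phi>'. Inv (Suc i) \<phi>' \<and> Step i \<phi> \<phi>'" if inv: "Inv i \<phi>" for i \<phi>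
  proof -
    have \<phi>: "\<phi> \<in> graded_hom A (res_mod P (i + q)) (res_mod Q i)"
      and im: "\<And>x. x \<in> carrier (res_mod P (Suc (i + q))) \<Longrightarrow>
          \<phi> (res_diff P (Suc (i + q)) x) \<in> res_diff Q (Suc i) ` carrier (res_mod Q (Suc i))"
      using inv unfolding Inv_def by auto
    have c: "\<phi> \<circ> res_diff P (Suc (i + q)) \<in> graded_hom A (res_mod P (Suc (i + q))) (res_mod Q i)"
      using graded_hom_comp[OF P.is_gmod P.is_gmod Q.is_gmod \<phi> hom_deg_graded_hom[OF P.is_gmod P.diff_hom]] .
    have im': "\<And>x. x \<in> carrier (res_mod P (Suc (i + q))) \<Longrightarrow>
          (\<phi> \<circ> res_diff P (Suc (i + q))) x \<in> res_diff Q (Suc i) ` carrier (res_mod Q (Suc i))"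
      using im by simp
    obtain \<phi>' where \<phi>': "\<phi>' \<in> graded_hom A (res_mod P (Suc (i + q))) (res_mod Q (Suc i))"
        "\<And>x. x \<in> carrier (res_mod P (Suc (i + q))) \<Longrightarrow> res_diff Q (Suc i) (\<phi>' x) = (\<phi> \<circ> res_diff P (Suc (i + q))) x"
      using P.lift_projective[OF P.is_gmod P.is_projective Q.is_gmod Q.is_gmod c Q.diff_hom im'] by metis
    have "\<phi>' (res_diff P (Suc (Suc (i + q))) x) \<in> res_diff Q (Suc (Suc i)) ` carrier (res_mod Q (Suc (Suc i)))"
      if "x \<in> carrier (res_mod P (Suc (Suc (i + q))))" for x
    proof -
      have "res_diff Q (Suc i) (\<phi>' (res_diff P (Suc (Suc (i + q))) x)) = \<zero>\<^bsub>res_mod Q i\<^esub>"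
        using \<phi>'(2)[OF P.diff_closed] P.diff_diff[OF that] lin_map_zero[OF P.is_abelian Q.is_abelian graded_hom_lin[OF P.is_gmod Q.is_gmod \<phi>]] by simp
      then show ?thesis
        using Q.exact_Suc[of i] lin_map_closed[OF Q.is_gmod graded_hom_lin[OF P.is_gmod Q.is_gmod \<phi>'(1)]] by blast
    qed
    then show ?thesis unfolding Inv_def Step_def using \<phi>' by auto
  qed
  obtain \<phi> where "\<And>i. Inv i (\<phi> i)" "\<And>i. Step i (\<phi> i) (\<phi> (Suc i))"
    using dependent_nat_choice[of Inv Step] base step by blast
  then show ?thesis unfolding cross_lift_def Inv_def Step_def by (intro exI[of _ \<phi>]) auto
qed

text \<open>
  The homotopy of a chain map whose bottom component is a coboundary, built degree by degree. The
  statement keeps the part that is visible to cocycles: up to boundaries of \<open>Q\<close>, the map \<open>\<chi> p\<close> is a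
  map \<open>\<sigma>\<close> that factors through the differential of \<open>P\<close>. In total degree 0 no module precedes
  \<open>P\<^sup>0\<close>, and \<open>\<sigma>\<close> is zero.
\<close>

lemma null_homotopy:
  assumes \<chi>: "\<And>i. \<chi> i \<in> graded_hom A (res_mod P (i + q)) (res_mod Q i)"
    and chain: "\<And>i x. x \<in> carrier (res_mod P (Suc (i + q))) \<Longrightarrow>
        res_diff Q (Suc i) (\<chi> (Suc i) x) = \<chi> i (res_diff P (Suc (i + q)) x)"
    and cob: "(\<lambda>x. res_aug Q (\<chi> 0 x)) \<in> coboundaries A P q"
  shows "\<exists>\<sigma> \<in> graded_hom A (res_mod P (p + q)) (res_mod Q p).
    (p + q = 0 \<and> \<sigma> = (\<lambda>x. \<zero>\<^bsub>res_mod Q p\<^esub>) \<or>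
      (\<exists>m. p + q = Suc m \<and> (\<exists>s \<in> graded_hom A (res_mod P m) (res_mod Q p). \<sigma> = s \<circ> res_diff P (Suc m)))) \<and>
    (\<forall>x \<in> carrier (res_mod P (p + q)). \<chi> p x \<ominus>\<^bsub>res_mod Q p\<^esub> \<sigma> x \<in> res_diff Q (Suc p) ` carrier (res_mod Q (Suc p)))"
proof (induction p)
  case 0
  interpret Q0: gmod A "res_mod Q 0" by (rule Q.is_gmod)
  have \<chi>0: "\<chi> 0 \<in> graded_hom A (res_mod P q) (res_mod Q 0)" using \<chi>[of 0] by simp
  have \<chi>c: "\<chi> 0 x \<in> carrier (res_mod Q 0)" for x
    using lin_map_closed[OF Q.is_gmod graded_hom_lin[OF P.is_gmod Q.is_gmod \<chi>0]] .
  show ?case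
  proof (cases q)
    case q: 0
    have "\<chi> 0 x \<ominus>\<^bsub>res_mod Q 0\<^esub> \<zero>\<^bsub>res_mod Q 0\<^esub> \<in> res_diff Q (Suc 0) ` carrier (res_mod Q (Suc 0))" for x
    proof -
      have "res_aug Q (\<chi> 0 x) = 0" using cob unfolding q P.coboundaries_0 by (auto dest: fun_cong)
      moreover have "\<chi> 0 x \<ominus>\<^bsub>res_mod Q 0\<^esub> \<zero>\<^bsub>res_mod Q 0\<^esub> = \<chi> 0 x"
        using \<chi>c[of x] by (simp add: a_minus_def)
      ultimately show ?thesis using Q.exact_0 \<chi>c[of x] by auto
    qed
    then show ?thesis using graded_hom_zero[OF Q.is_gmod, of 0 "res_mod P 0"] by (auto simp: q)
  next
    case (Suc m)
    obtain h where h: "h \<in> cochains A P m" and e: "(\<lambda>x. res_aug Q (\<chi> 0 x)) = h \<circ> res_diff P (Suc m)"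
      using cob unfolding Suc P.coboundaries_Suc by blast
    obtain s where s: "s \<in> graded_hom A (res_mod P m) (res_mod Q 0)"
        "\<And>x. x \<in> carrier (res_mod P m) \<Longrightarrow> res_aug Q (s x) = h x"
      using P.lift_projective[OF P.is_gmod P.is_projective Q.is_gmod P.trivial_gmod h[unfolded cochains_def] Q.aug_hom] Q.res_aug_surj by auto
    have sc: "s x \<in> carrier (res_mod Q 0)" for x
      using lin_map_closed[OF Q.is_gmod graded_hom_lin[OF P.is_gmod Q.is_gmod s(1)]] .
    have "\<chi> 0 x \<ominus>\<^bsub>res_mod Q 0\<^esub> (s \<circ> res_diff P (Suc m)) x \<in> res_diff Q (Suc 0) ` carrier (res_mod Q (Suc 0))" for x
    proof -
      have "res_aug Q (\<chi> 0 x \<ominus>\<^bsub>res_mod Q 0\<^esub> (s \<circ> res_diff P (Suc m)) x) = 0"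
        using lin_map_minus[OF Q.is_abelian trivial_module_abelian Q.aug_lin \<chi>c sc] s(2)[OF P.diff_closed] fun_cong[OF e] by simp
      then show ?thesis using Q.exact_0 \<chi>c[of x] sc[of "res_diff P (Suc m) x"] by auto
    qed
    moreover have "s \<circ> res_diff P (Suc m) \<in> graded_hom A (res_mod P (Suc m)) (res_mod Q 0)"
      using graded_hom_comp[OF P.is_gmod P.is_gmod Q.is_gmod s(1) hom_deg_graded_hom[OF P.is_gmod P.diff_hom]] .
    ultimately show ?thesis using s(1) unfolding Suc
      by (intro bexI[of _ "s \<circ> res_diff P (Suc m)"] conjI disjI2 exI[of _ m] bexI[of _ s]) auto
  qed
next
  case (Suc p)
  interpret Qp: gmod A "res_mod Q p" by (rule Q.is_gmod)
  obtain \<sigma> where \<sigma>: "\<sigma> \<in> graded_hom A (res_mod P (p + q)) (res_mod Q p)"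
    and \<sigma>': "p + q = 0 \<and> \<sigma> = (\<lambda>x. \<zero>\<^bsub>res_mod Q p\<^esub>) \<or>
      (\<exists>m. p + q = Suc m \<and> (\<exists>s \<in> graded_hom A (res_mod P m) (res_mod Q p). \<sigma> = s \<circ> res_diff P (Suc m)))"
    and im: "\<And>x. x \<in> carrier (res_mod P (p + q)) \<Longrightarrow>
      \<chi> p x \<ominus>\<^bsub>res_mod Q p\<^esub> \<sigma> x \<in> res_diff Q (Suc p) ` carrier (res_mod Q (Suc p))"
    using Suc by blast
  have \<sigma>d: "\<sigma> (res_diff P (Suc (p + q)) x) = \<zero>\<^bsub>res_mod Q p\<^esub>" if x: "x \<in> carrier (res_mod P (Suc (p + q)))" for x
    using \<sigma>'
  proof (elim disjE exE conjE bexE)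
    fix m s assume "p + q = Suc m" "s \<in> graded_hom A (res_mod P m) (res_mod Q p)" "\<sigma> = s \<circ> res_diff P (Suc m)"
    then show ?thesis using P.diff_diff[of x m] x lin_map_zero[OF P.is_abelian Q.is_abelian graded_hom_lin[OF P.is_gmod Q.is_gmod]] by auto
  qed simp
  define \<psi> where "\<psi> = (\<lambda>x. \<chi> p x \<ominus>\<^bsub>res_mod Q p\<^esub> \<sigma> x)"
  have \<psi>: "\<psi> \<in> graded_hom A (res_mod P (p + q)) (res_mod Q p)"
    unfolding \<psi>_def by (rule graded_hom_minus[OF P.is_gmod Q.is_gmod \<chi> \<sigma>])
  obtain s where s: "s \<in> graded_hom A (res_mod P (p + q)) (res_mod Q (Suc p))"
      "\<And>x. x \<in> carrier (res_mod P (p + q)) \<Longrightarrow> res_diff Q (Suc p) (s x) = \<psi> x"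
    using P.lift_projective[OF P.is_gmod P.is_projective Q.is_gmod Q.is_gmod \<psi> Q.diff_hom] im unfolding \<psi>_def by metis
  have sc: "s x \<in> carrier (res_mod Q (Suc p))" for x
    using lin_map_closed[OF Q.is_gmod graded_hom_lin[OF P.is_gmod Q.is_gmod s(1)]] .
  have \<chi>c: "\<chi> i x \<in> carrier (res_mod Q i)" for i x
    using lin_map_closed[OF Q.is_gmod graded_hom_lin[OF P.is_gmod Q.is_gmod \<chi>]] .
  interpret Qs: gmod A "res_mod Q (Suc p)" by (rule Q.is_gmod)
  have "\<chi> (Suc p) x \<ominus>\<^bsub>res_mod Q (Suc p)\<^esub> (s \<circ> res_diff P (Suc (p + q))) x
      \<in> res_diff Q (Suc (Suc p)) ` carrier (res_mod Q (Suc (Suc p)))"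
    if x: "x \<in> carrier (res_mod P (Suc (p + q)))" for x
  proof -
    have "res_diff Q (Suc p) (\<chi> (Suc p) x \<ominus>\<^bsub>res_mod Q (Suc p)\<^esub> s (res_diff P (Suc (p + q)) x))
       = \<chi> p (res_diff P (Suc (p + q)) x) \<ominus>\<^bsub>res_mod Q p\<^esub> \<psi> (res_diff P (Suc (p + q)) x)"
      using lin_map_minus[OF Q.is_abelian Q.is_abelian Q.diff_lin \<chi>c sc] chain[OF x] s(2)[OF P.diff_closed] by simp
    also have "\<psi> (res_diff P (Suc (p + q)) x) = \<chi> p (res_diff P (Suc (p + q)) x)"
      unfolding \<psi>_def using \<sigma>d[OF x] \<chi>c
      by (simp add: a_minus_def)
    finally have "res_diff Q (Suc p) (\<chi> (Suc p) x \<ominus>\<^bsub>res_mod Q (Suc p)\<^esub> s (res_diff P (Suc (p + q)) x)) = \<zero>\<^bsub>res_mod Q p\<^esub>"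
      using \<chi>c by (simp add: a_minus_def Qp.M.r_neg)
    then show ?thesis using Q.exact_Suc[of p] \<chi>c[of "Suc p" x] sc[of "res_diff P (Suc (p + q)) x"]
      by (simp add: set_eq_iff) (metis Qs.M.minus_closed)
  qed
  moreover have "s \<circ> res_diff P (Suc (p + q)) \<in> graded_hom A (res_mod P (Suc (p + q))) (res_mod Q (Suc p))"
    using graded_hom_comp[OF P.is_gmod P.is_gmod Q.is_gmod s(1) hom_deg_graded_hom[OF P.is_gmod P.diff_hom]] .
  ultimately show ?case using s(1) unfolding add_Suc
    by (intro bexI[of _ "s \<circ> res_diff P (Suc (p + q))"] conjI disjI2 exI[of _ "p + q"] bexI[of _ s]) auto
qed

text \<open>
  The class of \<open>f \<circ> \<phi> p\<close> depends only on the class of \<open>g\<close>: the difference of two lifts is a chain map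
  to which \<open>null_homotopy\<close> applies, and \<open>f\<close> kills boundaries.
\<close>

lemma lift_unique:
  assumes \<phi>: "cross_lift A P Q q g \<phi>" and \<phi>': "cross_lift A P Q q g' \<phi>'"
    and gg: "(\<lambda>x. g x - g' x) \<in> coboundaries A P q"
    and g: "g \<in> cochains A P q" "g' \<in> cochains A P q"
    and f: "f \<in> cocycles A Q p"
  shows "(\<lambda>x. f (\<phi> p x) - f (\<phi>' p x)) \<in> coboundaries A P (p + q)"
proof -
  define \<chi> where "\<chi> = (\<lambda>i x. \<phi> i x \<ominus>\<^bsub>res_mod Q i\<^esub> \<phi>' i x)"
  have c: "\<phi> i x \<in> carrier (res_mod Q i)" "\<phi>' i x \<in> carrier (res_mod Q i)" for i x
    using lin_map_closed[OF Q.is_gmod graded_hom_lin[OF P.is_gmod Q.is_gmod]] cross_liftD(1)[OF \<phi>] cross_liftD(1)[OF \<phi>'] by blast+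
  have \<chi>1: "\<chi> i \<in> graded_hom A (res_mod P (i + q)) (res_mod Q i)" for i
    unfolding \<chi>_def by (rule graded_hom_minus[OF P.is_gmod Q.is_gmod cross_liftD(1)[OF \<phi>] cross_liftD(1)[OF \<phi>']])
  have \<chi>c: "\<chi> i x \<in> carrier (res_mod Q i)" for i x
    using lin_map_closed[OF Q.is_gmod graded_hom_lin[OF P.is_gmod Q.is_gmod \<chi>1]] .
  have 2: "res_diff Q (Suc i) (\<chi> (Suc i) x) = \<chi> i (res_diff P (Suc (i + q)) x)"
    if x: "x \<in> carrier (res_mod P (Suc (i + q)))" for i x
    unfolding \<chi>_def lin_map_minus[OF Q.is_abelian Q.is_abelian Q.diff_lin c] cross_liftD(3)[OF \<phi> x] cross_liftD(3)[OF \<phi>' x] ..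
  have "res_aug Q (\<chi> 0 x) = g x - g' x" for x
  proof (cases "x \<in> carrier (res_mod P q)")
    case True
    then show ?thesis
      unfolding \<chi>_def lin_map_minus[OF Q.is_abelian trivial_module_abelian Q.aug_lin c]
      using cross_liftD(2)[OF \<phi> True] cross_liftD(2)[OF \<phi>' True] by simp
  next
    case False
    have "\<chi> 0 x = \<zero>\<^bsub>res_mod Q 0\<^esub>"
      using lin_map_outside[OF graded_hom_lin[OF P.is_gmod Q.is_gmod \<chi>1]] False by simp
    then show ?thesis
      using lin_map_outside[OF P.cochain_lin[OF g(1)] False] lin_map_outside[OF P.cochain_lin[OF g(2)] False]
        lin_map_zero[OF Q.is_abelian trivial_module_abelian Q.aug_lin] by simp
  qed
  then have 3: "(\<lambda>x. res_aug Q (\<chi> 0 x)) \<in> coboundaries A P q" using gg by simp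
  from null_homotopy[OF \<chi>1 2 3, of p] obtain \<sigma> where \<sigma>: "\<sigma> \<in> graded_hom A (res_mod P (p + q)) (res_mod Q p)"
    and \<sigma>': "p + q = 0 \<and> \<sigma> = (\<lambda>x. \<zero>\<^bsub>res_mod Q p\<^esub>) \<or>
      (\<exists>m. p + q = Suc m \<and> (\<exists>s \<in> graded_hom A (res_mod P m) (res_mod Q p). \<sigma> = s \<circ> res_diff P (Suc m)))"
    and im: "\<And>x. x \<in> carrier (res_mod P (p + q)) \<Longrightarrow>
      \<chi> p x \<ominus>\<^bsub>res_mod Q p\<^esub> \<sigma> x \<in> res_diff Q (Suc p) ` carrier (res_mod Q (Suc p))"
    by blast
  have \<sigma>c: "\<sigma> x \<in> carrier (res_mod Q p)" for x
    using lin_map_closed[OF Q.is_gmod graded_hom_lin[OF P.is_gmod Q.is_gmod \<sigma>]] .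
  note fc = Q.cocycleD(1)[OF f]
  have eq: "f (\<phi> p x) - f (\<phi>' p x) = f (\<sigma> x)" for x
  proof (cases "x \<in> carrier (res_mod P (p + q))")
    case True
    have "f (\<chi> p x \<ominus>\<^bsub>res_mod Q p\<^esub> \<sigma> x) = 0" using im[OF True] Q.cocycleD(2)[OF f] by auto
    then show ?thesis using Q.cochain_minus[OF fc \<chi>c \<sigma>c] Q.cochain_minus[OF fc c] by (simp add: \<chi>_def)
  next
    case False
    then show ?thesis using lin_map_outside[OF graded_hom_lin[OF P.is_gmod Q.is_gmod]]
        cross_liftD(1)[OF \<phi>] cross_liftD(1)[OF \<phi>'] \<sigma> by (metis right_minus_eq Q.cochain_zero_val[OF fc])
  qed
  from \<sigma>' show ?thesis
  proof (elim disjE exE conjE bexE)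
    assume "p + q = 0" "\<sigma> = (\<lambda>x. \<zero>\<^bsub>res_mod Q p\<^esub>)"
    then have "(\<lambda>x. f (\<phi> p x) - f (\<phi>' p x)) = (\<lambda>x. 0)" using Q.cochain_zero_val[OF fc] by (intro ext) (simp only: eq)
    then show ?thesis using P.coboundaries_zero by simp
  next
    fix m s assume m: "p + q = Suc m" and s: "s \<in> graded_hom A (res_mod P m) (res_mod Q p)" "\<sigma> = s \<circ> res_diff P (Suc m)"
    have "f \<circ> s \<in> cochains A P m"
      using graded_hom_comp[OF P.is_gmod Q.is_gmod P.trivial_gmod fc[unfolded cochains_def] s(1)] by (simp add: cochains_def)
    then show ?thesis unfolding eq m P.coboundaries_Suc s(2) by (auto simp: comp_def)
  qed
qed

lemma pullback_cochain:
  assumes "f \<in> cochains A Q p" "cross_lift A P Q q g \<phi>"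
  shows "f \<circ> \<phi> p \<in> cochains A P (p + q)"
  using graded_hom_comp[OF P.is_gmod Q.is_gmod P.trivial_gmod assms(1)[unfolded cochains_def] cross_liftD(1)[OF assms(2)]]
  by (simp add: cochains_def)

lemma pullback_cocycle:
  assumes "f \<in> cocycles A Q p" "cross_lift A P Q q g \<phi>"
  shows "f \<circ> \<phi> p \<in> cocycles A P (p + q)"
proof (rule P.cocycleI)
  show "f \<circ> \<phi> p \<in> cochains A P (p + q)" using pullback_cochain[OF Q.cocycleD(1)[OF assms(1)] assms(2)] .
  fix x assume x: "x \<in> carrier (res_mod P (Suc (p + q)))"
  have "\<phi> (Suc p) x \<in> carrier (res_mod Q (Suc p))"
    using lin_map_closed[OF Q.is_gmod graded_hom_lin[OF P.is_gmod Q.is_gmod cross_liftD(1)[OF assms(2)]]] .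
  then show "(f \<circ> \<phi> p) (res_diff P (Suc (p + q)) x) = 0"
    using cross_liftD(3)[OF assms(2) x, symmetric] Q.cocycleD(2)[OF assms(1)] by simp
qed

lemma pullback_coboundary:
  assumes "f \<in> coboundaries A Q p" "cross_lift A P Q q g \<phi>"
  shows "f \<circ> \<phi> p \<in> coboundaries A P (p + q)"
proof (cases p)
  case 0
  then show ?thesis using assms(1) by (simp add: Q.coboundaries_0 comp_def P.coboundaries_zero)
next
  case (Suc m)
  obtain h where h: "h \<in> cochains A Q m" "f = h \<circ> res_diff Q (Suc m)"
    using assms(1) unfolding Suc Q.coboundaries_Suc by blast
  have "(f \<circ> \<phi> p) x = ((h \<circ> \<phi> m) \<circ> res_diff P (Suc (m + q))) x" for x
  proof (cases "x \<in> carrier (res_mod P (Suc (m + q)))")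
    case True
    then show ?thesis using cross_liftD(3)[OF assms(2) True] by (simp add: h(2) Suc)
  next
    case False
    have "\<phi> (Suc m) x = \<zero>\<^bsub>res_mod Q (Suc m)\<^esub>"
      using lin_map_outside[OF graded_hom_lin[OF P.is_gmod Q.is_gmod cross_liftD(1)[OF assms(2)]], of x "Suc m"] False by simp
    moreover have "res_diff P (Suc (m + q)) x = \<zero>\<^bsub>res_mod P (m + q)\<^esub>"
      using lin_map_outside[OF P.diff_lin] False by blast
    ultimately show ?thesis
      using lin_map_zero[OF Q.is_abelian Q.is_abelian Q.diff_lin] lin_map_zero[OF P.is_abelian Q.is_abelian graded_hom_lin[OF P.is_gmod Q.is_gmod cross_liftD(1)[OF assms(2)]]]
      by (simp add: h(2) Suc)
  qed
  then have "f \<circ> \<phi> p = (h \<circ> \<phi> m) \<circ> res_diff P (Suc (m + q))" by blast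
  then show ?thesis
    using pullback_cochain[OF h(1) assms(2)] unfolding Suc add_Suc P.coboundaries_Suc by blast
qed

end

text \<open>
  Composing lifts lifts the product; this is the associativity of the Yoneda product at the level of
  chain maps.
\<close>

lemma cross_lift_comp:
  assumes "resol A P" "resol A Q" "resol A S"
    and \<psi>: "cross_lift A Q S q g \<psi>" and \<phi>: "cross_lift A P Q q' g' \<phi>"
  shows "cross_lift A P S (q + q') (g \<circ> \<phi> q) (\<lambda>i. \<psi> i \<circ> \<phi> (i + q))"
proof -
  interpret P: resol A P by fact
  interpret Q: resol A Q by fact
  interpret S: resol A S by fact
  have c: "\<phi> i x \<in> carrier (res_mod Q i)" for i x
    using lin_map_closed[OF Q.is_gmod graded_hom_lin[OF P.is_gmod Q.is_gmod cross_liftD(1)[OF \<phi>]]] .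
  have "\<psi> i \<circ> \<phi> (i + q) \<in> graded_hom A (res_mod P (i + (q + q'))) (res_mod S i)" for i
    using graded_hom_comp[OF P.is_gmod Q.is_gmod S.is_gmod cross_liftD(1)[OF \<psi>, of i] cross_liftD(1)[OF \<phi>, of "i + q"]]
    by (simp add: add.assoc)
  moreover have "res_diff S (Suc i) ((\<psi> (Suc i) \<circ> \<phi> (Suc i + q)) x) = (\<psi> i \<circ> \<phi> (i + q)) (res_diff P (Suc (i + (q + q'))) x)"
    if x: "x \<in> carrier (res_mod P (Suc (i + (q + q'))))" for i x
    using cross_liftD(3)[OF \<psi>, of "\<phi> (Suc i + q) x" i] cross_liftD(3)[OF \<phi>, of x "i + q"] x c[of "Suc (i + q)" x]
    by (simp add: add.assoc)
  ultimately show ?thesis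
    unfolding cross_lift_def using cross_liftD(2)[OF \<psi>] c by simp
qed

lemma cross_lift_cong:
  assumes "cross_lift A P Q q g \<phi>" "\<And>x. x \<in> carrier (res_mod P q) \<Longrightarrow> g x = g' x"
  shows "cross_lift A P Q q g' \<phi>"
  using assms by (simp add: cross_lift_def)


section \<open>The Yoneda algebra and decomposable classes\<close>

text \<open>
  The cocycles whose class lies in \<open>E\<^sup>1 E\<^sup>n\<^sup>-\<^sup>1 + E\<^sup>2 E\<^sup>n\<^sup>-\<^sup>2\<close>, for \<open>n \<ge> 2\<close>. Coboundaries are included so
  that the set is a union of classes, and scalar factors are absorbed into \<open>f\<close>.
\<close>

inductive_set decomposables :: "('a, 'k::field) graded_algebra \<Rightarrow> ('a, 'm, 'k) resolution \<Rightarrow> nat \<Rightarrow> ('m \<Rightarrow> 'k) set"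
  for A P n where
    cob: "f \<in> coboundaries A P n \<Longrightarrow> f \<in> decomposables A P n"
  | prod1: "\<lbrakk>f \<in> cocycles A P 1; g \<in> cocycles A P (n - 1); chain_lift A P (n - 1) g \<phi>\<rbrakk>
      \<Longrightarrow> f \<circ> \<phi> 1 \<in> decomposables A P n"
  | prod2: "\<lbrakk>f \<in> cocycles A P 2; g \<in> cocycles A P (n - 2); chain_lift A P (n - 2) g \<phi>\<rbrakk>
      \<Longrightarrow> f \<circ> \<phi> 2 \<in> decomposables A P n"
  | add: "\<lbrakk>f \<in> decomposables A P n; g \<in> decomposables A P n\<rbrakk> \<Longrightarrow> (\<lambda>x. f x + g x) \<in> decomposables A P n"

context resol
begin

interpretation self: two_resol A P P
  by (intro two_resol.intro resol_axioms)

lemma chain_lift_exists: "g \<in> cocycles A P q \<Longrightarrow> \<exists>\<phi>. chain_lift A P q g \<phi>"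
  using self.lift_exists by (simp add: chain_lift_iff)

lemma chain_lift_zero: "chain_lift A P q (\<lambda>x. 0) (\<lambda>i x. \<zero>\<^bsub>res_mod P i\<^esub>)"
  unfolding chain_lift_iff cross_lift_def
  using lin_map_zero[OF is_abelian is_abelian diff_lin] lin_map_zero[OF is_abelian trivial_module_abelian aug_lin]
  by (intro conjI allI graded_hom_zero[OF is_gmod]) simp_all

lemma chain_lift_pullback: "f \<in> cocycles A P p \<Longrightarrow> chain_lift A P q g \<phi> \<Longrightarrow> f \<circ> \<phi> p \<in> cocycles A P (p + q)"
  using self.pullback_cocycle by (simp add: chain_lift_iff)

lemma chain_lift_pullback_coboundary:
  "f \<in> coboundaries A P p \<Longrightarrow> chain_lift A P q g \<phi> \<Longrightarrow> f \<circ> \<phi> p \<in> coboundaries A P (p + q)"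
  using self.pullback_coboundary by (simp add: chain_lift_iff)

lemma decomposables_shift:
  assumes "f \<in> decomposables A P n" "(\<lambda>x. f' x - f x) \<in> coboundaries A P n"
  shows "f' \<in> decomposables A P n"
  using decomposables.add[OF assms(1) decomposables.cob[OF assms(2)]] by simp

lemma decomposables_scale: "f \<in> decomposables A P n \<Longrightarrow> (\<lambda>x. c * f x) \<in> decomposables A P n"
proof (induction rule: decomposables.induct)
  case (cob f)
  then show ?case by (intro decomposables.cob coboundaries_scale)
next
  case (prod1 f g \<phi>)
  then show ?case using decomposables.prod1[OF cocycles_scale[OF prod1(1)] prod1(2,3)] by (simp add: comp_def)
next
  case (prod2 f g \<phi>)
  then show ?case using decomposables.prod2[OF cocycles_scale[OF prod2(1)] prod2(2,3)] by (simp add: comp_def)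
next
  case (add f g)
  then show ?case using decomposables.add[OF add.IH] by (simp add: distrib_left)
qed

lemma decomposables_cocycles:
  assumes "f \<in> decomposables A P n" "n \<ge> 2"
  shows "f \<in> cocycles A P n"
  using assms(1)
proof (induction rule: decomposables.induct)
  case (cob f)
  then show ?case by (rule coboundaries_cocycles)
next
  case (prod1 f g \<phi>)
  then show ?case using chain_lift_pullback[OF prod1(1,3)] assms(2) by (simp add: comp_def)
next
  case (prod2 f g \<phi>)
  have "2 + (n - 2) = n" using assms(2) by simp
  then show ?case using chain_lift_pullback[OF prod2(1,3)] by (simp add: comp_def)
next
  case (add f g)
  then show ?case using cocycles_add by simp
qed

lemma decomposables_sum:
  "(\<And>i. i \<in> S \<Longrightarrow> f i \<in> decomposables A P n) \<Longrightarrow> (\<lambda>x. \<Sum>i\<in>S. f i x) \<in> decomposables A P n"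
  by (induction S rule: infinite_finite_induct)
    (simp_all add: decomposables.cob[OF coboundaries_zero] decomposables.add)

text \<open>
  \<open>E\<^sup>0 = K\<close>. If \<open>res_aug P x0 = 1\<close> and \<open>a\<close> has augmentation \<open>res_aug P x\<close>, then \<open>x\<close> and \<open>a x0\<close> have the
  same image in \<open>K\<close>; they differ by a boundary, so \<open>f\<close> takes the same value on both.
\<close>

lemma cocycle_0:
  assumes "f \<in> cocycles A P 0"
  shows "\<exists>k. f = (\<lambda>x. k * res_aug P x)"
proof -
  interpret P0: gmod A "res_mod P 0" by (rule is_gmod)
  obtain x0 where x0: "x0 \<in> carrier (res_mod P 0)" "res_aug P x0 = 1"
    using res_aug_surj by (metis UNIV_I imageE)
  note fc = cocycleD(1)[OF assms]
  have "f x = f x0 * res_aug P x" for x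
  proof (cases "x \<in> carrier (res_mod P 0)")
    case True
    obtain a where a: "a \<in> carrier A" "aug A a = res_aug P x" using aug_surj by blast
    have ax: "a \<odot>\<^bsub>res_mod P 0\<^esub> x0 \<in> carrier (res_mod P 0)" using a x0 P0.smult_closed by blast
    have "res_aug P (x \<ominus>\<^bsub>res_mod P 0\<^esub> a \<odot>\<^bsub>res_mod P 0\<^esub> x0) = 0"
      using lin_map_minus[OF is_abelian trivial_module_abelian aug_lin True ax] lin_map_smult[OF aug_lin a(1) x0(1)] a x0
      by simp
    then have "x \<ominus>\<^bsub>res_mod P 0\<^esub> a \<odot>\<^bsub>res_mod P 0\<^esub> x0 \<in> res_diff P (Suc 0) ` carrier (res_mod P (Suc 0))"
      unfolding exact_0[symmetric] using P0.M.minus_closed[OF True ax] by simp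
    then have "f (x \<ominus>\<^bsub>res_mod P 0\<^esub> a \<odot>\<^bsub>res_mod P 0\<^esub> x0) = 0"
      using cocycleD(2)[OF assms] by (elim imageE) simp
    then show ?thesis
      using cochain_minus[OF fc True ax] lin_map_smult[OF cochain_lin[OF fc] a(1) x0(1)] a by (simp add: mult.commute)
  next
    case False
    then show ?thesis using lin_map_outside[OF cochain_lin[OF fc]] lin_map_outside[OF aug_lin] by simp
  qed
  then show ?thesis by blast
qed

text \<open>
  For \<open>p > 2\<close> associativity moves the second factor inside: \<open>(f h) g = f (h g)\<close> with \<open>f\<close> in degree 1
  or 2. A factor of degree 0 is a scalar, and a first factor of degree 1 or 2 is an instance of the
  definition.
\<close>

lemma decomposables_times:
  assumes f: "f \<in> cocycles A P p" and g: "g \<in> cocycles A P q" and \<phi>: "chain_lift A P q g \<phi>"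
    and fd: "p > 2 \<Longrightarrow> f \<in> decomposables A P p" and gd: "q > 2 \<Longrightarrow> g \<in> decomposables A P q"
    and n: "p + q > 2"
  shows "f \<circ> \<phi> p \<in> decomposables A P (p + q)"
proof -
  consider "p = 0" | "p = 1" | "p = 2" | "p > 2" by linarith
  then show ?thesis
  proof cases
    case 1
    obtain k where k: "f = (\<lambda>x. k * res_aug P x)" using cocycle_0 f 1 by blast
    have "f (\<phi> 0 x) = k * g x" for x
    proof (cases "x \<in> carrier (res_mod P q)")
      case True
      then show ?thesis using \<phi> k by (simp add: chain_lift_def)
    next
      case False
      have "\<phi> 0 x = \<zero>\<^bsub>res_mod P 0\<^esub>"
        using lin_map_outside[OF graded_hom_lin[OF is_gmod is_gmod cross_liftD(1)[OF \<phi>[unfolded chain_lift_iff], of 0]]] False by simp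
      then show ?thesis using lin_map_outside[OF cochain_lin[OF cocycleD(1)[OF g]] False] cochain_zero_val cocycleD(1)[OF f] 1
        by simp
    qed
    then have "f \<circ> \<phi> p = (\<lambda>x. k * g x)" using 1 by auto
    then show ?thesis using decomposables_scale[OF gd] n 1 by simp
  next
    case 2
    then show ?thesis using decomposables.prod1[of f A P g "p + q" \<phi>] f g \<phi> by simp
  next
    case 3
    then show ?thesis using decomposables.prod2[of f A P g "p + q" \<phi>] f g \<phi> by simp
  next
    case 4
    have step: "f \<circ> \<psi> r \<circ> \<phi> p \<in> decomposables A P (p + q)"
      if "f \<in> cocycles A P r" "h \<in> cocycles A P (p - r)" "chain_lift A P (p - r) h \<psi>" "r = 1 \<or> r = 2" for f h \<psi> r
    proof -
      have rp: "r + (p - r) = p" "p - r + q = p + q - r" using 4 that(4) by auto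
      have h: "h \<circ> \<phi> (p - r) \<in> cocycles A P (p + q - r)" using chain_lift_pullback[OF that(2) \<phi>] rp by simp
      have l: "chain_lift A P (p + q - r) (h \<circ> \<phi> (p - r)) (\<lambda>i. \<psi> i \<circ> \<phi> (i + (p - r)))"
        using cross_lift_comp[OF resol_axioms resol_axioms resol_axioms] that(3) \<phi> rp(2)[symmetric]
        unfolding chain_lift_iff by metis
      show ?thesis using that(4)
      proof
        assume r: "r = 1"
        have "f \<circ> (\<psi> 1 \<circ> \<phi> (1 + (p - 1))) \<in> decomposables A P (p + q)"
          by (rule decomposables.prod1[OF that(1)[unfolded r] h[unfolded r] l[unfolded r]])
        then show ?thesis using rp r by (simp only: comp_assoc)
      next
        assume r: "r = 2"
        have "f \<circ> (\<psi> 2 \<circ> \<phi> (2 + (p - 2))) \<in> decomposables A P (p + q)"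
          by (rule decomposables.prod2[OF that(1)[unfolded r] h[unfolded r] l[unfolded r]])
        then show ?thesis using rp r by (simp only: comp_assoc)
      qed
    qed
    from fd[OF 4] show ?thesis
    proof (induction rule: decomposables.induct)
      case (cob f)
      then show ?case using chain_lift_pullback_coboundary[OF _ \<phi>] decomposables.cob by blast
    next
      case (prod1 f g \<psi>)
      then show ?case using step[of f 1 g \<psi>] by (simp add: comp_def)
    next
      case (prod2 f g \<psi>)
      then show ?case using step[of f 2 g \<psi>] by (simp add: comp_def)
    next
      case (add f g)
      then show ?case using decomposables.add[OF add.IH] by (simp add: comp_def)
    qed
  qed
qed

lemma coh_classI: "(\<lambda>x. f' x - f x) \<in> coboundaries A P n \<Longrightarrow> f' \<in> coh_class A P n f"
  unfolding coh_class_def by (intro CollectI exI[of _ "\<lambda>x. f' x - f x"]) auto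

lemma coh_class_iff: "f' \<in> coh_class A P n f \<longleftrightarrow> (\<lambda>x. f' x - f x) \<in> coboundaries A P n"
proof
  assume "f' \<in> coh_class A P n f"
  then obtain b where "b \<in> coboundaries A P n" "f' = (\<lambda>x. f x + b x)" unfolding coh_class_def by blast
  then show "(\<lambda>x. f' x - f x) \<in> coboundaries A P n" by simp
qed (rule coh_classI)

lemma coboundaries_uminus: "(\<lambda>x. f x - g x) \<in> coboundaries A P n \<Longrightarrow> (\<lambda>x. g x - f x) \<in> coboundaries A P n"
  using coboundaries_scale[of "\<lambda>x. f x - g x" n "-1"] by simp

lemma coboundaries_trans: "(\<lambda>x. f x - g x) \<in> coboundaries A P n \<Longrightarrow> (\<lambda>x. g x - h x) \<in> coboundaries A P n \<Longrightarrow>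
    (\<lambda>x. f x - h x) \<in> coboundaries A P n"
  using coboundaries_add[of "\<lambda>x. f x - g x" n "\<lambda>x. g x - h x"] by simp

lemma coh_class_eqI: "(\<lambda>x. f x - g x) \<in> coboundaries A P n \<Longrightarrow> coh_class A P n f = coh_class A P n g"
  unfolding set_eq_iff coh_class_iff using coboundaries_trans coboundaries_uminus by blast

lemma coh_class_self: "f \<in> coh_class A P n f"
  using coboundaries_zero by (simp add: coh_class_iff)

lemma coh_class_zero: "coh_class A P n (\<lambda>x. 0) = coboundaries A P n"
  unfolding set_eq_iff coh_class_iff by simp

lemma coh_class_eq_zero_iff: "coh_class A P n f = coboundaries A P n \<longleftrightarrow> f \<in> coboundaries A P n"
  using coh_class_self[of f n] coh_class_eqI[of f "\<lambda>x. 0" n] coh_class_zero by auto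

lemma coh_class_cocycle: "f \<in> cocycles A P n \<Longrightarrow> f' \<in> coh_class A P n f \<Longrightarrow> f' \<in> cocycles A P n"
  unfolding coh_class_def using cocycles_add coboundaries_cocycles by blast

text \<open>
  All cosets in the union that defines the product coincide, by \<open>lift_unique\<close>.
\<close>

lemma yoneda_product_coh_class:
  assumes f: "f \<in> cocycles A P p" and g: "g \<in> cocycles A P q" and \<phi>: "chain_lift A P q g \<phi>"
  shows "yoneda_product A P p q (coh_class A P p f) (coh_class A P q g) = coh_class A P (p + q) (f \<circ> \<phi> p)"
proof -
  have "coh_class A P (p + q) (f' \<circ> \<phi>' p) = coh_class A P (p + q) (f \<circ> \<phi> p)"
    if f': "f' \<in> coh_class A P p f" and g': "g' \<in> coh_class A P q g" and \<phi>': "chain_lift A P q g' \<phi>'" for f' g' \<phi>'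
  proof -
    have 1: "(\<lambda>x. f' (\<phi>' p x) - f' (\<phi> p x)) \<in> coboundaries A P (p + q)"
      using self.lift_unique[of q g' \<phi>' g \<phi> f' p] coh_class_cocycle[OF f f'] coh_class_cocycle[OF g g'] g
        g'[unfolded coh_class_iff] \<phi> \<phi>' cocycleD(1) by (simp add: chain_lift_iff)
    have 2: "(\<lambda>x. f' (\<phi> p x) - f (\<phi> p x)) \<in> coboundaries A P (p + q)"
      using chain_lift_pullback_coboundary[OF f'[unfolded coh_class_iff] \<phi>] by (simp add: comp_def)
    show ?thesis using coboundaries_trans[OF 1 2] by (intro coh_class_eqI) simp
  qed
  then have "{coh_class A P (p + q) (f' \<circ> \<phi>' p) | f' g' \<phi>'. f' \<in> coh_class A P p f \<and> g' \<in> coh_class A P q g \<and>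
      chain_lift A P q g' \<phi>'} = {coh_class A P (p + q) (f \<circ> \<phi> p)}"
    using coh_class_self \<phi> by blast
  then show ?thesis unfolding yoneda_product_def by simp
qed

text \<open>
  An element of the Yoneda algebra is handled through a family of representing cocycles, one in each
  degree; the operations of the algebra can then be computed on representatives.
\<close>

definition family_class :: "(nat \<Rightarrow> 'm \<Rightarrow> 'k) \<Rightarrow> nat \<Rightarrow> ('m \<Rightarrow> 'k) set"
  where "family_class f = (\<lambda>n. coh_class A P n (f n))"

lemma yoneda_carrier: "u \<in> carrier (yoneda_algebra A P) \<longleftrightarrow>
    (\<exists>f. u = family_class f \<and> (\<forall>n. f n \<in> cocycles A P n) \<and> finite {n. f n \<notin> coboundaries A P n})"
proof
  assume u: "u \<in> carrier (yoneda_algebra A P)"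
  then have "\<exists>f. f \<in> cocycles A P n \<and> u n = coh_class A P n f" for n
    unfolding yoneda_algebra_def Ext_def by auto
  then obtain f where f: "\<And>n. f n \<in> cocycles A P n" "\<And>n. u n = coh_class A P n (f n)" by metis
  then have "u = family_class f" by (auto simp: family_class_def)
  moreover have "finite {n. f n \<notin> coboundaries A P n}"
    using u f(2) by (simp add: yoneda_algebra_def coh_class_eq_zero_iff)
  ultimately show "\<exists>f. u = family_class f \<and> (\<forall>n. f n \<in> cocycles A P n) \<and> finite {n. f n \<notin> coboundaries A P n}"
    using f(1) by blast
next
  assume "\<exists>f. u = family_class f \<and> (\<forall>n. f n \<in> cocycles A P n) \<and> finite {n. f n \<notin> coboundaries A P n}"
  then show "u \<in> carrier (yoneda_algebra A P)"
    by (auto simp: yoneda_algebra_def Ext_def family_class_def coh_class_eq_zero_iff)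
qed

lemma yoneda_one: "\<one>\<^bsub>yoneda_algebra A P\<^esub> = family_class (\<lambda>n. if n = 0 then res_aug P else (\<lambda>x. 0))"
  by (intro ext) (simp add: yoneda_algebra_def family_class_def coh_class_zero)

lemma yoneda_add:
  "family_class f \<oplus>\<^bsub>yoneda_algebra A P\<^esub> family_class g = family_class (\<lambda>n x. f n x + g n x)"
proof
  fix n
  have "{\<lambda>x. f' x + g' x | f' g'. f' \<in> coh_class A P n (f n) \<and> g' \<in> coh_class A P n (g n)} =
      coh_class A P n (\<lambda>x. f n x + g n x)" (is "?L = ?R")
  proof (intro equalityI subsetI)
    fix h assume "h \<in> ?L"
    then obtain f' g' where "h = (\<lambda>x. f' x + g' x)" "f' \<in> coh_class A P n (f n)" "g' \<in> coh_class A P n (g n)" by blast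
    then show "h \<in> ?R" using coboundaries_add[of "\<lambda>x. f' x - f n x" n "\<lambda>x. g' x - g n x"]
      by (simp add: coh_class_iff algebra_simps)
  next
    fix h assume "h \<in> ?R"
    then have "(\<lambda>x. h x - g n x) \<in> coh_class A P n (f n)" by (simp add: coh_class_iff algebra_simps)
    then show "h \<in> ?L" using coh_class_self[of "g n" n]
      by (intro CollectI exI[of _ "\<lambda>x. h x - g n x"] exI[of _ "g n"]) auto
  qed
  then show "(family_class f \<oplus>\<^bsub>yoneda_algebra A P\<^esub> family_class g) n = family_class (\<lambda>n x. f n x + g n x) n"
    by (simp add: yoneda_algebra_def family_class_def)
qed

lemma yoneda_smult: "c \<odot>\<^bsub>yoneda_algebra A P\<^esub> family_class f = family_class (\<lambda>n x. c * f n x)"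
proof
  fix n
  have "coh_class A P n (\<lambda>x. c * f' x) = coh_class A P n (\<lambda>x. c * f n x)" if "f' \<in> coh_class A P n (f n)" for f'
    using that coboundaries_scale[of "\<lambda>x. f' x - f n x" n c] by (intro coh_class_eqI) (simp add: coh_class_iff algebra_simps)
  then have "(\<Union>f' \<in> coh_class A P n (f n). coh_class A P n (\<lambda>x. c * f' x)) = coh_class A P n (\<lambda>x. c * f n x)"
    using coh_class_self[of "f n" n] by blast
  then show "(c \<odot>\<^bsub>yoneda_algebra A P\<^esub> family_class f) n = family_class (\<lambda>n x. c * f n x) n"
    by (simp add: yoneda_algebra_def family_class_def)
qed

text \<open>
  A sum of representatives of the summands represents the sum of the classes. Conversely, the
  coboundary by which a representative of the sum differs is added to the summand \<open>p = 0\<close>.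
\<close>

lemma yoneda_mult:
  assumes f: "\<And>n. f n \<in> cocycles A P n" and g: "\<And>n. g n \<in> cocycles A P n" and \<phi>: "\<And>q. chain_lift A P q (g q) (\<phi> q)"
  shows "family_class f \<otimes>\<^bsub>yoneda_algebra A P\<^esub> family_class g = family_class (\<lambda>n x. \<Sum>p\<le>n. f p (\<phi> (n - p) p x))"
proof
  fix n
  have yp: "yoneda_product A P p (n - p) (coh_class A P p (f p)) (coh_class A P (n - p) (g (n - p))) =
      coh_class A P n (f p \<circ> \<phi> (n - p) p)" if "p \<le> n" for p
    using yoneda_product_coh_class[OF f g \<phi>, of p "n - p"] that by simp
  have "{\<lambda>x. \<Sum>p\<le>n. h p x | h. \<forall>p \<le> n. h p \<in> coh_class A P n (f p \<circ> \<phi> (n - p) p)} =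
      coh_class A P n (\<lambda>x. \<Sum>p\<le>n. f p (\<phi> (n - p) p x))" (is "?L = ?R")
  proof (intro equalityI subsetI)
    fix k assume "k \<in> ?L"
    then obtain h where k: "k = (\<lambda>x. \<Sum>p\<le>n. h p x)" and h: "\<forall>p \<le> n. h p \<in> coh_class A P n (f p \<circ> \<phi> (n - p) p)" by blast
    have "(\<lambda>x. \<Sum>p\<le>n. h p x - f p (\<phi> (n - p) p x)) \<in> coboundaries A P n"
      by (intro coboundaries_sum) (use h in \<open>auto simp: coh_class_iff\<close>)
    then show "k \<in> ?R" by (simp add: coh_class_iff k sum_subtractf)
  next
    fix k assume k: "k \<in> ?R"
    define h where "h = (\<lambda>p x. f p (\<phi> (n - p) p x) + (if p = 0 then k x - (\<Sum>p\<le>n. f p (\<phi> (n - p) p x)) else 0))"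
    have "k = (\<lambda>x. \<Sum>p\<le>n. h p x)" by (simp add: h_def sum.distrib)
    moreover have "h p \<in> coh_class A P n (f p \<circ> \<phi> (n - p) p)" for p
      using k by (cases "p = 0") (simp_all add: h_def coh_class_iff coboundaries_zero)
    ultimately show "k \<in> ?L" by blast
  qed
  moreover have "(family_class f \<otimes>\<^bsub>yoneda_algebra A P\<^esub> family_class g) n =
     {\<lambda>x. \<Sum>p\<le>n. h p x | h. \<forall>p \<le> n. h p \<in> coh_class A P n (f p \<circ> \<phi> (n - p) p)}"
    using yp by (simp add: yoneda_algebra_def family_class_def)
  ultimately show "(family_class f \<otimes>\<^bsub>yoneda_algebra A P\<^esub> family_class g) n =
      family_class (\<lambda>n x. \<Sum>p\<le>n. f p (\<phi> (n - p) p x)) n"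
    by (simp add: family_class_def)
qed

definition in_degree :: "nat \<Rightarrow> ('m \<Rightarrow> 'k) \<Rightarrow> nat \<Rightarrow> 'm \<Rightarrow> 'k"
  where "in_degree n f = (\<lambda>m. if m = n then f else (\<lambda>x. 0))"

lemma in_degree_cocycles: "f \<in> cocycles A P n \<Longrightarrow> in_degree n f m \<in> cocycles A P m"
  by (simp add: in_degree_def cocycles_zero)

lemma in_degree_mult:
  assumes f: "f \<in> cocycles A P p" and g: "g \<in> cocycles A P q" and \<phi>: "chain_lift A P q g \<phi>"
  shows "family_class (in_degree p f) \<otimes>\<^bsub>yoneda_algebra A P\<^esub> family_class (in_degree q g) =
      family_class (in_degree (p + q) (f \<circ> \<phi> p))"
proof -
  \<comment> \<open>a lift of every member of the family \<open>in_degree q g\<close>; the zero members are lifted by zero\<close>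
  define \<Phi> where "\<Phi> = (\<lambda>r. if r = q then \<phi> else (\<lambda>i x. \<zero>\<^bsub>res_mod P i\<^esub>))"
  have \<Phi>: "chain_lift A P r (in_degree q g r) (\<Phi> r)" for r
    using \<phi> chain_lift_zero by (simp add: \<Phi>_def in_degree_def)
  have f0: "f \<zero>\<^bsub>res_mod P p\<^esub> = 0" using cochain_zero_val cocycleD(1)[OF f] by blast
  have "(\<Sum>r\<le>n. in_degree p f r (\<Phi> (n - r) r x)) = in_degree (p + q) (f \<circ> \<phi> p) n x" for n x
  proof -
    have "(\<Sum>r\<le>n. in_degree p f r (\<Phi> (n - r) r x)) = (\<Sum>r\<in>{..n} \<inter> {p}. f (\<Phi> (n - r) r x))"
      by (rule sum.mono_neutral_cong_right) (auto simp: in_degree_def)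
    also have "\<dots> = in_degree (p + q) (f \<circ> \<phi> p) n x"
      using f0 by (cases "p \<le> n") (auto simp: in_degree_def \<Phi>_def)
    finally show ?thesis .
  qed
  then show ?thesis
    using yoneda_mult[of "in_degree p f" "in_degree q g" \<Phi>] in_degree_cocycles f g \<Phi> by simp
qed

lemma in_degree_carrier:
  assumes "f \<in> cocycles A P n"
  shows "family_class (in_degree n f) \<in> yoneda_comp A P n"
proof -
  have "{m. in_degree n f m \<notin> coboundaries A P m} \<subseteq> {n}" by (auto simp: in_degree_def coboundaries_zero)
  then have "finite {m. in_degree n f m \<notin> coboundaries A P m}" by (rule finite_subset) simp
  then have "family_class (in_degree n f) \<in> carrier (yoneda_algebra A P)"
    unfolding yoneda_carrier using in_degree_cocycles[OF assms] by blast
  then show ?thesis unfolding yoneda_comp_def by (simp add: family_class_def in_degree_def coh_class_zero)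
qed

text \<open>
  The families all of whose members in degrees above 2 are decomposable form a subalgebra that
  contains \<open>E\<^sup>1\<close> and \<open>E\<^sup>2\<close>.
\<close>

lemma generated_families:
  assumes "u \<in> generated_subalgebra (yoneda_algebra A P) (yoneda_comp A P 1 \<union> yoneda_comp A P 2)"
  shows "\<exists>f. u = family_class f \<and> (\<forall>n. f n \<in> cocycles A P n) \<and> finite {n. f n \<notin> coboundaries A P n} \<and>
    (\<forall>n > 2. f n \<in> decomposables A P n)"
  using assms
proof (induction rule: generated_subalgebra.induct)
  case one
  have "{n. (if n = 0 then res_aug P else (\<lambda>x. 0)) \<notin> coboundaries A P n} \<subseteq> {0}"
    by (auto simp: coboundaries_zero)
  then have "finite {n. (if n = 0 then res_aug P else (\<lambda>x. 0)) \<notin> coboundaries A P n}" by (rule finite_subset) simp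
  then show ?case unfolding yoneda_one
    by (intro exI[of _ "\<lambda>n. if n = 0 then res_aug P else (\<lambda>x. 0)"])
      (simp add: aug_cocycle cocycles_zero decomposables.cob coboundaries_zero)
next
  case (incl u)
  then have "u \<in> carrier (yoneda_algebra A P)" and z: "\<And>n. n > 2 \<Longrightarrow> u n = coboundaries A P n"
    by (auto simp: yoneda_comp_def)
  then obtain f where f: "u = family_class f" "\<forall>n. f n \<in> cocycles A P n" "finite {n. f n \<notin> coboundaries A P n}"
    using yoneda_carrier by blast
  have "f n \<in> decomposables A P n" if "n > 2" for n
    using z[OF that] f(1) by (intro decomposables.cob) (simp add: family_class_def coh_class_eq_zero_iff)
  then show ?case using f by blast
next
  case (add u v)
  then obtain f g where f: "u = family_class f" "\<forall>n. f n \<in> cocycles A P n" "finite {n. f n \<notin> coboundaries A P n}"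
      "\<forall>n > 2. f n \<in> decomposables A P n"
    and g: "v = family_class g" "\<forall>n. g n \<in> cocycles A P n" "finite {n. g n \<notin> coboundaries A P n}"
      "\<forall>n > 2. g n \<in> decomposables A P n" by blast
  have "{n. (\<lambda>x. f n x + g n x) \<notin> coboundaries A P n} \<subseteq> {n. f n \<notin> coboundaries A P n} \<union> {n. g n \<notin> coboundaries A P n}"
    using coboundaries_add by blast
  then have "finite {n. (\<lambda>x. f n x + g n x) \<notin> coboundaries A P n}" using f(3) g(3) by (rule finite_subset[OF _ finite_UnI])
  then show ?case using f g
    by (intro exI[of _ "\<lambda>n x. f n x + g n x"]) (simp add: yoneda_add cocycles_add decomposables.add)
next
  case (smult u c)
  then obtain f where f: "u = family_class f" "\<forall>n. f n \<in> cocycles A P n" "finite {n. f n \<notin> coboundaries A P n}"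
      "\<forall>n > 2. f n \<in> decomposables A P n" by blast
  have "{n. (\<lambda>x. c * f n x) \<notin> coboundaries A P n} \<subseteq> {n. f n \<notin> coboundaries A P n}"
    using coboundaries_scale by blast
  then have "finite {n. (\<lambda>x. c * f n x) \<notin> coboundaries A P n}" using f(3) by (rule finite_subset)
  then show ?case using f
    by (intro exI[of _ "\<lambda>n x. c * f n x"]) (simp add: yoneda_smult cocycles_scale decomposables_scale)
next
  case (mult u v)
  then obtain f g where f: "u = family_class f" "\<forall>n. f n \<in> cocycles A P n" "finite {n. f n \<notin> coboundaries A P n}"
      "\<forall>n > 2. f n \<in> decomposables A P n"
    and g: "v = family_class g" "\<forall>n. g n \<in> cocycles A P n" "finite {n. g n \<notin> coboundaries A P n}"
      "\<forall>n > 2. g n \<in> decomposables A P n" by blast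
  have "\<forall>q. \<exists>\<phi>. chain_lift A P q (g q) \<phi>" using chain_lift_exists g(2) by blast
  then obtain \<phi> where \<phi>: "\<And>q. chain_lift A P q (g q) (\<phi> q)" by metis
  define h where "h = (\<lambda>n x. \<Sum>p\<le>n. f p (\<phi> (n - p) p x))"
  have summand: "f p \<circ> \<phi> (n - p) p \<in> cocycles A P n" if "p \<le> n" for p n
    using chain_lift_pullback[OF f(2)[rule_format] \<phi>, of p "n - p"] that by simp
  have "u \<otimes>\<^bsub>yoneda_algebra A P\<^esub> v = family_class h"
    unfolding f(1) g(1) h_def using yoneda_mult f(2) g(2) \<phi> by blast
  moreover have "h n \<in> cocycles A P n" for n
    unfolding h_def by (intro cocycles_sum) (use summand in \<open>auto simp: comp_def\<close>)
  moreover have "h n \<in> decomposables A P n" if "n > 2" for n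
  proof -
    have "(\<lambda>x. f p (\<phi> (n - p) p x)) \<in> decomposables A P n" if p: "p \<le> n" for p
      using decomposables_times[OF f(2)[rule_format] g(2)[rule_format] \<phi>, of p "n - p"] f(4) g(4) p \<open>n > 2\<close>
      by (simp add: comp_def)
    then show ?thesis unfolding h_def by (intro decomposables_sum) auto
  qed
  moreover have "finite {n. h n \<notin> coboundaries A P n}"
  proof -
    have "h n \<in> coboundaries A P n"
      if n: "n \<notin> (\<lambda>(p, q). p + q) ` ({n. f n \<notin> coboundaries A P n} \<times> {n. g n \<notin> coboundaries A P n})" for n
      unfolding h_def
    proof (intro coboundaries_sum)
      fix p assume "p \<in> {..n}"
      then have p: "p + (n - p) = n" by simp
      consider "f p \<in> coboundaries A P p" | "g (n - p) \<in> coboundaries A P (n - p)"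
        using n p by (metis (mono_tags, lifting) SigmaI case_prod_conv image_eqI mem_Collect_eq)
      then show "(\<lambda>x. f p (\<phi> (n - p) p x)) \<in> coboundaries A P n"
      proof cases
        case 1
        then show ?thesis using chain_lift_pullback_coboundary[OF 1 \<phi>, of "n - p"] p by (simp add: comp_def)
      next
        case 2
        have "(\<lambda>x. f p (\<phi> (n - p) p x) - f p (\<zero>\<^bsub>res_mod P p\<^esub>)) \<in> coboundaries A P (p + (n - p))"
          using self.lift_unique[of "n - p" "g (n - p)" "\<phi> (n - p)" "\<lambda>x. 0" "\<lambda>i x. \<zero>\<^bsub>res_mod P i\<^esub>" "f p" p] \<phi>[of "n - p"]
            chain_lift_zero[of "n - p"] 2 g(2) f(2) cochains_zero cocycleD(1) by (simp add: chain_lift_iff)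
        then show ?thesis using p cochain_zero_val[OF cocycleD(1)[OF f(2)[rule_format, of p]]] by simp
      qed
    qed
    then have "{n. h n \<notin> coboundaries A P n} \<subseteq>
        (\<lambda>(p, q). p + q) ` ({n. f n \<notin> coboundaries A P n} \<times> {n. g n \<notin> coboundaries A P n})" by blast
    then show ?thesis using f(3) g(3) by (rule finite_subset[OF _ finite_imageI[OF finite_cartesian_product]])
  qed
  ultimately show ?case by blast
qed

lemma zero_generated: "family_class (\<lambda>m x. 0) \<in> generated_subalgebra (yoneda_algebra A P) S"
  using generated_subalgebra.smult[OF generated_subalgebra.one, where c = 0 and E = "yoneda_algebra A P" and S = S]
  by (simp add: yoneda_one yoneda_smult)

text \<open>
  Induction on the degree: a decomposable class is a sum of products of classes of smaller degree
  with classes of degree 1 or 2, while degree 0 consists of the multiples of the unit.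
\<close>

lemma generated_in_degree:
  assumes dec: "\<And>n. n > 2 \<Longrightarrow> cocycles A P n \<subseteq> decomposables A P n" and f: "f \<in> cocycles A P n"
  shows "family_class (in_degree n f) \<in> generated_subalgebra (yoneda_algebra A P) (yoneda_comp A P 1 \<union> yoneda_comp A P 2)"
    (is "_ \<in> ?G")
  using f
proof (induction n arbitrary: f rule: less_induct)
  case (less n)
  have low: "family_class (in_degree r f) \<in> ?G" if "f \<in> cocycles A P r" "r = 1 \<or> r = 2" for f r
    using that in_degree_carrier by (intro generated_subalgebra.incl) blast
  consider "n = 0" | "n = 1 \<or> n = 2" | "n > 2" by linarith
  then show ?case
  proof cases
    case 1
    then obtain k where k: "f = (\<lambda>x. k * res_aug P x)" using cocycle_0 less.prems by blast
    have "(\<lambda>n x. k * (if n = 0 then res_aug P else (\<lambda>x. 0)) x) = in_degree 0 f"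
      by (auto simp: in_degree_def k)
    then show ?thesis
      using generated_subalgebra.smult[OF generated_subalgebra.one, where c = k and E = "yoneda_algebra A P"] 1
      by (simp add: yoneda_one yoneda_smult)
  next
    case 2
    then show ?thesis using low less.prems by blast
  next
    case 3
    then have "f \<in> decomposables A P n" using dec less.prems by blast
    then show ?thesis
    proof (induction rule: decomposables.induct)
      case (cob f)
      then have "family_class (in_degree n f) = family_class (\<lambda>m x. 0)"
        by (intro ext) (simp add: family_class_def in_degree_def coh_class_zero coh_class_eq_zero_iff coboundaries_zero)
      then show ?case using zero_generated by simp
    next
      case (prod1 f g \<phi>)
      then show ?case
        using in_degree_mult[OF prod1] generated_subalgebra.mult[OF low[OF prod1(1)] less.IH[OF _ prod1(2)]] 3 by (simp add: comp_def)
    next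
      case (prod2 f g \<phi>)
      have "2 + (n - 2) = n" using 3 by simp
      then show ?case
        using in_degree_mult[OF prod2] generated_subalgebra.mult[OF low[OF prod2(1)] less.IH[OF _ prod2(2)]] 3 by (simp add: comp_def)
    next
      case (add f g)
      have "(\<lambda>m x. in_degree n f m x + in_degree n g m x) = in_degree n (\<lambda>x. f x + g x)"
        by (auto simp: in_degree_def)
      then show ?case using generated_subalgebra.add[OF add.IH] by (simp add: yoneda_add)
    qed
  qed
qed

lemma K2_iff_decomposables: "K2 A P \<longleftrightarrow> (\<forall>n > 2. cocycles A P n \<subseteq> decomposables A P n)"
proof
  assume K2: "K2 A P"
  show "\<forall>n > 2. cocycles A P n \<subseteq> decomposables A P n"
  proof (intro allI impI subsetI)
    fix n f assume n: "n > (2::nat)" and f: "f \<in> cocycles A P n"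
    have "family_class (in_degree n f) \<in> carrier (yoneda_algebra A P)"
      using in_degree_carrier[OF f] by (simp add: yoneda_comp_def)
    then obtain g where g: "family_class (in_degree n f) = family_class g" "g n \<in> decomposables A P n"
      using K2 generated_families n unfolding K2_def by blast
    then have "coh_class A P n f = coh_class A P n (g n)" by (auto simp: family_class_def in_degree_def dest: fun_cong[of _ _ n])
    then have "f \<in> coh_class A P n (g n)" using coh_class_self by blast
    then show "f \<in> decomposables A P n" using g(2) decomposables_shift by (simp add: coh_class_iff)
  qed
next
  assume dec: "\<forall>n > 2. cocycles A P n \<subseteq> decomposables A P n"
  let ?G = "generated_subalgebra (yoneda_algebra A P) (yoneda_comp A P 1 \<union> yoneda_comp A P 2)"
  have sub: "?G \<subseteq> carrier (yoneda_algebra A P)"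
  proof
    fix u assume "u \<in> ?G"
    from generated_families[OF this] show "u \<in> carrier (yoneda_algebra A P)" unfolding yoneda_carrier by blast
  qed
  have fin: "family_class f \<in> ?G" if "\<forall>n. f n \<in> cocycles A P n" "{n. f n \<notin> coboundaries A P n} \<subseteq> S" "finite S" for f S
    using that(3,1,2)
  proof (induction S arbitrary: f rule: finite_induct)
    case empty
    have "family_class f = family_class (\<lambda>m x. 0)"
      using empty by (intro ext) (simp add: family_class_def coh_class_zero coh_class_eq_zero_iff)
    then show ?case using zero_generated by simp
  next
    case (insert n S)
    have 1: "family_class (f(n := \<lambda>x. 0)) \<in> ?G"
      using insert.prems by (intro insert.IH) (auto simp: cocycles_zero coboundaries_zero)
    have 2: "family_class (in_degree n (f n)) \<in> ?G"
      by (rule generated_in_degree) (use dec insert.prems in auto)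
    have 3: "(\<lambda>m x. (f(n := \<lambda>x. 0)) m x + in_degree n (f n) m x) = f"
      by (auto simp: in_degree_def)
    show ?case using generated_subalgebra.add[OF 1 2] unfolding yoneda_add 3 .
  qed
  have "carrier (yoneda_algebra A P) \<subseteq> ?G"
  proof
    fix u assume "u \<in> carrier (yoneda_algebra A P)"
    then obtain f where "u = family_class f" "\<forall>n. f n \<in> cocycles A P n" "finite {n. f n \<notin> coboundaries A P n}"
      unfolding yoneda_carrier by blast
    then show "u \<in> ?G" using fin[OF _ subset_refl] by simp
  qed
  with sub show "K2 A P" unfolding K2_def by blast
qed

end


section \<open>Independence of the resolution\<close>

context two_resol
begin

text \<open>
  Pulling back along \<open>\<alpha>\<close> respects products: if \<open>\<phi>\<close> lifts \<open>g\<close> and \<open>\<chi>\<close> lifts the pullback of \<open>g\<close>, then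
  \<open>\<phi> \<circ> \<alpha>\<close> and \<open>\<alpha> \<circ> \<chi>\<close> lift the same cocycle from \<open>P\<close> to \<open>Q\<close>.
\<close>

lemma pullback_decomposables:
  assumes f: "f \<in> decomposables A Q n" and \<alpha>: "cross_lift A P Q 0 (res_aug P) \<alpha>" and n: "n \<ge> 2"
  shows "f \<circ> \<alpha> n \<in> decomposables A P n"
proof -
  have "\<exists>h \<chi>. h \<in> cocycles A P (n - r) \<and> chain_lift A P (n - r) h \<chi> \<and> f \<circ> \<alpha> r \<in> cocycles A P r \<and>
      (\<lambda>x. (f \<circ> \<phi> r \<circ> \<alpha> n) x - (f \<circ> \<alpha> r \<circ> \<chi> r) x) \<in> coboundaries A P n"
    if f: "f \<in> cocycles A Q r" and g: "g \<in> cocycles A Q (n - r)" and \<phi>: "chain_lift A Q (n - r) g \<phi>" and r: "r \<le> n" for f g \<phi> r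
  proof -
    have h: "g \<circ> \<alpha> (n - r) \<in> cocycles A P (n - r)" using pullback_cocycle[OF g \<alpha>] by simp
    obtain \<chi> where \<chi>: "chain_lift A P (n - r) (g \<circ> \<alpha> (n - r)) \<chi>" using P.chain_lift_exists[OF h] by blast
    have 1: "cross_lift A P Q (n - r) (g \<circ> \<alpha> (n - r)) (\<lambda>i. \<phi> i \<circ> \<alpha> (i + (n - r)))"
      using cross_lift_comp[OF P.resol_axioms Q.resol_axioms Q.resol_axioms \<phi>[unfolded chain_lift_iff] \<alpha>] by simp
    have "cross_lift A P Q (0 + (n - r)) (res_aug P \<circ> \<chi> 0) (\<lambda>i. \<alpha> i \<circ> \<chi> (i + 0))"
      using cross_lift_comp[OF P.resol_axioms P.resol_axioms Q.resol_axioms \<alpha> \<chi>[unfolded chain_lift_iff]] .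
    then have 2: "cross_lift A P Q (n - r) (g \<circ> \<alpha> (n - r)) (\<lambda>i. \<alpha> i \<circ> \<chi> i)"
      using cross_lift_cong[of A P Q "n - r" "res_aug P \<circ> \<chi> 0"] cross_liftD(2)[OF \<chi>[unfolded chain_lift_iff]] by simp
    have "(\<lambda>x. f (\<phi> r (\<alpha> (r + (n - r)) x)) - f (\<alpha> r (\<chi> r x))) \<in> coboundaries A P (r + (n - r))"
      using lift_unique[OF 1 2 _ P.cocycleD(1)[OF h] P.cocycleD(1)[OF h] f] P.coboundaries_zero by simp
    moreover have "f \<circ> \<alpha> r \<in> cocycles A P r" using pullback_cocycle[OF f \<alpha>] by simp
    ultimately show ?thesis using h \<chi> r by auto
  qed note key = this
  from f show ?thesis
  proof (induction rule: decomposables.induct)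
    case (cob f)
    then show ?case using decomposables.cob[OF pullback_coboundary[OF cob \<alpha>]] by (simp add: comp_def)
  next
    case (prod1 f g \<phi>)
    then obtain h \<chi> where "h \<in> cocycles A P (n - 1)" "chain_lift A P (n - 1) h \<chi>" "f \<circ> \<alpha> 1 \<in> cocycles A P 1"
      "(\<lambda>x. (f \<circ> \<phi> 1 \<circ> \<alpha> n) x - (f \<circ> \<alpha> 1 \<circ> \<chi> 1) x) \<in> coboundaries A P n" using key[OF prod1] n by auto
    then show ?case using P.decomposables_shift decomposables.prod1 by blast
  next
    case (prod2 f g \<phi>)
    then obtain h \<chi> where "h \<in> cocycles A P (n - 2)" "chain_lift A P (n - 2) h \<chi>" "f \<circ> \<alpha> 2 \<in> cocycles A P 2"
      "(\<lambda>x. (f \<circ> \<phi> 2 \<circ> \<alpha> n) x - (f \<circ> \<alpha> 2 \<circ> \<chi> 2) x) \<in> coboundaries A P n" using key[OF prod2] n by auto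
    then show ?case using P.decomposables_shift decomposables.prod2 by blast
  next
    case (add f g)
    then show ?case using decomposables.add[OF add.IH] by (simp add: comp_def)
  qed
qed

text \<open>
  \<open>\<beta> \<circ> \<alpha>\<close> and the identity of \<open>P\<close> both lift the augmentation of \<open>P\<close>.
\<close>

lemma round_trip:
  obtains \<alpha> \<beta> where "cross_lift A P Q 0 (res_aug P) \<alpha>" "cross_lift A Q P 0 (res_aug Q) \<beta>"
    "\<And>n f. f \<in> cocycles A P n \<Longrightarrow> (\<lambda>x. f x - f (\<beta> n (\<alpha> n x))) \<in> coboundaries A P n"
proof -
  interpret QP: two_resol A Q P by (intro two_resol.intro P.resol_axioms Q.resol_axioms)
  interpret PP: two_resol A P P by (intro two_resol.intro P.resol_axioms)
  obtain \<alpha> where \<alpha>: "cross_lift A P Q 0 (res_aug P) \<alpha>" using lift_exists[OF P.aug_cocycle] by blast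
  obtain \<beta> where \<beta>: "cross_lift A Q P 0 (res_aug Q) \<beta>" using QP.lift_exists[OF Q.aug_cocycle] by blast
  \<comment> \<open>the identity, made zero outside the carriers as homogeneous homomorphisms are required to be\<close>
  define ident where "ident = (\<lambda>i x. if x \<in> carrier (res_mod P i) then x else \<zero>\<^bsub>res_mod P i\<^esub>)"
  have "ident i \<in> hom_deg A (res_mod P i) (res_mod P i) 0" for i
  proof -
    interpret Pi: gmod A "res_mod P i" by (rule P.is_gmod)
    show ?thesis by (auto simp: hom_deg_iff lin_map_def ident_def Pi.smult_closed Pi.mcomp_carrier)
  qed
  then have "ident i \<in> graded_hom A (res_mod P i) (res_mod P i)" for i
    using hom_deg_graded_hom[OF P.is_gmod] by blast
  then have id: "cross_lift A P P 0 (res_aug P) ident"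
    using P.diff_closed by (auto simp: cross_lift_def ident_def)
  have "cross_lift A P P (0 + 0) (res_aug Q \<circ> \<alpha> 0) (\<lambda>i. \<beta> i \<circ> \<alpha> (i + 0))"
    using cross_lift_comp[OF P.resol_axioms Q.resol_axioms P.resol_axioms \<beta> \<alpha>] .
  then have ba: "cross_lift A P P 0 (res_aug P) (\<lambda>i. \<beta> i \<circ> \<alpha> i)"
    using cross_lift_cong[of A P P 0 "res_aug Q \<circ> \<alpha> 0"] cross_liftD(2)[OF \<alpha>] by simp
  have "(\<lambda>x. f x - f (\<beta> n (\<alpha> n x))) \<in> coboundaries A P n" if f: "f \<in> cocycles A P n" for f n
  proof -
    have "f (ident n x) = f x" for x
      using lin_map_outside[OF P.cochain_lin[OF P.cocycleD(1)[OF f]], of x] P.cochain_zero_val[OF P.cocycleD(1)[OF f]]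
      by (simp add: ident_def)
    then show ?thesis
      using PP.lift_unique[OF id ba _ P.cocycleD(1) P.cocycleD(1) f] P.aug_cocycle P.coboundaries_zero by simp
  qed
  then show ?thesis using that \<alpha> \<beta> by blast
qed

lemma transfer_decomposables:
  assumes "cocycles A Q n \<subseteq> decomposables A Q n" "n \<ge> 2"
  shows "cocycles A P n \<subseteq> decomposables A P n"
proof
  interpret QP: two_resol A Q P by (intro two_resol.intro P.resol_axioms Q.resol_axioms)
  fix f assume f: "f \<in> cocycles A P n"
  obtain \<alpha> \<beta> where \<alpha>: "cross_lift A P Q 0 (res_aug P) \<alpha>" and \<beta>: "cross_lift A Q P 0 (res_aug Q) \<beta>"
    and ba: "(\<lambda>x. f x - f (\<beta> n (\<alpha> n x))) \<in> coboundaries A P n" using round_trip f by metis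
  have "f \<circ> \<beta> n \<in> decomposables A Q n" using QP.pullback_cocycle[OF f \<beta>] assms by auto
  then have "f \<circ> \<beta> n \<circ> \<alpha> n \<in> decomposables A P n" using pullback_decomposables[OF _ \<alpha> assms(2)] by blast
  then show "f \<in> decomposables A P n" using P.decomposables_shift[of "f \<circ> \<beta> n \<circ> \<alpha> n"] ba by simp
qed

text \<open>
  Up to a coboundary, a cocycle factors through \<open>Q\<^sup>n = 0\<close>.
\<close>

lemma cocycles_vanish:
  assumes "carrier (res_mod Q n) = {\<zero>\<^bsub>res_mod Q n\<^esub>}"
  shows "cocycles A P n \<subseteq> coboundaries A P n"
proof
  interpret QP: two_resol A Q P by (intro two_resol.intro P.resol_axioms Q.resol_axioms)
  fix f assume f: "f \<in> cocycles A P n"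
  obtain \<alpha> \<beta> where \<alpha>: "cross_lift A P Q 0 (res_aug P) \<alpha>" and \<beta>: "cross_lift A Q P 0 (res_aug Q) \<beta>"
    and ba: "(\<lambda>x. f x - f (\<beta> n (\<alpha> n x))) \<in> coboundaries A P n" using round_trip f by metis
  have "\<alpha> n x = \<zero>\<^bsub>res_mod Q n\<^esub>" for x
    using lin_map_closed[OF Q.is_gmod graded_hom_lin[OF P.is_gmod Q.is_gmod cross_liftD(1)[OF \<alpha>, of n]]] assms by simp
  moreover have "f \<circ> \<beta> n \<in> cochains A Q n" using QP.pullback_cocycle[OF f \<beta>] Q.cocycleD(1) by simp
  then have "f (\<beta> n \<zero>\<^bsub>res_mod Q n\<^esub>) = 0" using Q.cochain_zero_val[of "f \<circ> \<beta> n"] by simp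
  ultimately show "f \<in> coboundaries A P n" using ba by simp
qed

end

lemma (in resol) cocycles_above_proj_dim:
  assumes "proj_dim A < enat n"
  shows "cocycles A P n \<subseteq> coboundaries A P n"
proof -
  obtain Q :: "('a, nat \<Rightarrow> 'a, 'k) resolution" where Q: "graded_projective_resolution A Q" "res_length Q < enat n"
    using assms unfolding proj_dim_def Inf_less_iff by auto
  interpret Q: resol A Q by unfold_locales (rule Q(1))
  interpret two_resol A P Q by unfold_locales
  have "carrier (res_mod Q n) = {\<zero>\<^bsub>res_mod Q n\<^esub>}"
  proof (rule ccontr)
    assume "\<not> ?thesis"
    then have "enat n \<le> res_length Q" unfolding res_length_def by (intro SUP_upper) simp
    then show False using Q(2) by simp
  qed
  then show ?thesis by (rule cocycles_vanish)
qed


section \<open>The free algebra\<close>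

lemma fword_add_letters [simp]: "letters (u + v) = letters u @ letters v"
  by (simp add: plus_fword_def)

lemma fword_zero_letters [simp]: "letters 0 = []"
  by (simp add: zero_fword_def)

lemma fword_eq_zero_iff: "w = 0 \<longleftrightarrow> letters w = []"
  by (metis fword.collapse fword_zero_letters)

lemma fword_add_eq_zero [simp]: "u + v = (0 :: 'x fword) \<longleftrightarrow> u = 0 \<and> v = 0"
  by (simp add: fword_eq_zero_iff)

lemma free_alg_expand: "p = (\<Sum>w\<in>Poly_Mapping.keys p. Poly_Mapping.single w (Poly_Mapping.lookup p w))"
  for p :: "('x, 'k::field) free_alg"
  by (rule poly_mapping_eqI) (auto simp: lookup_sum lookup_single when_def in_keys_iff)

text \<open>
  Restricting the words to those of \<open>p\<close> makes the rule usable for subalgebras spanned by words.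
\<close>

lemma free_alg_induct [case_names zero word add]:
  fixes p :: "('x, 'k::field) free_alg"
  assumes "Pr 0" "\<And>w c. w \<in> Poly_Mapping.keys p \<Longrightarrow> Pr (Poly_Mapping.single w c)"
    and "\<And>p q. Pr p \<Longrightarrow> Pr q \<Longrightarrow> Pr (p + q)"
  shows "Pr p"
proof -
  have "Pr (\<Sum>w\<in>S. Poly_Mapping.single w (Poly_Mapping.lookup p w))" if "finite S" "S \<subseteq> Poly_Mapping.keys p" for S
    using that by (induction S rule: finite_induct) (auto intro: assms)
  then show ?thesis using free_alg_expand[of p] by (metis finite_keys subset_refl)
qed

lemma const_add: "const (c + d) = const c + const d"
  by (simp add: const_def single_add)

lemma const_mult: "const (c * d) = const c * const d"
  by (simp add: const_def mult_single)

lemma const_zero [simp]: "const 0 = 0"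
  by (simp add: const_def)

lemma const_sum: "const (\<Sum>c\<in>C. F c) = (\<Sum>c\<in>C. const (F c))"
  by (induction C rule: infinite_finite_induct) (simp_all add: const_add)

lemma const_one [simp]: "const 1 = 1"
  by (simp add: const_def)

lemma const_uminus: "const (- c) = - const c"
  by (simp add: const_def single_uminus)

lemma const_commute: "const c * p = p * const c"
  by (induction p rule: free_alg_induct) (simp_all add: const_def mult_single algebra_simps)

lemma lookup_const_mult [simp]: "Poly_Mapping.lookup (const c * p) w = c * Poly_Mapping.lookup p w"
  by (induction p rule: free_alg_induct)
    (simp_all add: const_def mult_single lookup_single lookup_add when_def algebra_simps)

lemma lookup_const_zero [simp]: "Poly_Mapping.lookup (const c) 0 = c"
  by (simp add: const_def)

lemma lookup_mult_zero [simp]: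
  "Poly_Mapping.lookup (p * q) 0 = Poly_Mapping.lookup p 0 * Poly_Mapping.lookup q (0 :: 'x fword)"
  for p q :: "('x, 'k::field) free_alg"
proof (induction p rule: free_alg_induct)
  case (word u c)
  show ?case
    by (induction q rule: free_alg_induct)
      (auto simp: mult_single lookup_single lookup_add when_def distrib_left)
qed (simp_all add: lookup_add distrib_right)

lemma lookup_letter_zero [simp]: "Poly_Mapping.lookup (letter x) 0 = 0"
  by (simp add: letter_def lookup_single zero_fword_def)

lemma lookup_one_zero [simp]: "Poly_Mapping.lookup 1 (0 :: 'x fword) = (1 :: 'k::field)"
  using lookup_const_zero[of 1] by simp

text \<open>
  Right multiplication by a letter shifts coefficients to the words that end in it.
\<close>

lemma lookup_mult_letter:
  "Poly_Mapping.lookup (p * letter x) (FWord (u @ [y])) = (if x = y then Poly_Mapping.lookup p (FWord u) else 0)"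
proof (induction p rule: free_alg_induct)
  case (word w c)
  show ?case by (cases w) (auto simp: letter_def mult_single lookup_single plus_fword_def when_def)
qed (simp_all add: distrib_right lookup_add)


section \<open>The tensor algebra as a ring\<close>

lemma tensor_carrier: "p \<in> carrier (tensor_algebra X) \<longleftrightarrow> (\<forall>w \<in> Poly_Mapping.keys p. set (letters w) \<subseteq> X)"
  by (simp add: tensor_algebra_def)

lemma tensor_ops [simp]:
  "p \<otimes>\<^bsub>tensor_algebra X\<^esub> q = p * q" "p \<oplus>\<^bsub>tensor_algebra X\<^esub> q = p + q"
  "\<zero>\<^bsub>tensor_algebra X\<^esub> = 0" "\<one>\<^bsub>tensor_algebra X\<^esub> = 1"
  by (simp_all add: tensor_algebra_def)

lemma tensor_zero [simp]: "0 \<in> carrier (tensor_algebra X)"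
  by (simp add: tensor_carrier)

lemma tensor_const [simp]: "const c \<in> carrier (tensor_algebra X)"
  by (simp add: tensor_carrier const_def)

lemma tensor_one [simp]: "1 \<in> carrier (tensor_algebra X)"
  using tensor_const[of 1] by simp

lemma tensor_letter [simp]: "x \<in> X \<Longrightarrow> letter x \<in> carrier (tensor_algebra X)"
  by (simp add: tensor_carrier letter_def)

lemma tensor_add [simp]: "p \<in> carrier (tensor_algebra X) \<Longrightarrow> q \<in> carrier (tensor_algebra X) \<Longrightarrow> p + q \<in> carrier (tensor_algebra X)"
  using keys_add[of p q] by (auto simp: tensor_carrier)

lemma tensor_mult [simp]: "p \<in> carrier (tensor_algebra X) \<Longrightarrow> q \<in> carrier (tensor_algebra X) \<Longrightarrow> p * q \<in> carrier (tensor_algebra X)"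
  using keys_mult[of p q] by (fastforce simp: tensor_carrier)

lemma tensor_uminus [simp]: "p \<in> carrier (tensor_algebra X) \<Longrightarrow> - p \<in> carrier (tensor_algebra X)"
  using tensor_mult[OF tensor_const[of "-1"]] by (simp add: const_uminus)

lemma tensor_minus [simp]: "p \<in> carrier (tensor_algebra X) \<Longrightarrow> q \<in> carrier (tensor_algebra X) \<Longrightarrow> p - q \<in> carrier (tensor_algebra X)"
  using tensor_add[OF _ tensor_uminus] by (metis diff_conv_add_uminus)

lemma tensor_sum [simp]: "(\<And>i. i \<in> S \<Longrightarrow> f i \<in> carrier (tensor_algebra X)) \<Longrightarrow> sum f S \<in> carrier (tensor_algebra X)"
  by (induction S rule: infinite_finite_induct) auto

lemma tensor_abelian: "abelian_group (tensor_algebra X)"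
  by (rule abelian_groupI) (auto simp: algebra_simps intro!: bexI[of _ "- x" for x])

lemma tensor_ring: "ring (tensor_algebra X)"
  by (rule ringI[OF tensor_abelian]) (auto intro!: monoidI simp: algebra_simps)

lemma tensor_a_inv [simp]: "p \<in> carrier (tensor_algebra X) \<Longrightarrow> \<ominus>\<^bsub>tensor_algebra X\<^esub> p = - p"
  by (rule abelian_group.minus_equality[OF tensor_abelian]) auto

lemma tensor_idealI:
  assumes "J \<subseteq> carrier (tensor_algebra X)" "0 \<in> J" "\<And>p q. p \<in> J \<Longrightarrow> q \<in> J \<Longrightarrow> p + q \<in> J"
    and l: "\<And>t p. t \<in> carrier (tensor_algebra X) \<Longrightarrow> p \<in> J \<Longrightarrow> t * p \<in> J"
    and "\<And>t p. t \<in> carrier (tensor_algebra X) \<Longrightarrow> p \<in> J \<Longrightarrow> p * t \<in> J"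
  shows "ideal J (tensor_algebra X)"
proof (rule idealI[OF tensor_ring])
  interpret T: ring "tensor_algebra X" by (rule tensor_ring)
  have "- p \<in> J" if "p \<in> J" for p using l[OF tensor_const[of "-1"] that] by (simp add: const_uminus)
  then show "subgroup J (add_monoid (tensor_algebra X))"
    using assms by (intro T.add.subgroupI) (auto simp: subset_iff)
qed (use assms in auto)

lemma tensor_idealD:
  assumes "ideal J (tensor_algebra X)"
  shows "p \<in> J \<Longrightarrow> p \<in> carrier (tensor_algebra X)" "0 \<in> J" "p \<in> J \<Longrightarrow> q \<in> J \<Longrightarrow> p + q \<in> J"
    "t \<in> carrier (tensor_algebra X) \<Longrightarrow> p \<in> J \<Longrightarrow> t * p \<in> J"
    "t \<in> carrier (tensor_algebra X) \<Longrightarrow> p \<in> J \<Longrightarrow> p * t \<in> J"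
    "p \<in> J \<Longrightarrow> - p \<in> J" "p \<in> J \<Longrightarrow> q \<in> J \<Longrightarrow> p - q \<in> J"
    "(\<And>i. i \<in> S \<Longrightarrow> f i \<in> J) \<Longrightarrow> sum f S \<in> J"
proof -
  interpret ideal J "tensor_algebra X" by fact
  show c: "p \<in> J \<Longrightarrow> p \<in> carrier (tensor_algebra X)" for p by (rule a_Hcarr)
  show z: "0 \<in> J" using additive_subgroup.zero_closed[OF additive_subgroup_axioms] by simp
  show a: "p \<in> J \<Longrightarrow> q \<in> J \<Longrightarrow> p + q \<in> J" for p q using additive_subgroup.a_closed[OF additive_subgroup_axioms] by simp
  show l: "t \<in> carrier (tensor_algebra X) \<Longrightarrow> p \<in> J \<Longrightarrow> t * p \<in> J" for t p using I_l_closed by simp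
  show "t \<in> carrier (tensor_algebra X) \<Longrightarrow> p \<in> J \<Longrightarrow> p * t \<in> J" using I_r_closed by simp
  show u: "p \<in> J \<Longrightarrow> - p \<in> J" for p using l[OF tensor_const[of "-1"]] by (simp add: const_uminus)
  show "p \<in> J \<Longrightarrow> q \<in> J \<Longrightarrow> p - q \<in> J" using a u by (metis diff_conv_add_uminus)
  show "(\<And>i. i \<in> S \<Longrightarrow> f i \<in> J) \<Longrightarrow> sum f S \<in> J"
    by (induction S rule: infinite_finite_induct) (auto simp: z a)
qed

lemma tensor_coset_eq_iff:
  assumes "ideal J (tensor_algebra X)" "p \<in> carrier (tensor_algebra X)" "q \<in> carrier (tensor_algebra X)"
  shows "J +>\<^bsub>tensor_algebra X\<^esub> p = J +>\<^bsub>tensor_algebra X\<^esub> q \<longleftrightarrow> p - q \<in> J"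
proof -
  have "J +>\<^bsub>tensor_algebra X\<^esub> p = {j + p | j. j \<in> J}" for p by (auto simp: a_r_coset_def')
  moreover have "{j + p | j. j \<in> J} = {j + q | j. j \<in> J}" if "p - q \<in> J"
  proof (intro equalityI subsetI; clarify)
    fix j assume j: "j \<in> J"
    show "\<exists>j'. j + p = j' + q \<and> j' \<in> J"
      using tensor_idealD(3)[OF assms(1) j that] by (intro exI[of _ "j + (p - q)"]) simp
    show "\<exists>j'. j + q = j' + p \<and> j' \<in> J"
      using tensor_idealD(7)[OF assms(1) j that] by (intro exI[of _ "j - (p - q)"]) simp
  qed
  moreover have "p - q \<in> J" if "{j + p | j. j \<in> J} = {j + q | j. j \<in> J}"
  proof -
    have "p \<in> {j + p | j. j \<in> J}" using tensor_idealD(2)[OF assms(1)] by force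
    then have "p \<in> {j + q | j. j \<in> J}" unfolding that .
    then obtain j where "j \<in> J" "p = j + q" by blast
    then show ?thesis by simp
  qed
  ultimately show ?thesis by metis
qed

text \<open>
  The coset map is a ring homomorphism, so a linear combination of cosets is the coset of the linear
  combination.
\<close>

lemma tensor_quot_lincomb:
  assumes J: "ideal J (tensor_algebra X)" and "finite F" "\<And>b. b \<in> F \<Longrightarrow> h b \<in> carrier (tensor_algebra X)"
  shows "quot_lincomb X J F k (\<lambda>b. J +>\<^bsub>tensor_algebra X\<^esub> h b) = \<zero>\<^bsub>tensor_algebra X Quot J\<^esub> \<longleftrightarrow>
    (\<Sum>b\<in>F. const (k b) * h b) \<in> J"
proof -
  interpret ideal J "tensor_algebra X" by fact
  interpret Q: ring "tensor_algebra X Quot J" by (rule quotient_is_ring)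
  have hom: "(+>\<^bsub>tensor_algebra X\<^esub>) J \<in> ring_hom (tensor_algebra X) (tensor_algebra X Quot J)" by (rule rcos_ring_hom)
  note h = ring_hom_memE[OF hom, simplified]
  have "(\<Oplus>\<^bsub>tensor_algebra X Quot J\<^esub>b\<in>F. (J +>\<^bsub>tensor_algebra X\<^esub> const (k b)) \<otimes>\<^bsub>tensor_algebra X Quot J\<^esub>
      (J +>\<^bsub>tensor_algebra X\<^esub> h b)) = J +>\<^bsub>tensor_algebra X\<^esub> (\<Sum>b\<in>F. const (k b) * h b)"
    using assms(2,3)
  proof (induction F rule: finite_induct)
    case empty
    have "J +>\<^bsub>tensor_algebra X\<^esub> 0 = \<zero>\<^bsub>tensor_algebra X Quot J\<^esub>"
      using ring_hom_zero[OF hom tensor_ring Q.ring_axioms] by simp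
    then show ?case by simp
  next
    case (insert b F)
    have c: "\<And>b'. b' \<in> insert b F \<Longrightarrow> (J +>\<^bsub>tensor_algebra X\<^esub> const (k b')) \<otimes>\<^bsub>tensor_algebra X Quot J\<^esub>
      (J +>\<^bsub>tensor_algebra X\<^esub> h b') \<in> carrier (tensor_algebra X Quot J)"
      using insert.prems h(1) tensor_const by (intro Q.m_closed) auto
    show ?case
      using insert c h(2)[OF tensor_const, of "h b"] h(3)[of "const (k b) * h b" "\<Sum>b\<in>F. const (k b) * h b"]
      by (subst Q.finsum_insert) auto
  qed
  moreover have "\<zero>\<^bsub>tensor_algebra X Quot J\<^esub> = J +>\<^bsub>tensor_algebra X\<^esub> 0"
    using ring_hom_zero[OF hom tensor_ring Q.ring_axioms] by simp
  moreover have "(\<Sum>b\<in>F. const (k b) * h b) \<in> carrier (tensor_algebra X)"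
    using assms(3) by (intro tensor_sum tensor_mult) auto
  ultimately show ?thesis
    unfolding quot_lincomb_def Let_def using tensor_coset_eq_iff[OF J _ tensor_zero, of "\<Sum>b\<in>F. const (k b) * h b"]
    by simp
qed


section \<open>The defining ideal\<close>

abbreviation constant_coeff :: "('x, 'k::field) free_alg \<Rightarrow> 'k" where "constant_coeff p \<equiv> Poly_Mapping.lookup p 0"

lemma tensor_induct [consumes 1, case_names zero word add]:
  assumes "p \<in> carrier (tensor_algebra X)" "Pr 0"
    and "\<And>w c. set w \<subseteq> X \<Longrightarrow> Pr (Poly_Mapping.single (FWord w) c)"
    and "\<And>p q. Pr p \<Longrightarrow> Pr q \<Longrightarrow> Pr (p + q)"
  shows "Pr p"
  using assms(2)
proof (induction p rule: free_alg_induct)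
  case (word w c)
  then show ?case using assms(1) assms(3)[of "letters w" c] by (auto simp: tensor_carrier)
qed (use assms in auto)

text \<open>
  The decomposition \<open>T(V) = K \<oplus> T(V) \<otimes> V\<close>: every nonempty word ends in a letter.
\<close>

lemma right_expansion:
  assumes "finite X" "p \<in> carrier (tensor_algebra X)"
  shows "\<exists>f. f ` X \<subseteq> carrier (tensor_algebra X) \<and> p = const (constant_coeff p) + (\<Sum>x\<in>X. f x * letter x)"
  using assms(2)
proof (induction rule: tensor_induct)
  case zero
  show ?case by (intro exI[of _ "\<lambda>_. 0"]) auto
next
  case (word w c)
  show ?case
  proof (cases w rule: rev_cases)
    case Nil
    then show ?thesis by (intro exI[of _ "\<lambda>_. 0"]) (auto simp: const_def zero_fword_def)
  next
    case (snoc u x)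
    then have x: "x \<in> X" using word by simp
    let ?f = "\<lambda>y. if y = x then Poly_Mapping.single (FWord u) c else 0"
    have "(\<Sum>y\<in>X. ?f y * letter y) = Poly_Mapping.single (FWord u) c * letter x"
      using x assms(1) by (simp add: if_distrib[of "\<lambda>t. t * _"] cong: if_cong)
    also have "\<dots> = Poly_Mapping.single (FWord w) c"
      by (simp add: letter_def mult_single plus_fword_def snoc)
    finally have "Poly_Mapping.single (FWord w) c = const (constant_coeff (Poly_Mapping.single (FWord w) c)) + (\<Sum>y\<in>X. ?f y * letter y)"
      by (simp add: lookup_single zero_fword_def snoc)
    then show ?thesis using word snoc by (intro exI[of _ ?f]) (auto simp: tensor_carrier)
  qed
next
  case (add p q)
  then obtain f g where "f ` X \<subseteq> carrier (tensor_algebra X)" "g ` X \<subseteq> carrier (tensor_algebra X)"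
    "p = const (constant_coeff p) + (\<Sum>x\<in>X. f x * letter x)" "q = const (constant_coeff q) + (\<Sum>x\<in>X. g x * letter x)"
    by blast
  note fg = this
  have "p + q = const (constant_coeff (p + q)) + (\<Sum>x\<in>X. (f x + g x) * letter x)"
    by (subst fg(3), subst fg(4)) (simp add: lookup_add const_add distrib_right sum.distrib algebra_simps)
  then show ?case using fg(1,2) by (intro exI[of _ "\<lambda>x. f x + g x"]) (auto simp: image_subset_iff)
qed

text \<open>
  The decomposition \<open>T(V) = K \<oplus> V \<otimes> T(V)\<close>: every nonempty word starts with a letter.
\<close>

lemma left_expansion:
  assumes "finite X" "p \<in> carrier (tensor_algebra X)"
  shows "\<exists>f. f ` X \<subseteq> carrier (tensor_algebra X) \<and> p = const (constant_coeff p) + (\<Sum>x\<in>X. letter x * f x)"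
  using assms(2)
proof (induction rule: tensor_induct)
  case zero
  show ?case by (intro exI[of _ "\<lambda>_. 0"]) auto
next
  case (word w c)
  show ?case
  proof (cases w)
    case Nil
    then show ?thesis by (intro exI[of _ "\<lambda>_. 0"]) (auto simp: const_def zero_fword_def)
  next
    case (Cons x u)
    then have x: "x \<in> X" using word by simp
    let ?f = "\<lambda>y. if y = x then Poly_Mapping.single (FWord u) c else 0"
    have "(\<Sum>y\<in>X. letter y * ?f y) = letter x * Poly_Mapping.single (FWord u) c"
      using x assms(1) by (simp add: if_distrib[of "\<lambda>t. _ * t"] cong: if_cong)
    also have "\<dots> = Poly_Mapping.single (FWord w) c"
      by (simp add: letter_def mult_single plus_fword_def Cons)
    finally have "Poly_Mapping.single (FWord w) c = const (constant_coeff (Poly_Mapping.single (FWord w) c)) + (\<Sum>y\<in>X. letter y * ?f y)"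
      by (simp add: lookup_single zero_fword_def Cons)
    then show ?thesis using word Cons by (intro exI[of _ ?f]) (auto simp: tensor_carrier)
  qed
next
  case (add p q)
  then obtain f g where "f ` X \<subseteq> carrier (tensor_algebra X)" "g ` X \<subseteq> carrier (tensor_algebra X)"
    "p = const (constant_coeff p) + (\<Sum>x\<in>X. letter x * f x)" "q = const (constant_coeff q) + (\<Sum>x\<in>X. letter x * g x)"
    by blast
  note fg = this
  have "p + q = const (constant_coeff (p + q)) + (\<Sum>x\<in>X. letter x * (f x + g x))"
    by (subst fg(3), subst fg(4)) (simp add: lookup_add const_add distrib_left sum.distrib algebra_simps)
  then show ?case using fg(1,2) by (intro exI[of _ "\<lambda>x. f x + g x"]) (auto simp: image_subset_iff)
qed

lemma tensor_ge2_ideal: "ideal (tensor_ge2 X :: ('x, 'k::field) free_alg set) (tensor_algebra X)"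
proof (rule tensor_idealI)
  have len: "length (letters w) \<ge> 2" if "w \<in> Poly_Mapping.keys (p * q)"
    "(\<forall>w \<in> Poly_Mapping.keys p. length (letters w) \<ge> 2) \<or> (\<forall>w \<in> Poly_Mapping.keys q. length (letters w) \<ge> 2)"
    for w and p q :: "('x, 'k) free_alg"
    using keys_mult[of p q] that by fastforce
  show "t * p \<in> tensor_ge2 X" "p * t \<in> tensor_ge2 X" if "t \<in> carrier (tensor_algebra X)" "p \<in> tensor_ge2 X" for t p :: "('x, 'k) free_alg"
    using that len by (auto simp: tensor_ge2_def)
  show "p + q \<in> tensor_ge2 X" if "p \<in> tensor_ge2 X" "q \<in> tensor_ge2 X" for p q :: "('x, 'k) free_alg"
    using that keys_add[of p q] by (auto simp: tensor_ge2_def)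
qed (auto simp: tensor_ge2_def)

lemma tensor_ge2_constant_coeff: "p \<in> tensor_ge2 X \<Longrightarrow> constant_coeff p = 0"
  by (force simp: tensor_ge2_def in_keys_iff)

locale presentation =
  fixes X :: "'x set" and R :: "('x, 'k::field) free_alg set"
  assumes finite_X: "finite X" and minimal: "minimal_relations X R"
begin

abbreviation "T \<equiv> tensor_algebra X :: ('x, 'k) free_alg ring"
abbreviation "I \<equiv> relation_ideal X R"
abbreviation "I' \<equiv> decomposable_ideal X I"

lemma relations_ge2: "R \<subseteq> tensor_ge2 X"
  using minimal unfolding minimal_relations_def tensor_comp_def tensor_ge2_def by fastforce

lemma relations_carrier: "R \<subseteq> carrier T"
  using relations_ge2 by (auto simp: tensor_ge2_def)

lemma finite_relations: "finite R"
  using minimal by (simp add: minimal_relations_def)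

lemma I_ideal: "ideal I T"
  unfolding relation_ideal_def by (rule ring.genideal_ideal[OF tensor_ring relations_carrier])

lemma relations_I: "r \<in> R \<Longrightarrow> r \<in> I"
  unfolding relation_ideal_def using ring.genideal_self[OF tensor_ring relations_carrier] by blast

lemma I_minimal: "ideal J T \<Longrightarrow> R \<subseteq> J \<Longrightarrow> I \<subseteq> J"
  unfolding relation_ideal_def by (rule ring.genideal_minimal[OF tensor_ring])

lemma I_ge2: "I \<subseteq> tensor_ge2 X"
  by (rule I_minimal[OF tensor_ge2_ideal relations_ge2])

lemma I_constant_coeff: "p \<in> I \<Longrightarrow> constant_coeff p = 0"
  using I_ge2 tensor_ge2_constant_coeff by blast

lemmas I_rules = tensor_idealD[OF I_ideal]

text \<open>
  This is \<open>I \<otimes> V\<close>, one of the two summands of \<open>I'\<close>; it is also \<open>I T(V)\<^sub>+\<close>.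
\<close>

definition right_multiples :: "('x, 'k) free_alg set"
  where "right_multiples = {\<Sum>x\<in>X. f x * letter x | f. f ` X \<subseteq> I}"

lemma right_multiples_add: "p \<in> right_multiples \<Longrightarrow> q \<in> right_multiples \<Longrightarrow> p + q \<in> right_multiples"
proof -
  assume p: "p \<in> right_multiples" and q: "q \<in> right_multiples"
  obtain f where f: "f ` X \<subseteq> I" "p = (\<Sum>x\<in>X. f x * letter x)"
    using p unfolding right_multiples_def by blast
  obtain g where "g ` X \<subseteq> I" "q = (\<Sum>x\<in>X. g x * letter x)"
    using q unfolding right_multiples_def by blast
  with f show ?thesis unfolding right_multiples_def
    by (intro CollectI exI[of _ "\<lambda>x. f x + g x"]) (auto simp: distrib_right sum.distrib image_subset_iff I_rules)
qed

lemma right_multiples_zero: "0 \<in> right_multiples"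
  unfolding right_multiples_def by (intro CollectI exI[of _ "\<lambda>_. 0"]) (auto simp: I_rules)

lemma right_multiples_sum: "(\<And>i. i \<in> S \<Longrightarrow> f i \<in> right_multiples) \<Longrightarrow> sum f S \<in> right_multiples"
  by (induction S rule: infinite_finite_induct) (auto simp: right_multiples_zero right_multiples_add)

lemma right_multiples_left_mult: "t \<in> carrier T \<Longrightarrow> p \<in> right_multiples \<Longrightarrow> t * p \<in> right_multiples"
proof -
  assume t: "t \<in> carrier T" and "p \<in> right_multiples"
  then obtain f where "f ` X \<subseteq> I" "p = (\<Sum>x\<in>X. f x * letter x)" unfolding right_multiples_def by blast
  then show ?thesis using t unfolding right_multiples_def
    by (intro CollectI exI[of _ "\<lambda>x. t * f x"]) (auto simp: sum_distrib_left mult.assoc image_subset_iff I_rules)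
qed

lemma right_multiplesI: "i \<in> I \<Longrightarrow> t \<in> carrier T \<Longrightarrow> constant_coeff t = 0 \<Longrightarrow> i * t \<in> right_multiples"
proof -
  assume i: "i \<in> I" and t: "t \<in> carrier T" "constant_coeff t = 0"
  obtain f where f: "f ` X \<subseteq> carrier T" "t = (\<Sum>x\<in>X. f x * letter x)"
    using right_expansion[OF finite_X t(1)] t(2) by auto
  then show ?thesis using i unfolding right_multiples_def
    by (intro CollectI exI[of _ "\<lambda>x. i * f x"]) (auto simp: sum_distrib_left mult.assoc image_subset_iff I_rules)
qed

lemma right_multiples_right_mult: "p \<in> right_multiples \<Longrightarrow> t \<in> carrier T \<Longrightarrow> p * t \<in> right_multiples"
proof -
  assume t: "t \<in> carrier T" and "p \<in> right_multiples"
  then obtain f where f: "f ` X \<subseteq> I" "p = (\<Sum>x\<in>X. f x * letter x)" unfolding right_multiples_def by blast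
  have "(\<Sum>x\<in>X. f x * (letter x * t)) \<in> right_multiples"
    using f(1) t by (intro right_multiples_sum right_multiplesI) auto
  then show ?thesis by (simp add: f(2) sum_distrib_right mult.assoc)
qed

lemma right_multiples_I: "p \<in> right_multiples \<Longrightarrow> p \<in> I"
  unfolding right_multiples_def by (auto intro!: I_rules(5,8) simp: image_subset_iff)

lemma decomposable_right: "right_multiples \<subseteq> I'"
proof
  fix p assume "p \<in> right_multiples"
  then obtain f where "f ` X \<subseteq> I" "p = (\<Sum>x\<in>X. f x * letter x)" unfolding right_multiples_def by blast
  then show "p \<in> I'" unfolding decomposable_ideal_def
    by (intro CollectI exI[of _ f] exI[of _ "\<lambda>_. 0"]) (auto simp: I_rules)
qed

text \<open>
  \<open>T(V)\<^sub>+ I\<close> is contained in \<open>V \<otimes> I\<close>, by \<open>left_expansion\<close>.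
\<close>

lemma decomposable_left: "i \<in> I \<Longrightarrow> t \<in> carrier T \<Longrightarrow> constant_coeff t = 0 \<Longrightarrow> t * i \<in> I'"
proof -
  assume i: "i \<in> I" and t: "t \<in> carrier T" "constant_coeff t = 0"
  obtain f where f: "f ` X \<subseteq> carrier T" "t = (\<Sum>x\<in>X. letter x * f x)"
    using left_expansion[OF finite_X t(1)] t(2) by auto
  then show ?thesis using i unfolding decomposable_ideal_def
    by (intro CollectI exI[of _ "\<lambda>_. 0"] exI[of _ "\<lambda>x. f x * i"])
      (auto simp: sum_distrib_right mult.assoc image_subset_iff I_rules)
qed

lemma decomposable_cases:
  assumes "p \<in> I'"
  obtains q g where "q \<in> right_multiples" "g ` X \<subseteq> I" "p = q + (\<Sum>x\<in>X. letter x * g x)"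
  using assms unfolding decomposable_ideal_def right_multiples_def by blast

lemma decomposable_add: "p \<in> I' \<Longrightarrow> q \<in> I' \<Longrightarrow> p + q \<in> I'"
proof -
  assume p: "p \<in> I'" and q: "q \<in> I'"
  obtain f g where fg: "f ` X \<subseteq> I" "g ` X \<subseteq> I" "p = (\<Sum>x\<in>X. f x * letter x) + (\<Sum>x\<in>X. letter x * g x)"
    using p unfolding decomposable_ideal_def by blast
  obtain f' g' where "f' ` X \<subseteq> I" "g' ` X \<subseteq> I" "q = (\<Sum>x\<in>X. f' x * letter x) + (\<Sum>x\<in>X. letter x * g' x)"
    using q unfolding decomposable_ideal_def by blast
  with fg show ?thesis unfolding decomposable_ideal_def
    by (intro CollectI exI[of _ "\<lambda>x. f x + f' x"] exI[of _ "\<lambda>x. g x + g' x"])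
      (auto simp: distrib_right distrib_left sum.distrib image_subset_iff I_rules)
qed

lemma decomposable_zero: "0 \<in> I'"
  using decomposable_right right_multiples_zero by blast

lemma decomposable_sum: "(\<And>i. i \<in> S \<Longrightarrow> f i \<in> I') \<Longrightarrow> sum f S \<in> I'"
  by (induction S rule: infinite_finite_induct) (auto simp: decomposable_zero decomposable_add)

lemma decomposable_I: "p \<in> I' \<Longrightarrow> p \<in> I"
proof (elim decomposable_cases)
  fix q g assume "q \<in> right_multiples" and g: "g ` X \<subseteq> I" and p: "p = q + (\<Sum>x\<in>X. letter x * g x)"
  then have "q \<in> I" by (intro right_multiples_I)
  moreover have "(\<Sum>x\<in>X. letter x * g x) \<in> I" using g by (intro I_rules(8) I_rules(4)) auto
  ultimately show "p \<in> I" unfolding p by (rule I_rules(3))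
qed

lemma I'_ideal: "ideal I' T"
proof (rule tensor_idealI)
  show "I' \<subseteq> carrier T" using decomposable_I I_rules(1) by blast
  show "0 \<in> I'" by (rule decomposable_zero)
  show "p + q \<in> I'" if "p \<in> I'" "q \<in> I'" for p q using decomposable_add that .
  fix t p assume t: "t \<in> carrier T" and "p \<in> I'"
  then obtain q g where q: "q \<in> right_multiples" and g: "g ` X \<subseteq> I" and p: "p = q + (\<Sum>x\<in>X. letter x * g x)"
    using decomposable_cases by blast
  have "t * q \<in> I'" using right_multiples_left_mult[OF t q] decomposable_right by blast
  moreover have "(\<Sum>x\<in>X. t * letter x * g x) \<in> I'"
    using g t by (intro decomposable_sum decomposable_left) auto
  ultimately show "t * p \<in> I'" using decomposable_add by (simp add: p distrib_left sum_distrib_left mult.assoc)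
  have "q * t \<in> I'" using right_multiples_right_mult[OF q t] decomposable_right by blast
  moreover have "(\<Sum>x\<in>X. letter x * (g x * t)) \<in> I'"
    using g t by (intro decomposable_sum decomposable_left) (auto simp: I_rules)
  ultimately show "p * t \<in> I'" using decomposable_add by (simp add: p distrib_right sum_distrib_right mult.assoc)
qed

text \<open>
  As a left module, \<open>I\<close> is generated by the relations modulo \<open>I \<otimes> V\<close>: the set of all sums on the right
  is an ideal, since multiplication on the right by a constant can be moved to the left, and
  multiplication by an element of \<open>T(V)\<^sub>+\<close> leads into \<open>I \<otimes> V\<close>.
\<close>

lemma I_left_generated:
  assumes "p \<in> I"
  shows "\<exists>t j. t ` R \<subseteq> carrier T \<and> j \<in> right_multiples \<and> p = (\<Sum>r\<in>R. t r * r) + j"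
proof -
  define J where "J = {(\<Sum>r\<in>R. t r * r) + j | t j. t ` R \<subseteq> carrier T \<and> j \<in> right_multiples}"
  have "ideal J T"
  proof (rule tensor_idealI)
    show "J \<subseteq> carrier T" unfolding J_def
      using relations_carrier right_multiples_I I_rules(1) by (auto intro!: tensor_add tensor_sum tensor_mult)
    show "0 \<in> J" unfolding J_def using right_multiples_zero
      by (intro CollectI exI[of _ "\<lambda>_. 0"] exI[of _ 0]) auto
    fix p assume "p \<in> J"
    then obtain t j where p: "p = (\<Sum>r\<in>R. t r * r) + j" and t: "t ` R \<subseteq> carrier T" and j: "j \<in> right_multiples"
      unfolding J_def by blast
    show "p + q \<in> J" if q: "q \<in> J" for q
    proof -
      obtain t' j' where "q = (\<Sum>r\<in>R. t' r * r) + j'" "t' ` R \<subseteq> carrier T" "j' \<in> right_multiples"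
        using q unfolding J_def by blast
      then show ?thesis using p t j unfolding J_def
        by (intro CollectI exI[of _ "\<lambda>r. t r + t' r"] exI[of _ "j + j'"])
          (auto simp: distrib_right sum.distrib image_subset_iff right_multiples_add)
    qed
    fix s assume s: "s \<in> carrier T"
    show "s * p \<in> J" using p t j s unfolding J_def
      by (intro CollectI exI[of _ "\<lambda>r. s * t r"] exI[of _ "s * j"])
        (auto simp: distrib_left sum_distrib_left mult.assoc image_subset_iff right_multiples_left_mult)
    define c where "c = constant_coeff s"
    define s' where "s' = s - const c"
    have s': "s = const c + s'" "s' \<in> carrier T" "constant_coeff s' = 0"
      using s by (auto simp: s'_def c_def lookup_minus)
    have "(\<Sum>r\<in>R. t r * r * s') \<in> right_multiples"
      using t relations_I s' by (intro right_multiples_sum right_multiplesI) (auto intro: I_rules)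
    then have "(\<Sum>r\<in>R. t r * r * s') + j * s \<in> right_multiples"
      using right_multiples_right_mult[OF j s] right_multiples_add by blast
    moreover have "p * s = (\<Sum>r\<in>R. (const c * t r) * r) + ((\<Sum>r\<in>R. t r * r * s') + j * s)"
    proof -
      have e: "const c * t r * r = t r * r * const c" for r by (metis const_commute mult.assoc)
      have "(\<Sum>r\<in>R. t r * r) * s = (\<Sum>r\<in>R. (const c * t r) * r) + (\<Sum>r\<in>R. t r * r * s')"
        unfolding e by (subst s'(1)) (simp add: distrib_left sum_distrib_right)
      then show ?thesis by (simp add: p distrib_right add.assoc)
    qed
    ultimately show "p * s \<in> J" unfolding J_def using t
      by (intro CollectI exI[of _ "\<lambda>r. const c * t r"] exI[of _ "(\<Sum>r\<in>R. t r * r * s') + j * s"]) auto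
  qed
  moreover have "R \<subseteq> J"
  proof
    fix r assume r: "r \<in> R"
    have "(\<Sum>r'\<in>R. (if r' = r then 1 else 0) * r') = r"
      using r finite_relations by (simp add: if_distrib[of "\<lambda>t. t * _"] cong: if_cong)
    then show "r \<in> J" unfolding J_def using right_multiples_zero
      by (intro CollectI exI[of _ "\<lambda>r'. if r' = r then 1 else 0"] exI[of _ 0]) auto
  qed
  ultimately show ?thesis using I_minimal assms unfolding J_def by blast
qed


section \<open>The presented algebra\<close>

abbreviation "A \<equiv> presented_algebra X R"

definition proj :: "('x, 'k) free_alg \<Rightarrow> ('x, 'k) free_alg set"
  where "proj p = I +>\<^bsub>T\<^esub> p"

lemma A_carrier: "carrier A = proj ` carrier T"
  by (auto simp: presented_algebra_def ring.defs FactRing_def A_RCOSETS_def' proj_def a_r_coset_def')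

lemma A_ops:
  "\<lbrakk>p \<in> carrier T; q \<in> carrier T\<rbrakk> \<Longrightarrow> proj p \<oplus>\<^bsub>A\<^esub> proj q = proj (p + q)"
  "\<lbrakk>p \<in> carrier T; q \<in> carrier T\<rbrakk> \<Longrightarrow> proj p \<otimes>\<^bsub>A\<^esub> proj q = proj (p * q)"
  "\<one>\<^bsub>A\<^esub> = proj 1" "\<zero>\<^bsub>A\<^esub> = proj 0"
proof -
  interpret ideal I T by (rule I_ideal)
  note h = ring_hom_memE[OF rcos_ring_hom, simplified]
  have z: "I +>\<^bsub>T\<^esub> 0 = \<zero>\<^bsub>T Quot I\<^esub>"
    using ring_hom_zero[OF rcos_ring_hom tensor_ring quotient_is_ring] by simp
  show "\<lbrakk>p \<in> carrier T; q \<in> carrier T\<rbrakk> \<Longrightarrow> proj p \<oplus>\<^bsub>A\<^esub> proj q = proj (p + q)"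
    "\<lbrakk>p \<in> carrier T; q \<in> carrier T\<rbrakk> \<Longrightarrow> proj p \<otimes>\<^bsub>A\<^esub> proj q = proj (p * q)"
    "\<one>\<^bsub>A\<^esub> = proj 1" "\<zero>\<^bsub>A\<^esub> = proj 0"
    using h z by (simp_all add: presented_algebra_def ring.defs proj_def)
qed

lemma proj_eq_iff: "\<lbrakk>p \<in> carrier T; q \<in> carrier T\<rbrakk> \<Longrightarrow> proj p = proj q \<longleftrightarrow> p - q \<in> I"
  unfolding proj_def by (rule tensor_coset_eq_iff[OF I_ideal])

lemma A_acomp: "acomp A i = proj ` tensor_comp X i"
  by (simp add: presented_algebra_def ring.defs proj_def)

text \<open>
  The constant coefficient is the same on the whole coset, because \<open>I\<close> lives in degrees at least 2.
\<close>

lemma A_aug: "aug A (proj p) = constant_coeff p"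
proof -
  have "(\<lambda>p. constant_coeff p) ` (proj p) = {constant_coeff p}"
    using I_constant_coeff I_rules(2) by (fastforce simp: proj_def a_r_coset_def' lookup_add image_iff)
  then show ?thesis by (simp add: presented_algebra_def ring.defs)
qed

lemma A_ring: "ring A"
proof (rule ringI)
  show "abelian_group A"
  proof (rule abelian_groupI)
    fix x assume "x \<in> carrier A"
    then obtain p where "p \<in> carrier T" "x = proj p" by (auto simp: A_carrier)
    then show "\<exists>y\<in>carrier A. y \<oplus>\<^bsub>A\<^esub> x = \<zero>\<^bsub>A\<^esub>"
      by (intro bexI[of _ "proj (- p)"]) (auto simp: A_carrier A_ops)
  qed (auto simp: A_carrier A_ops algebra_simps)
  show "Group.monoid A" by (rule monoidI) (auto simp: A_carrier A_ops algebra_simps)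
qed (auto simp: A_carrier A_ops algebra_simps)

lemma A_graded_alg: "graded_alg A"
proof (rule graded_alg.intro)
  show "ring A" by (rule A_ring)
  show "a \<in> carrier A" if "a \<in> acomp A i" for a i using that by (auto simp: A_acomp A_carrier tensor_comp_def)
  show "Pr a" if a: "a \<in> carrier A" and h: "\<And>i a. a \<in> acomp A i \<Longrightarrow> Pr a"
    and s: "\<And>a b. \<lbrakk>a \<in> carrier A; b \<in> carrier A; Pr a; Pr b\<rbrakk> \<Longrightarrow> Pr (a \<oplus>\<^bsub>A\<^esub> b)" for Pr a
  proof -
    obtain p where p: "p \<in> carrier T" "a = proj p" using a by (auto simp: A_carrier)
    have "p \<in> carrier T \<and> Pr (proj p)" using p(1)
    proof (induction rule: tensor_induct)
      case zero
      have "0 \<in> tensor_comp X 0" by (simp add: tensor_comp_def)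
      then show ?case using h A_acomp by auto
    next
      case (word w c)
      then have "Poly_Mapping.single (FWord w) c \<in> tensor_comp X (length w)"
        by (simp add: tensor_comp_def tensor_carrier)
      then show ?case using h[of "proj (Poly_Mapping.single (FWord w) c)" "length w"] by (simp add: A_acomp tensor_comp_def)
    next
      case (add p q)
      then show ?case using s[of "proj p" "proj q"] by (simp add: A_carrier A_ops)
    qed
    then show ?thesis using p by simp
  qed
  show "aug A (a \<oplus>\<^bsub>A\<^esub> b) = aug A a + aug A b" "aug A (a \<otimes>\<^bsub>A\<^esub> b) = aug A a * aug A b"
    if "a \<in> carrier A" "b \<in> carrier A" for a b
    using that by (auto simp: A_carrier A_ops A_aug lookup_add)
  show "aug A \<one>\<^bsub>A\<^esub> = 1" by (simp add: A_ops A_aug)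
  show "aug A a = 0" if "a \<in> acomp A i" "i > 0" for a i
    using that by (force simp: A_acomp A_aug tensor_comp_def in_keys_iff)
  show "\<exists>a \<in> carrier A. aug A a = c" for c
    by (intro bexI[of _ "proj (const c)"]) (auto simp: A_aug A_carrier)
qed

end


section \<open>The minimal resolution in coordinates\<close>

interpretation free_alg_vs: vector_space "\<lambda>k (p :: ('x, 'k::field) free_alg). const k * p"
  by standard (simp_all add: const_add const_mult distrib_left distrib_right mult.assoc)

locale minimal_res = presentation X R
  for X :: "'x set" and R :: "('x, 'k::field) free_alg set" +
  fixes Q :: "(('x, 'k) free_alg set, 'q, 'k) resolution"
    and B :: "nat \<Rightarrow> 'q set"
    and M :: "nat \<Rightarrow> 'q \<Rightarrow> 'q \<Rightarrow> ('x, 'k) free_alg set"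
    and Mh :: "nat \<Rightarrow> 'q \<Rightarrow> 'q \<Rightarrow> ('x, 'k) free_alg"
  assumes minimal_Q: "minimal_graded_projective_resolution (presented_algebra X R) Q"
    and bases: "\<And>n. homogeneous_basis (presented_algebra X R) (res_mod Q n) (B n)"
    and matrices: "\<And>n. n \<ge> 1 \<Longrightarrow> represents (presented_algebra X R) (res_mod Q (n - 1)) (B n) (B (n - 1)) (res_diff Q n) (M n)"
    and lifts: "\<And>n. n \<ge> 1 \<Longrightarrow> homogeneous_lift X R (B n) (B (n - 1)) (M n) (Mh n)"
    and entries_V: "entries_basis_of_V X (B 1) (B 0) (Mh 1)"
    and entries_R: "\<And>e. e \<in> B 0 \<Longrightarrow> bij_betw (\<lambda>b. mat_mult (B 1) (Mh 2) (Mh 1) b e) (B 2) R"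
begin

sublocale Q: resol "presented_algebra X R" Q
proof (rule resol.intro[OF A_graded_alg])
  show "resol_axioms A Q"
    using minimal_Q by (auto simp: minimal_graded_projective_resolution_def intro: resol_axioms.intro)
qed

sublocale Qf: gfree "presented_algebra X R" "res_mod Q n" "B n" for n
  by (intro gfree.intro gfree_axioms.intro Q.is_gmod bases)

abbreviation cf :: "nat \<Rightarrow> 'q \<Rightarrow> 'q \<Rightarrow> ('x, 'k) free_alg set"
  where "cf n \<equiv> gfree.coord A (res_mod Q n) (B n)"

text \<open>
  Minimality: boundaries lie in \<open>A\<^sub>+ Q\<close>, and \<open>A\<^sub>+\<close> acts as zero on \<open>K\<close>.
\<close>

lemma minimal_cochain:
  assumes f: "f \<in> cochains A Q n" and x: "x \<in> carrier (res_mod Q (Suc n))"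
  shows "f (res_diff Q (Suc n) x) = 0"
proof -
  have "res_diff Q (Suc n) ` carrier (res_mod Q (Suc n)) \<subseteq> aug_submodule A (res_mod Q n)"
    using minimal_Q[unfolded minimal_graded_projective_resolution_def, THEN conjunct2, rule_format, of "Suc n"] by simp
  then have "res_diff Q (Suc n) x \<in> aug_submodule A (res_mod Q n)" using x by (rule subsetD[OF _ imageI])
  then obtain S a where S: "finite S" "S \<subseteq> carrier (res_mod Q n)" "a \<in> S \<rightarrow> aug_ideal A"
    and e: "res_diff Q (Suc n) x = (\<Oplus>\<^bsub>res_mod Q n\<^esub>s\<in>S. a s \<odot>\<^bsub>res_mod Q n\<^esub> s)"
    unfolding aug_submodule_def by (elim CollectE exE conjE) simp
  have a: "a s \<in> carrier A" "aug A (a s) = 0" if "s \<in> S" for s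
    using S(3) that by (auto simp: aug_ideal_def Pi_iff)
  have s: "s \<in> carrier (res_mod Q n)" if "s \<in> S" for s using S(2) that by blast
  have "f (res_diff Q (Suc n) x) = finsum (trivial_module A) (\<lambda>s. f (a s \<odot>\<^bsub>res_mod Q n\<^esub> s)) S"
    unfolding e using a s Qf.smult_closed
    by (intro lin_map_finsum[OF Q.is_abelian trivial_module_abelian Q.cochain_lin[OF f] S(1)]) auto
  also have "\<dots> = (\<Sum>s\<in>S. f (a s \<odot>\<^bsub>res_mod Q n\<^esub> s))" using S(1) by simp
  also have "\<dots> = 0" using a s lin_map_smult[OF Q.cochain_lin[OF f]] by (intro sum.neutral) auto
  finally show ?thesis .
qed

lemma cochain_cocycle: "f \<in> cochains A Q n \<Longrightarrow> f \<in> cocycles A Q n"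
  using minimal_cochain by (intro Q.cocycleI)

lemma coboundary_zero: "f \<in> coboundaries A Q n \<Longrightarrow> f = (\<lambda>x. 0)"
proof (cases n)
  case (Suc m)
  assume "f \<in> coboundaries A Q n"
  then obtain g where g: "g \<in> cochains A Q m" "f = g \<circ> res_diff Q (Suc m)"
    unfolding Suc Q.coboundaries_Suc by blast
  have "g (res_diff Q (Suc m) x) = 0" for x
    using minimal_cochain[OF g(1)] lin_map_outside[OF Q.diff_lin, of x m] Q.cochain_zero_val[OF g(1)]
    by (cases "x \<in> carrier (res_mod Q (Suc m))") auto
  then show ?thesis by (auto simp: g(2))
qed (simp add: Q.coboundaries_0)

lemma cochain_eqI:
  assumes f: "f \<in> cochains A Q n" and g: "g \<in> cochains A Q n" and "\<And>b. b \<in> B n \<Longrightarrow> f b = g b"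
  shows "f = g"
proof
  fix x
  note fl = Q.cochain_lin[OF f] and gl = Q.cochain_lin[OF g]
  show "f x = g x"
  proof (cases "x \<in> carrier (res_mod Q n)")
    case True
    then show ?thesis
    proof (induction rule: Qf.basis_induct)
      case (multiple a b)
      then show ?case using assms(3) Qf.basis_carrier[OF multiple(1)]
        by (simp add: lin_map_smult[OF fl] lin_map_smult[OF gl])
    next
      case zero
      show ?case using Q.cochain_zero_val[OF f] Q.cochain_zero_val[OF g] by simp
    next
      case (add x y)
      then show ?case by (simp add: lin_map_add[OF fl] lin_map_add[OF gl])
    qed
  next
    case False
    then show ?thesis using lin_map_outside[OF fl] lin_map_outside[OF gl] by simp
  qed
qed

text \<open>
  The element of the dual basis that belongs to \<open>b\<close>.
\<close>

definition dual :: "nat \<Rightarrow> 'q \<Rightarrow> 'q \<Rightarrow> 'k"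
  where "dual n b x = (if x \<in> carrier (res_mod Q n) then aug A (cf n x b) else 0)"

lemma dual_basis: "b \<in> B n \<Longrightarrow> c \<in> B n \<Longrightarrow> dual n b c = (if c = b then 1 else 0)"
  by (simp add: dual_def Qf.basis_carrier Qf.coord_basis Q.aug_one)

text \<open>
  The functional is homogeneous of degree \<open>- deg b\<close>, being the linear extension of the function on
  \<open>B n\<close> that is 1 at \<open>b\<close> and 0 elsewhere.
\<close>

lemma dual_cochain:
  assumes b: "b \<in> B n"
  shows "dual n b \<in> cochains A Q n"
proof -
  obtain db where db: "b \<in> mcomp (res_mod Q n) db" using Qf.basis_homogeneous[OF b] by blast
  have "\<exists>d. c \<in> mcomp (res_mod Q n) d \<and> (if c = b then 1 else 0) \<in> mcomp (trivial_module A) (d + (- db))" if "c \<in> B n" for c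
    using Qf.basis_homogeneous[OF that] db by (cases "c = b") auto
  from Q.extend_from_basis[OF Qf.gfree_axioms Q.trivial_gmod this]
  obtain H where H: "H \<in> hom_deg A (res_mod Q n) (trivial_module A) (- db)"
    "\<And>c. c \<in> B n \<Longrightarrow> H c = (if c = b then 1 else 0)" by metis
  note Hl = hom_deg_lin[OF H(1)]
  have "H x = dual n b x" for x
  proof (cases "x \<in> carrier (res_mod Q n)")
    case True
    then have "H x = aug A (cf n x b)"
    proof (induction rule: Qf.basis_induct)
      case (multiple a c)
      then show ?case
        by (simp add: lin_map_smult[OF Hl] Qf.basis_carrier H(2) Qf.coord_smult_basis)
    next
      case zero
      show ?case using lin_map_zero[OF Q.is_abelian trivial_module_abelian Hl] by simp
    next
      case (add x y)
      then show ?case by (simp add: lin_map_add[OF Hl] Qf.coord_add Q.aug_add Qf.coord_carrier)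
    qed
    then show ?thesis using True by (simp add: dual_def)
  next
    case False
    then show ?thesis using lin_map_outside[OF Hl] by (simp add: dual_def)
  qed
  then have "H = dual n b" by blast
  then show ?thesis using hom_deg_graded_hom[OF Q.trivial_gmod H(1)] by (simp add: cochains_def)
qed

lemma cochain_expansion:
  assumes f: "f \<in> cochains A Q n" and fin: "finite (B n)" and x: "x \<in> carrier (res_mod Q n)"
  shows "f x = (\<Sum>b\<in>B n. aug A (cf n x b) * f b)"
proof -
  have "x = (\<Oplus>\<^bsub>res_mod Q n\<^esub>b\<in>B n. cf n x b \<odot>\<^bsub>res_mod Q n\<^esub> b)"
    using Qf.coord_expansion[OF x fin] Qf.coord_support[OF x] by blast
  then have "f x = f (\<Oplus>\<^bsub>res_mod Q n\<^esub>b\<in>B n. cf n x b \<odot>\<^bsub>res_mod Q n\<^esub> b)" by simp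
  also have "\<dots> = finsum (trivial_module A) (\<lambda>b. f (cf n x b \<odot>\<^bsub>res_mod Q n\<^esub> b)) (B n)"
    using Qf.coord_carrier[OF x] Qf.basis_carrier Qf.smult_closed
    by (intro lin_map_finsum[OF Q.is_abelian trivial_module_abelian Q.cochain_lin[OF f] fin]) auto
  also have "\<dots> = (\<Sum>b\<in>B n. aug A (cf n x b) * f b)"
    using fin lin_map_smult[OF Q.cochain_lin[OF f]] Qf.coord_carrier[OF x] Qf.basis_carrier by simp
  finally show ?thesis .
qed

text \<open>
  Otherwise \<open>e\<close> is a boundary, which \<open>minimal_cochain\<close> excludes.
\<close>

lemma generator_aug: "e \<in> B 0 \<Longrightarrow> res_aug Q e \<noteq> 0"
proof
  assume e: "e \<in> B 0" and "res_aug Q e = 0"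
  then have "e \<in> res_diff Q (Suc 0) ` carrier (res_mod Q (Suc 0))"
    unfolding Q.exact_0[symmetric] using Qf.basis_carrier by blast
  then have "dual 0 e e = 0" using minimal_cochain[OF dual_cochain[OF e]] by auto
  then show False using dual_basis[OF e e] by simp
qed

text \<open>
  For two basis elements, suitable multiples of them have the same image in \<open>K\<close>; their difference is
  then a boundary with a coordinate outside \<open>A\<^sub>+\<close>.
\<close>

lemma ex_generator: "\<exists>e. B 0 = {e}"
proof -
  have "e = e'" if e: "e \<in> B 0" and e': "e' \<in> B 0" for e e'
  proof (rule ccontr)
    assume ne: "e \<noteq> e'"
    obtain a a' where a: "a \<in> carrier A" "aug A a = res_aug Q e'" and a': "a' \<in> carrier A" "aug A a' = res_aug Q e"
      using Q.aug_surj by metis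
    note ec = Qf.basis_carrier[OF e] Qf.basis_carrier[OF e']
    have c: "a \<odot>\<^bsub>res_mod Q 0\<^esub> e \<in> carrier (res_mod Q 0)" "a' \<odot>\<^bsub>res_mod Q 0\<^esub> e' \<in> carrier (res_mod Q 0)"
      using a a' ec Qf.smult_closed by auto
    let ?x = "a \<odot>\<^bsub>res_mod Q 0\<^esub> e \<ominus>\<^bsub>res_mod Q 0\<^esub> a' \<odot>\<^bsub>res_mod Q 0\<^esub> e'"
    have "res_aug Q ?x = 0"
      using lin_map_minus[OF Q.is_abelian trivial_module_abelian Q.aug_lin c] a a' ec by (simp add: lin_map_smult[OF Q.aug_lin])
    then have "?x \<in> res_diff Q (Suc 0) ` carrier (res_mod Q (Suc 0))"
      unfolding Q.exact_0[symmetric] using Qf.M.minus_closed[OF c] by blast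
    then have "dual 0 e ?x = 0" using minimal_cochain[OF dual_cochain[OF e]] by auto
    moreover have "dual 0 e ?x = res_aug Q e'"
      using Q.cochain_minus[OF dual_cochain[OF e] c] a a' ec ne dual_basis[OF e e] dual_basis[OF e e']
      by (simp add: lin_map_smult[OF Q.cochain_lin[OF dual_cochain[OF e]]])
    ultimately show False using generator_aug[OF e'] by simp
  qed
  moreover have "B 0 \<noteq> {}"
  proof
    assume "B 0 = {}"
    obtain x where x: "x \<in> carrier (res_mod Q 0)" "res_aug Q x = 1" using Q.res_aug_surj by (metis UNIV_I imageE)
    have "{b. cf 0 x b \<noteq> \<zero>\<^bsub>A\<^esub>} \<subseteq> {}" using Qf.coord_support[OF x(1)] unfolding \<open>B 0 = {}\<close> by (rule conjunct2)
    from Qf.coord_expansion[OF x(1) finite.emptyI this empty_subsetI]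
    have "x = \<zero>\<^bsub>res_mod Q 0\<^esub>" by (simp only: Qf.M.finsum_empty)
    then show False using lin_map_zero[OF Q.is_abelian trivial_module_abelian Q.aug_lin] x(2) by simp
  qed
  ultimately show ?thesis by blast
qed

definition gen :: 'q where "gen = (THE e. B 0 = {e})"

lemma B0: "B 0 = {gen}"
proof -
  obtain e where e: "B 0 = {e}" using ex_generator by blast
  have "gen = e" unfolding gen_def e by (rule the_equality) auto
  then show ?thesis using e by simp
qed

text \<open>
  The generator of \<open>Q\<^sup>0\<close> may map to any nonzero scalar; this scalar enters the formulas for products.
\<close>

definition lam :: 'k where "lam = res_aug Q gen"

lemma lam_nonzero: "lam \<noteq> 0"
  unfolding lam_def using generator_aug B0 by blast

lemma aug_coord_0: "x \<in> carrier (res_mod Q 0) \<Longrightarrow> aug A (cf 0 x gen) = res_aug Q x / lam"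
  using cochain_expansion[OF Q.cocycleD(1)[OF Q.aug_cocycle], of x] lam_nonzero by (simp add: B0 lam_def)

definition rep :: "('x, 'k) free_alg set \<Rightarrow> ('x, 'k) free_alg"
  where "rep a = (SOME p. p \<in> carrier T \<and> proj p = a)"

lemma rep: "a \<in> carrier A \<Longrightarrow> rep a \<in> carrier T" "a \<in> carrier A \<Longrightarrow> proj (rep a) = a"
  "a \<in> carrier A \<Longrightarrow> constant_coeff (rep a) = aug A a"
proof -
  assume "a \<in> carrier A"
  then have "\<exists>p. p \<in> carrier T \<and> proj p = a" by (auto simp: A_carrier)
  then have "rep a \<in> carrier T \<and> proj (rep a) = a" unfolding rep_def by (rule someI_ex)
  then show "rep a \<in> carrier T" "proj (rep a) = a" "constant_coeff (rep a) = aug A a" using A_aug[of "rep a"] by auto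
qed

text \<open>
  Coordinates of a linear map by matrix multiplication, where representatives in \<open>T(V)\<close> of the
  coordinates of \<open>x\<close> and of the matrix entries may be chosen freely.
\<close>

lemma lin_map_coord:
  assumes \<psi>: "lin_map A (res_mod Q n) (res_mod Q m) \<psi>" and fin: "finite (B n)" and x: "x \<in> carrier (res_mod Q n)"
    and u: "\<And>c. c \<in> B n \<Longrightarrow> u c \<in> carrier T" "\<And>c. c \<in> B n \<Longrightarrow> proj (u c) = cf n x c"
    and v: "\<And>c. c \<in> B n \<Longrightarrow> v c \<in> carrier T" "\<And>c. c \<in> B n \<Longrightarrow> proj (v c) = cf m (\<psi> c) y"
  shows "cf m (\<psi> x) y = proj (\<Sum>c\<in>B n. u c * v c)"
proof -
  have "x = (\<Oplus>\<^bsub>res_mod Q n\<^esub>b\<in>B n. cf n x b \<odot>\<^bsub>res_mod Q n\<^esub> b)"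
    using Qf.coord_expansion[OF x fin] Qf.coord_support[OF x] by blast
  then have "\<psi> x = \<psi> (\<Oplus>\<^bsub>res_mod Q n\<^esub>b\<in>B n. cf n x b \<odot>\<^bsub>res_mod Q n\<^esub> b)" by simp
  also have "\<dots> = (\<Oplus>\<^bsub>res_mod Q m\<^esub>b\<in>B n. \<psi> (cf n x b \<odot>\<^bsub>res_mod Q n\<^esub> b))"
    using Qf.coord_carrier[OF x] Qf.basis_carrier Qf.smult_closed
    by (intro lin_map_finsum[OF Q.is_abelian Q.is_abelian \<psi> fin]) auto
  finally have e: "\<psi> x = (\<Oplus>\<^bsub>res_mod Q m\<^esub>b\<in>B n. \<psi> (cf n x b \<odot>\<^bsub>res_mod Q n\<^esub> b))" .
  have "cf m (\<Oplus>\<^bsub>res_mod Q m\<^esub>b\<in>D. \<psi> (cf n x b \<odot>\<^bsub>res_mod Q n\<^esub> b)) y = proj (\<Sum>c\<in>D. u c * v c)"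
    if "finite D" "D \<subseteq> B n" for D
    using that
  proof (induction D rule: finite_induct)
    case empty
    then show ?case by (simp add: A_ops)
  next
    case (insert b D)
    have c: "\<psi> (cf n x b \<odot>\<^bsub>res_mod Q n\<^esub> b) \<in> carrier (res_mod Q m)" for b
      using lin_map_closed[OF Q.is_gmod \<psi>] .
    have b: "b \<in> B n" "b \<in> carrier (res_mod Q n)" using insert.prems Qf.basis_carrier by auto
    have "(\<Oplus>\<^bsub>res_mod Q m\<^esub>b\<in>insert b D. \<psi> (cf n x b \<odot>\<^bsub>res_mod Q n\<^esub> b)) =
        \<psi> (cf n x b \<odot>\<^bsub>res_mod Q n\<^esub> b) \<oplus>\<^bsub>res_mod Q m\<^esub> (\<Oplus>\<^bsub>res_mod Q m\<^esub>b\<in>D. \<psi> (cf n x b \<odot>\<^bsub>res_mod Q n\<^esub> b))"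
      using insert c by (intro Qf.M.finsum_insert) auto
    moreover have "(\<Oplus>\<^bsub>res_mod Q m\<^esub>b\<in>D. \<psi> (cf n x b \<odot>\<^bsub>res_mod Q n\<^esub> b)) \<in> carrier (res_mod Q m)"
      using c by (intro Qf.M.finsum_closed) auto
    moreover have "cf m (\<psi> (cf n x b \<odot>\<^bsub>res_mod Q n\<^esub> b)) y = proj (u b * v b)"
      using u[OF b(1)] v[OF b(1)] b Qf.coord_carrier[OF x] lin_map_carrier[OF \<psi> b(2)]
      by (simp add: lin_map_smult[OF \<psi>] Qf.coord_smult A_ops(2)[symmetric])
    moreover have "(\<Sum>c\<in>D. u c * v c) \<in> carrier T" "u b * v b \<in> carrier T"
      using insert.prems u v by (auto intro!: tensor_sum)
    ultimately show ?case using insert c by (simp add: Qf.coord_add A_ops)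
  qed
  then show ?thesis using e fin by simp
qed

lemma Mh_carrier: "b \<in> B (Suc n) \<Longrightarrow> c \<in> B n \<Longrightarrow> Mh (Suc n) b c \<in> carrier T"
  and Mh_coord: "b \<in> B (Suc n) \<Longrightarrow> c \<in> B n \<Longrightarrow> proj (Mh (Suc n) b c) = cf n (res_diff Q (Suc n) b) c"
proof -
  have l: "homogeneous_lift X R (B (Suc n)) (B n) (M (Suc n)) (Mh (Suc n))" using lifts[of "Suc n"] by simp
  have r: "represents A (res_mod Q n) (B (Suc n)) (B n) (res_diff Q (Suc n)) (M (Suc n))" using matrices[of "Suc n"] by simp
  show "Mh (Suc n) b c \<in> carrier T" if "b \<in> B (Suc n)" "c \<in> B n"
    using l that by (auto simp: homogeneous_lift_def tensor_comp_def)
  assume b: "b \<in> B (Suc n)"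
  assume c: "c \<in> B n"
  let ?D = "{c \<in> B n. M (Suc n) b c \<noteq> \<zero>\<^bsub>A\<^esub>}"
  have D: "finite ?D" "\<And>c. c \<in> B n \<Longrightarrow> M (Suc n) b c \<in> carrier A"
    and e: "res_diff Q (Suc n) b = (\<Oplus>\<^bsub>res_mod Q n\<^esub>c\<in>?D. M (Suc n) b c \<odot>\<^bsub>res_mod Q n\<^esub> c)"
    using r b unfolding represents_def by blast+
  have "cf n (res_diff Q (Suc n) b) c = M (Suc n) b c"
    unfolding e using Qf.coord_eqI[of ?D n "M (Suc n) b" c] D c by auto
  moreover have "proj (Mh (Suc n) b c) = M (Suc n) b c"
    using l b c by (simp add: homogeneous_lift_def proj_def)
  ultimately show "proj (Mh (Suc n) b c) = cf n (res_diff Q (Suc n) b) c" by simp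
qed

text \<open>
  The entries of the matrices of a minimal resolution lie in \<open>A\<^sub>+\<close>.
\<close>

lemma Mh_constant_coeff:
  assumes b: "b \<in> B (Suc n)" and c: "c \<in> B n"
  shows "constant_coeff (Mh (Suc n) b c) = 0"
proof -
  have "constant_coeff (Mh (Suc n) b c) = dual n c (res_diff Q (Suc n) b)"
    using A_aug[of "Mh (Suc n) b c"] Mh_coord[OF b c] Q.diff_closed by (simp add: dual_def)
  then show ?thesis using minimal_cochain[OF dual_cochain[OF c] Qf.basis_carrier[OF b]] by simp
qed

abbreviation "ent y \<equiv> Mh (Suc 0) y gen"

abbreviation "rel z \<equiv> mat_mult (B (Suc 0)) (Mh (Suc (Suc 0))) (Mh (Suc 0)) z gen"

lemma ent_carrier: "y \<in> B (Suc 0) \<Longrightarrow> ent y \<in> carrier T"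
  using Mh_carrier[of y 0 gen] B0 by simp

lemma ent_constant_coeff: "y \<in> B (Suc 0) \<Longrightarrow> constant_coeff (ent y) = 0"
  using Mh_constant_coeff[of y 0 gen] B0 by simp

lemma ent_inj: "inj_on ent (B (Suc 0))"
  and ent_independent: "free_alg_vs.independent (ent ` B (Suc 0))"
  and ent_span: "free_alg_vs.span (ent ` B (Suc 0)) = tensor_comp X 1"
proof -
  have i: "(\<lambda>(b, c). Mh 1 b c) ` (B 1 \<times> B 0) = ent ` B (Suc 0)" by (auto simp: B0 image_iff)
  have "inj_on (\<lambda>(b, c). Mh 1 b c) (B 1 \<times> B 0)" using entries_V by (simp add: entries_basis_of_V_def)
  then show "inj_on ent (B (Suc 0))" by (auto simp: inj_on_def B0)
  show "free_alg_vs.independent (ent ` B (Suc 0))" "free_alg_vs.span (ent ` B (Suc 0)) = tensor_comp X 1"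
    using entries_V i by (simp_all add: entries_basis_of_V_def)
qed

lemma ent_V: "y \<in> B (Suc 0) \<Longrightarrow> ent y \<in> tensor_comp X 1"
  unfolding ent_span[symmetric] by (intro free_alg_vs.span_base imageI)

lemma degree_one_expansion:
  assumes "v \<in> tensor_comp X 1"
  shows "v = (\<Sum>x\<in>X. const (Poly_Mapping.lookup v (FWord [x])) * letter x)"
proof (rule poly_mapping_eqI)
  fix w
  have rhs: "Poly_Mapping.lookup (\<Sum>x\<in>X. const (Poly_Mapping.lookup v (FWord [x])) * letter x) w =
      (\<Sum>x\<in>X. Poly_Mapping.lookup v (FWord [x]) * (if w = FWord [x] then 1 else 0))"
    by (simp add: lookup_sum letter_def lookup_single when_def eq_commute)
  show "Poly_Mapping.lookup v w = Poly_Mapping.lookup (\<Sum>x\<in>X. const (Poly_Mapping.lookup v (FWord [x])) * letter x) w"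
  proof (cases "w \<in> Poly_Mapping.keys v")
    case True
    then have "length (letters w) = 1" "set (letters w) \<subseteq> X" using assms by (auto simp: tensor_comp_def tensor_carrier)
    then obtain x where "w = FWord [x]" "x \<in> X" by (cases w) (auto simp: length_Suc_conv)
    then show ?thesis unfolding rhs using finite_X by (simp add: if_distrib cong: if_cong)
  next
    case False
    then have "Poly_Mapping.lookup v w = 0" by (simp add: in_keys_iff)
    then have "(\<Sum>x\<in>X. Poly_Mapping.lookup v (FWord [x]) * (if w = FWord [x] then 1 else 0)) = 0"
      by (intro sum.neutral) auto
    then show ?thesis unfolding rhs using \<open>Poly_Mapping.lookup v w = 0\<close> by simp
  qed
qed

lemma finite_B1: "finite (B (Suc 0))"
proof -
  have "ent ` B (Suc 0) \<subseteq> free_alg_vs.span (letter ` X)"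
  proof
    fix v assume "v \<in> ent ` B (Suc 0)"
    then have "v \<in> tensor_comp X 1" using ent_V by blast
    then show "v \<in> free_alg_vs.span (letter ` X)"
      by (subst degree_one_expansion[OF \<open>v \<in> tensor_comp X 1\<close>])
        (intro free_alg_vs.span_sum free_alg_vs.span_scale free_alg_vs.span_base imageI)
  qed
  then have "finite (ent ` B (Suc 0))"
    using free_alg_vs.independent_span_bound[OF finite_imageI[OF finite_X] ent_independent] by blast
  then show ?thesis using ent_inj finite_imageD by blast
qed

lemma ent_independent_family:
  assumes "(\<Sum>y\<in>B (Suc 0). const (k y) * ent y) = 0" "y \<in> B (Suc 0)"
  shows "k y = 0"
proof -
  \<comment> \<open>the scalars indexed by the entries themselves, as independence of a set of vectors is formulated\<close>
  define k' where "k' = (\<lambda>v. k (inv_into (B (Suc 0)) ent v))"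
  have k': "k' (ent y) = k y" if "y \<in> B (Suc 0)" for y using inv_into_f_f[OF ent_inj that] by (simp add: k'_def)
  have "(\<Sum>v\<in>ent ` B (Suc 0). const (k' v) * v) = (\<Sum>y\<in>B (Suc 0). const (k y) * ent y)"
    using ent_inj by (subst sum.reindex) (auto simp: k')
  then have "k' (ent y) = 0"
    using free_alg_vs.independentD[OF ent_independent, of "ent ` B (Suc 0)" k' "ent y"] assms finite_B1 by auto
  then show ?thesis using k' assms(2) by simp
qed

text \<open>
  A linear combination of the entries has degree 1, so it lies in \<open>T(V)\<^sub>\<ge>\<^sub>2\<close> only if it is zero.
\<close>

lemma ent_independent_ge2:
  assumes "(\<Sum>y\<in>B (Suc 0). const (k y) * ent y) \<in> tensor_ge2 X" "y \<in> B (Suc 0)"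
  shows "k y = 0"
proof -
  have "(\<Sum>y\<in>B (Suc 0). const (k y) * ent y) \<in> free_alg_vs.span (ent ` B (Suc 0))"
    by (intro free_alg_vs.span_sum free_alg_vs.span_scale free_alg_vs.span_base imageI)
  then have "(\<Sum>y\<in>B (Suc 0). const (k y) * ent y) \<in> tensor_comp X 1" using ent_span by simp
  then have "Poly_Mapping.keys (\<Sum>y\<in>B (Suc 0). const (k y) * ent y) = {}"
    using assms(1) by (force simp: tensor_comp_def tensor_ge2_def)
  then show ?thesis using ent_independent_family[OF _ assms(2)] by simp
qed

lemma lookup_mult_degree_one:
  assumes "v \<in> tensor_comp X 1"
  shows "Poly_Mapping.lookup ((p :: ('x, 'k) free_alg) * v) (FWord (u @ [x])) = Poly_Mapping.lookup p (FWord u) * Poly_Mapping.lookup v (FWord [x])"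
proof -
  have e: "p * (const c * q) = const c * p * q" for c and q :: "('x, 'k) free_alg"
    by (simp only: mult.assoc[symmetric] const_commute[of c p])
  have "Poly_Mapping.lookup (p * v) (FWord (u @ [x])) =
      (\<Sum>x'\<in>X. Poly_Mapping.lookup (const (Poly_Mapping.lookup v (FWord [x'])) * p * letter x') (FWord (u @ [x])))"
    by (subst (1) degree_one_expansion[OF assms])
      (simp only: sum_distrib_left lookup_sum e)
  also have "\<dots> = (\<Sum>x'\<in>X. if x' = x then Poly_Mapping.lookup v (FWord [x']) * Poly_Mapping.lookup p (FWord u) else 0)"
    by (simp add: lookup_mult_letter cong: if_cong)
  also have "\<dots> = Poly_Mapping.lookup p (FWord u) * Poly_Mapping.lookup v (FWord [x])"
  proof (cases "x \<in> X")
    case False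
    then have "FWord [x] \<notin> Poly_Mapping.keys v" using assms by (force simp: tensor_comp_def tensor_carrier)
    then show ?thesis using False finite_X by (simp add: in_keys_iff)
  qed (use finite_X in \<open>simp add: mult.commute\<close>)
  finally show ?thesis .
qed

text \<open>
  \<open>T(V) \<otimes> V\<close> is a free left module on any basis of \<open>V\<close>: the coefficients at the words \<open>u x\<close>, for a
  fixed word \<open>u\<close>, form a linear relation between the entries.
\<close>

lemma ent_right_free:
  assumes "(\<Sum>y\<in>B (Suc 0). w y * ent y) = 0" "y \<in> B (Suc 0)"
  shows "w y = 0"
proof (rule poly_mapping_eqI)
  fix u
  let ?k = "\<lambda>y. Poly_Mapping.lookup (w y) u"
  have "(\<Sum>y\<in>B (Suc 0). const (?k y) * ent y) \<in> free_alg_vs.span (ent ` B (Suc 0))"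
    by (intro free_alg_vs.span_sum free_alg_vs.span_scale free_alg_vs.span_base imageI)
  then have V: "(\<Sum>y\<in>B (Suc 0). const (?k y) * ent y) \<in> tensor_comp X 1" using ent_span by simp
  have "Poly_Mapping.lookup (\<Sum>y\<in>B (Suc 0). const (?k y) * ent y) (FWord [x]) = 0" for x
  proof -
    have "Poly_Mapping.lookup (\<Sum>y\<in>B (Suc 0). const (?k y) * ent y) (FWord [x]) =
        Poly_Mapping.lookup (\<Sum>y\<in>B (Suc 0). w y * ent y) (FWord (letters u @ [x]))"
      by (simp add: lookup_sum lookup_mult_degree_one[OF ent_V])
    then show ?thesis by (simp add: assms(1))
  qed
  then have "(\<Sum>y\<in>B (Suc 0). const (?k y) * ent y) = 0" using degree_one_expansion[OF V] by simp
  then show "Poly_Mapping.lookup (w y) u = Poly_Mapping.lookup 0 u"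
    using ent_independent_family[OF _ assms(2)] by simp
qed

text \<open>
  Rewriting an element of \<open>I \<otimes> V\<close> in the basis of entries keeps its coefficients in \<open>I\<close>, and
  coefficients are unique by \<open>ent_right_free\<close>.
\<close>

lemma ent_right_multiples:
  assumes "(\<Sum>y\<in>B (Suc 0). p y * ent y) \<in> right_multiples" "y \<in> B (Suc 0)"
  shows "p y \<in> I"
proof -
  obtain f where f: "f ` X \<subseteq> I" "(\<Sum>y\<in>B (Suc 0). p y * ent y) = (\<Sum>x\<in>X. f x * letter x)"
    using assms(1) unfolding right_multiples_def by blast
  have "\<exists>k. letter x = (\<Sum>y\<in>B (Suc 0). const (k y) * ent y)" if "x \<in> X" for x
  proof -
    have "letter x \<in> tensor_comp X 1" using that by (simp add: tensor_comp_def letter_def tensor_carrier)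
    then have "letter x \<in> free_alg_vs.span (ent ` B (Suc 0))" using ent_span by simp
    then have "letter x \<in> range (\<lambda>k. \<Sum>v\<in>ent ` B (Suc 0). const (k v) * v)"
      using free_alg_vs.span_finite[OF finite_imageI[OF finite_B1], of ent] by simp
    then obtain k where "letter x = (\<Sum>v\<in>ent ` B (Suc 0). const (k v) * v)" by blast
    then show ?thesis using ent_inj by (intro exI[of _ "\<lambda>y. k (ent y)"]) (simp add: sum.reindex)
  qed
  then obtain k where k: "\<And>x. x \<in> X \<Longrightarrow> letter x = (\<Sum>y\<in>B (Suc 0). const (k x y) * ent y)" by metis
  have "(\<Sum>x\<in>X. f x * letter x) = (\<Sum>x\<in>X. \<Sum>y\<in>B (Suc 0). f x * const (k x y) * ent y)"
  proof (rule sum.cong[OF refl])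
    fix x assume "x \<in> X"
    show "f x * letter x = (\<Sum>y\<in>B (Suc 0). f x * const (k x y) * ent y)"
      by (subst k[OF \<open>x \<in> X\<close>]) (simp add: sum_distrib_left mult.assoc)
  qed
  also have "\<dots> = (\<Sum>y\<in>B (Suc 0). (\<Sum>x\<in>X. f x * const (k x y)) * ent y)"
    by (subst sum.swap) (simp add: sum_distrib_right)
  finally have "(\<Sum>y\<in>B (Suc 0). (p y - (\<Sum>x\<in>X. f x * const (k x y))) * ent y) = 0"
    using f(2) by (simp add: left_diff_distrib sum_subtractf)
  then have "p y = (\<Sum>x\<in>X. f x * const (k x y))" using ent_right_free assms(2) by fastforce
  then show ?thesis using f(1) by (auto intro!: I_rules(8) I_rules(5))
qed

lemma rel_expand: "rel z = (\<Sum>y\<in>B (Suc 0). Mh (Suc (Suc 0)) z y * ent y)"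
  unfolding mat_mult_def using finite_B1 by (intro sum.mono_neutral_left) auto

lemma rel_bij: "bij_betw rel (B (Suc (Suc 0))) R"
  using entries_R[of gen] B0 by (simp add: numeral_2_eq_2)

lemma finite_B2: "finite (B (Suc (Suc 0)))"
  using rel_bij finite_relations bij_betw_finite by blast

lemma rel_I: "z \<in> B (Suc (Suc 0)) \<Longrightarrow> rel z \<in> I"
  using rel_bij relations_I by (auto simp: bij_betw_def)

text \<open>
  The relations are linearly independent in \<open>I/I'\<close>. A combination in \<open>I'\<close> can be rewritten, by
  \<open>I_left_generated\<close>, as \<open>\<Sum>\<^sub>z c\<^sub>z rel z\<close> in \<open>I \<otimes> V\<close> with \<open>c\<^sub>z\<close> of constant coefficient \<open>k\<^sub>z\<close>. Comparing
  coefficients of the entries, the rows of \<open>M\<^sub>2\<close> satisfy the relation \<open>\<Sum>\<^sub>z c\<^sub>z M\<^sub>2(z,y) = 0\<close> over \<open>A\<close>. So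
  \<open>\<Sum>\<^sub>z c\<^sub>z z\<close> is a cycle, hence a boundary, hence in \<open>A\<^sub>+ Q\<^sup>2\<close> by minimality, and every \<open>k\<^sub>z\<close> is zero.
\<close>

lemma rel_independent:
  assumes "(\<Sum>z\<in>B (Suc (Suc 0)). const (k z) * rel z) \<in> I'" "z \<in> B (Suc (Suc 0))"
  shows "k z = 0"
proof -
  obtain q g where q: "q \<in> right_multiples" and g: "g ` X \<subseteq> I"
    and e: "(\<Sum>z\<in>B (Suc (Suc 0)). const (k z) * rel z) = q + (\<Sum>x\<in>X. letter x * g x)"
    using decomposable_cases[OF assms(1)] by blast
  have "\<forall>x\<in>X. \<exists>t j. t ` R \<subseteq> carrier T \<and> j \<in> right_multiples \<and> g x = (\<Sum>r\<in>R. t r * r) + j"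
  proof
    fix x assume "x \<in> X"
    then have "g x \<in> I" using g by blast
    from I_left_generated[OF this]
    show "\<exists>t j. t ` R \<subseteq> carrier T \<and> j \<in> right_multiples \<and> g x = (\<Sum>r\<in>R. t r * r) + j" .
  qed
  from bchoice[OF this] obtain t where
    "\<forall>x\<in>X. \<exists>j. t x ` R \<subseteq> carrier T \<and> j \<in> right_multiples \<and> g x = (\<Sum>r\<in>R. t x r * r) + j" by blast
  from bchoice[OF this] obtain j where
    tj: "\<forall>x\<in>X. t x ` R \<subseteq> carrier T \<and> j x \<in> right_multiples \<and> g x = (\<Sum>r\<in>R. t x r * r) + j x" by blast
  then have t: "\<And>x. x \<in> X \<Longrightarrow> t x ` R \<subseteq> carrier T" and j: "\<And>x. x \<in> X \<Longrightarrow> j x \<in> right_multiples"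
    and gx: "\<And>x. x \<in> X \<Longrightarrow> g x = (\<Sum>r\<in>R. t x r * r) + j x" by blast+
  define s where "s = (\<lambda>r. \<Sum>x\<in>X. letter x * t x r)"
  have s: "s r \<in> carrier T" "constant_coeff (s r) = 0" if "r \<in> R" for r
    using t that by (auto simp: s_def lookup_sum intro!: tensor_sum tensor_mult)
  have "(\<Sum>x\<in>X. letter x * g x) = (\<Sum>x\<in>X. (\<Sum>r\<in>R. letter x * t x r * r) + letter x * j x)"
    by (intro sum.cong refl) (simp add: gx distrib_left sum_distrib_left mult.assoc)
  also have "\<dots> = (\<Sum>r\<in>R. s r * r) + (\<Sum>x\<in>X. letter x * j x)"
    unfolding sum.distrib by (subst sum.swap) (simp add: s_def sum_distrib_right)
  also have "(\<Sum>r\<in>R. s r * r) = (\<Sum>z\<in>B (Suc (Suc 0)). s (rel z) * rel z)"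
    using sum.reindex_bij_betw[OF rel_bij, of "\<lambda>r. s r * r"] by simp
  finally have e2: "(\<Sum>z\<in>B (Suc (Suc 0)). (const (k z) - s (rel z)) * rel z) = q + (\<Sum>x\<in>X. letter x * j x)"
    using e by (simp add: left_diff_distrib sum_subtractf)
  \<comment> \<open>the coefficients over \<open>T(V)\<close> after moving the part in \<open>V \<otimes> I\<close> to the left-hand side\<close>
  define c where "c = (\<lambda>z. const (k z) - s (rel z))"
  have c: "c z \<in> carrier T" "constant_coeff (c z) = k z" if "z \<in> B (Suc (Suc 0))" for z
    using s rel_bij that by (auto simp: c_def bij_betw_def lookup_minus)
  have "(\<Sum>z\<in>B (Suc (Suc 0)). c z * rel z) \<in> right_multiples"
    unfolding c_def e2 using q j by (intro right_multiples_add right_multiples_sum right_multiples_left_mult) auto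
  moreover have "(\<Sum>z\<in>B (Suc (Suc 0)). c z * rel z) =
      (\<Sum>y\<in>B (Suc 0). (\<Sum>z\<in>B (Suc (Suc 0)). c z * Mh (Suc (Suc 0)) z y) * ent y)"
    unfolding rel_expand sum_distrib_left by (subst sum.swap) (simp add: sum_distrib_right mult.assoc)
  ultimately have pI: "(\<Sum>z\<in>B (Suc (Suc 0)). c z * Mh (Suc (Suc 0)) z y) \<in> I" if "y \<in> B (Suc 0)" for y
    using ent_right_multiples[of "\<lambda>y. \<Sum>z\<in>B (Suc (Suc 0)). c z * Mh (Suc (Suc 0)) z y" y] that by simp
  define x where "x = (\<Oplus>\<^bsub>res_mod Q (Suc (Suc 0))\<^esub>z\<in>B (Suc (Suc 0)). proj (c z) \<odot>\<^bsub>res_mod Q (Suc (Suc 0))\<^esub> z)"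
  have cA: "z \<in> B (Suc (Suc 0)) \<Longrightarrow> proj (c z) \<in> carrier A" for z using c by (simp add: A_carrier)
  have x: "x \<in> carrier (res_mod Q (Suc (Suc 0)))"
    unfolding x_def using cA Qf.basis_carrier Qf.smult_closed by (intro Qf.M.finsum_closed) auto
  have cx: "cf (Suc (Suc 0)) x z = proj (c z)" if "z \<in> B (Suc (Suc 0))" for z
    unfolding x_def using Qf.coord_eqI[OF finite_B2 subset_refl, of "\<lambda>z. proj (c z)" z] cA that by simp
  have "cf (Suc 0) (res_diff Q (Suc (Suc 0)) x) y = \<zero>\<^bsub>A\<^esub>" if y: "y \<in> B (Suc 0)" for y
  proof -
    have "cf (Suc 0) (res_diff Q (Suc (Suc 0)) x) y = proj (\<Sum>z\<in>B (Suc (Suc 0)). c z * Mh (Suc (Suc 0)) z y)"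
      using c cx y by (intro lin_map_coord[OF Q.diff_lin finite_B2 x]) (auto simp: Mh_carrier Mh_coord)
    also have "\<dots> = proj 0" using pI[OF y] I_rules(1) by (subst proj_eq_iff) auto
    finally show ?thesis by (simp add: A_ops)
  qed
  then have "{y. cf (Suc 0) (res_diff Q (Suc (Suc 0)) x) y \<noteq> \<zero>\<^bsub>A\<^esub>} = {}"
    using Qf.coord_support[OF Q.diff_closed] by blast
  then have "res_diff Q (Suc (Suc 0)) x = \<zero>\<^bsub>res_mod Q (Suc 0)\<^esub>"
    using Qf.coord_spec[OF Q.diff_closed[of "Suc 0" x]] abelian_monoid.finsum_empty[OF abelian_group.axioms(1)[OF Q.is_abelian]] by metis
  then have "x \<in> res_diff Q (Suc (Suc (Suc 0))) ` carrier (res_mod Q (Suc (Suc (Suc 0))))"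
    using Q.exact_Suc[of "Suc 0"] x by blast
  then have "dual (Suc (Suc 0)) z x = 0" using minimal_cochain[OF dual_cochain[OF assms(2)]] by auto
  then show ?thesis using x cx[OF assms(2)] c[OF assms(2)] A_aug by (simp add: dual_def)
qed


section \<open>Products in coordinates\<close>

text \<open>
  The two sums represent the coordinate of \<open>d (\<phi>\<^sub>1 b)\<close> and that of \<open>\<phi>\<^sub>0 (d b)\<close>.
\<close>

lemma product_lift_1:
  assumes \<phi>: "chain_lift A Q n g \<phi>" and fin: "finite (B n)" and b: "b \<in> B (Suc n)"
  shows "(\<Sum>y\<in>B (Suc 0). rep (cf (Suc 0) (\<phi> (Suc 0) b) y) * ent y) -
      (\<Sum>c\<in>B n. Mh (Suc n) b c * rep (cf 0 (\<phi> 0 c) gen)) \<in> I"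
proof -
  note \<phi>' = \<phi>[unfolded chain_lift_iff]
  have l: "lin_map A (res_mod Q (i + n)) (res_mod Q i) (\<phi> i)" for i
    using graded_hom_lin[OF Q.is_gmod Q.is_gmod cross_liftD(1)[OF \<phi>']] .
  have l0: "lin_map A (res_mod Q n) (res_mod Q 0) (\<phi> 0)" using l[of 0] by simp
  have t: "\<phi> i x \<in> carrier (res_mod Q i)" for i x using lin_map_closed[OF Q.is_gmod l] .
  have bc: "b \<in> carrier (res_mod Q (Suc n))" using b Qf.basis_carrier by blast
  have ca: "cf i (\<phi> i x) y \<in> carrier A" for i x y using Qf.coord_carrier[OF t] .
  have g: "gen \<in> B 0" using B0 by simp
  have "proj (\<Sum>y\<in>B (Suc 0). rep (cf (Suc 0) (\<phi> (Suc 0) b) y) * ent y) = cf 0 (res_diff Q (Suc 0) (\<phi> (Suc 0) b)) gen"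
    using g by (intro lin_map_coord[symmetric, OF Q.diff_lin finite_B1 t])
      (auto simp: rep[OF ca] ent_carrier Mh_coord)
  also have "res_diff Q (Suc 0) (\<phi> (Suc 0) b) = \<phi> 0 (res_diff Q (Suc n) b)"
    using cross_liftD(3)[OF \<phi>', of b 0] bc by simp
  also have "cf 0 \<dots> gen = proj (\<Sum>c\<in>B n. Mh (Suc n) b c * rep (cf 0 (\<phi> 0 c) gen))"
    using b by (intro lin_map_coord[OF l0 fin Q.diff_closed]) (auto simp: rep[OF ca] Mh_carrier Mh_coord)
  finally show ?thesis
    using rep(1)[OF ca] ent_carrier Mh_carrier[OF b] by (subst (asm) proj_eq_iff) (auto intro!: tensor_sum)
qed

lemma mult_ge2:
  assumes "p \<in> carrier T" "q \<in> carrier T" "constant_coeff p = 0" "constant_coeff q = 0"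
  shows "p * q \<in> tensor_ge2 X"
proof -
  have len: "length (letters w) \<ge> 1" if "w \<in> Poly_Mapping.keys r" "constant_coeff r = 0" for w and r :: "('x, 'k) free_alg"
    using that by (cases "letters w") (auto simp: in_keys_iff fword_eq_zero_iff[symmetric])
  have "length (letters w) \<ge> 2" if w: "w \<in> Poly_Mapping.keys (p * q)" for w
  proof -
    obtain u v where "w = u + v" "u \<in> Poly_Mapping.keys p" "v \<in> Poly_Mapping.keys q" using w keys_mult[of p q] by blast
    then show ?thesis using len[of u p] len[of v q] assms by simp
  qed
  then show ?thesis using assms by (simp add: tensor_ge2_def)
qed

text \<open>
  Modulo \<open>A\<^sub>+\<close>, the map \<open>\<phi>\<^sub>0\<close> sends \<open>c\<close> to \<open>g c / lam\<close> times the generator.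
\<close>

lemma lift_coefficient:
  assumes \<phi>: "chain_lift A Q n g \<phi>" and c: "c \<in> B n"
  shows "constant_coeff (rep (cf 0 (\<phi> 0 c) gen)) = g c / lam"
proof -
  have t: "\<phi> 0 c \<in> carrier (res_mod Q 0)"
    using lin_map_closed[OF Q.is_gmod graded_hom_lin[OF Q.is_gmod Q.is_gmod cross_liftD(1)[OF \<phi>[unfolded chain_lift_iff]]]] .
  show ?thesis
    using aug_coord_0[OF t] rep(3)[OF Qf.coord_carrier[OF t]] cross_liftD(2)[OF \<phi>[unfolded chain_lift_iff]] Qf.basis_carrier[OF c]
    by simp
qed

text \<open>
  Used to replace one factor by its constant coefficient, at the cost of a product with a factor in
  \<open>T(V)\<^sub>+\<close>.
\<close>

lemma split_constant: "p * q = const (constant_coeff p) * q + (p - const (constant_coeff p)) * q"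
  "q * p = const (constant_coeff p) * q + q * (p - const (constant_coeff p))"
  for p q :: "('x, 'k) free_alg"
  by (simp_all add: left_diff_distrib right_diff_distrib const_commute)

text \<open>
  In \<open>product_lift_1\<close> the entries of both matrices lie in \<open>T(V)\<^sub>+\<close>, so modulo \<open>T(V)\<^sub>\<ge>\<^sub>2\<close> the other factors
  may be replaced by their constant coefficients.
\<close>

lemma product_1:
  assumes \<phi>: "chain_lift A Q n g \<phi>" and fin: "finite (B n)" and b: "b \<in> B (Suc n)"
  shows "(\<Sum>y\<in>B (Suc 0). const (aug A (cf (Suc 0) (\<phi> (Suc 0) b) y)) * ent y) -
      (\<Sum>c\<in>B n. const (g c / lam) * Mh (Suc n) b c) \<in> tensor_ge2 X"
proof -
  have t: "\<phi> i x \<in> carrier (res_mod Q i)" for i x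
    using lin_map_closed[OF Q.is_gmod graded_hom_lin[OF Q.is_gmod Q.is_gmod cross_liftD(1)[OF \<phi>[unfolded chain_lift_iff]]]] .
  note ca = Qf.coord_carrier[OF t]
  note G = tensor_idealD[OF tensor_ge2_ideal[of X]]
  let ?p = "\<lambda>y. rep (cf (Suc 0) (\<phi> (Suc 0) b) y)" and ?a = "\<lambda>c. rep (cf 0 (\<phi> 0 c) gen)"
  have 1: "(\<Sum>y\<in>B (Suc 0). (?p y - const (constant_coeff (?p y))) * ent y) \<in> tensor_ge2 X"
    using rep(1)[OF ca] ent_carrier ent_constant_coeff by (intro G(8) mult_ge2) (auto simp: lookup_minus)
  have 2: "(\<Sum>c\<in>B n. Mh (Suc n) b c * (?a c - const (constant_coeff (?a c)))) \<in> tensor_ge2 X"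
    using rep(1)[OF ca] b by (intro G(8) mult_ge2) (auto simp: lookup_minus Mh_carrier Mh_constant_coeff)
  have p: "(\<Sum>y\<in>B (Suc 0). ?p y * ent y) = (\<Sum>y\<in>B (Suc 0). const (aug A (cf (Suc 0) (\<phi> (Suc 0) b) y)) * ent y) +
      (\<Sum>y\<in>B (Suc 0). (?p y - const (constant_coeff (?p y))) * ent y)"
    unfolding sum.distrib[symmetric] rep(3)[OF ca, symmetric] by (intro sum.cong refl split_constant)
  have a: "(\<Sum>c\<in>B n. Mh (Suc n) b c * ?a c) = (\<Sum>c\<in>B n. const (g c / lam) * Mh (Suc n) b c) +
      (\<Sum>c\<in>B n. Mh (Suc n) b c * (?a c - const (constant_coeff (?a c))))"
    unfolding sum.distrib[symmetric]
    by (intro sum.cong refl) (simp add: lift_coefficient[OF \<phi>, symmetric] split_constant(2)[symmetric])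
  have "(\<Sum>y\<in>B (Suc 0). ?p y * ent y) - (\<Sum>c\<in>B n. Mh (Suc n) b c * ?a c) \<in> tensor_ge2 X"
    using product_lift_1[OF assms] I_ge2 by blast
  from G(3)[OF G(7)[OF this 1] 2] show ?thesis unfolding p a by simp
qed

text \<open>
  \<open>M\<^sub>n M\<^sub>n\<^sub>-\<^sub>1\<close> represents \<open>d \<circ> d = 0\<close>.
\<close>

lemma product_matrix_I:
  assumes fin: "finite (B (Suc n))" and b: "b \<in> B (Suc (Suc n))" and e: "e \<in> B n"
  shows "(\<Sum>c\<in>B (Suc n). Mh (Suc (Suc n)) b c * Mh (Suc n) c e) \<in> I"
proof -
  have "cf n (res_diff Q (Suc n) (res_diff Q (Suc (Suc n)) b)) e =
      proj (\<Sum>c\<in>B (Suc n). Mh (Suc (Suc n)) b c * Mh (Suc n) c e)"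
    using b e by (intro lin_map_coord[OF Q.diff_lin fin Q.diff_closed]) (auto simp: Mh_carrier Mh_coord)
  then have "proj (\<Sum>c\<in>B (Suc n). Mh (Suc (Suc n)) b c * Mh (Suc n) c e) = proj 0"
    using Q.diff_diff[OF Qf.basis_carrier[OF b]] by (simp add: A_ops)
  then show ?thesis using b e by (subst (asm) proj_eq_iff) (auto intro!: tensor_sum simp: Mh_carrier)
qed

text \<open>
  Comparing \<open>d (\<phi>\<^sub>2 b)\<close> with \<open>\<phi>\<^sub>1 (d b)\<close> gives, for every \<open>y\<close>, a congruence modulo \<open>I\<close> between coefficients
  of \<open>ent y\<close>; multiplying by \<open>ent y\<close> and summing gives a congruence modulo \<open>I \<otimes> V\<close>. There the expression
  \<open>\<Sum>\<^sub>y (\<phi>\<^sub>1 c)\<^sub>y ent y\<close> is replaced by means of \<open>product_lift_1\<close>; the error lies in \<open>I\<close> and is multiplied on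
  the left by entries in \<open>T(V)\<^sub>+\<close>, so it vanishes modulo \<open>V \<otimes> I\<close>. Finally both sides are combinations of
  elements of \<open>I\<close>, and modulo \<open>I'\<close> their coefficients may be replaced by constant ones.
\<close>

lemma product_2:
  assumes \<phi>: "chain_lift A Q n g \<phi>" and fin: "finite (B n)" "finite (B (Suc n))" and b: "b \<in> B (Suc (Suc n))"
  shows "(\<Sum>z\<in>B (Suc (Suc 0)). const (aug A (cf (Suc (Suc 0)) (\<phi> (Suc (Suc 0)) b) z)) * rel z) -
      (\<Sum>e\<in>B n. const (g e / lam) * (\<Sum>c\<in>B (Suc n). Mh (Suc (Suc n)) b c * Mh (Suc n) c e)) \<in> I'"
proof -
  note \<phi>' = \<phi>[unfolded chain_lift_iff]
  have l: "lin_map A (res_mod Q (i + n)) (res_mod Q i) (\<phi> i)" for i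
    using graded_hom_lin[OF Q.is_gmod Q.is_gmod cross_liftD(1)[OF \<phi>']] .
  have l1: "lin_map A (res_mod Q (Suc n)) (res_mod Q (Suc 0)) (\<phi> (Suc 0))" using l[of "Suc 0"] by simp
  have t: "\<phi> i x \<in> carrier (res_mod Q i)" for i x using lin_map_closed[OF Q.is_gmod l] .
  note ca = Qf.coord_carrier[OF t]
  note D = tensor_idealD[OF I'_ideal]
  have bc: "b \<in> carrier (res_mod Q (Suc (Suc n)))" using b Qf.basis_carrier by blast
  let ?q = "\<lambda>z. rep (cf (Suc (Suc 0)) (\<phi> (Suc (Suc 0)) b) z)" and ?p = "\<lambda>c y. rep (cf (Suc 0) (\<phi> (Suc 0) c) y)"
    and ?a = "\<lambda>e. rep (cf 0 (\<phi> 0 e) gen)" and ?m = "Mh (Suc (Suc n)) b"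
    and ?N = "\<lambda>e. \<Sum>c\<in>B (Suc n). Mh (Suc (Suc n)) b c * Mh (Suc n) c e"
  have col: "(\<Sum>z\<in>B (Suc (Suc 0)). ?q z * Mh (Suc (Suc 0)) z y) - (\<Sum>c\<in>B (Suc n). ?m c * ?p c y) \<in> I"
    if y: "y \<in> B (Suc 0)" for y
  proof -
    have "proj (\<Sum>z\<in>B (Suc (Suc 0)). ?q z * Mh (Suc (Suc 0)) z y) = cf (Suc 0) (res_diff Q (Suc (Suc 0)) (\<phi> (Suc (Suc 0)) b)) y"
      using y by (intro lin_map_coord[symmetric, OF Q.diff_lin finite_B2 t]) (auto simp: rep[OF ca] Mh_carrier Mh_coord)
    also have "res_diff Q (Suc (Suc 0)) (\<phi> (Suc (Suc 0)) b) = \<phi> (Suc 0) (res_diff Q (Suc (Suc n)) b)"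
      using cross_liftD(3)[OF \<phi>', of b "Suc 0"] bc by simp
    also have "cf (Suc 0) \<dots> y = proj (\<Sum>c\<in>B (Suc n). ?m c * ?p c y)"
      using b by (intro lin_map_coord[OF l1 fin(2) Q.diff_closed]) (auto simp: rep[OF ca] Mh_carrier Mh_coord)
    finally show ?thesis
      using rep(1)[OF ca] y b by (subst (asm) proj_eq_iff) (auto intro!: tensor_sum simp: Mh_carrier)
  qed
  have "(\<Sum>y\<in>B (Suc 0). ((\<Sum>z\<in>B (Suc (Suc 0)). ?q z * Mh (Suc (Suc 0)) z y) - (\<Sum>c\<in>B (Suc n). ?m c * ?p c y)) * ent y)
      \<in> right_multiples"
    using col ent_carrier ent_constant_coeff by (intro right_multiples_sum right_multiplesI) auto
  moreover have "(\<Sum>y\<in>B (Suc 0). ((\<Sum>z\<in>B (Suc (Suc 0)). ?q z * Mh (Suc (Suc 0)) z y) - (\<Sum>c\<in>B (Suc n). ?m c * ?p c y)) * ent y)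
      = (\<Sum>z\<in>B (Suc (Suc 0)). ?q z * rel z) - (\<Sum>c\<in>B (Suc n). ?m c * (\<Sum>y\<in>B (Suc 0). ?p c y * ent y))"
    unfolding rel_expand left_diff_distrib sum_subtractf sum_distrib_left sum_distrib_right mult.assoc
    by (subst (1 2) sum.swap) simp
  ultimately have 1: "(\<Sum>z\<in>B (Suc (Suc 0)). ?q z * rel z) - (\<Sum>c\<in>B (Suc n). ?m c * (\<Sum>y\<in>B (Suc 0). ?p c y * ent y)) \<in> I'"
    using decomposable_right by auto
  have 2: "(\<Sum>c\<in>B (Suc n). ?m c * ((\<Sum>y\<in>B (Suc 0). ?p c y * ent y) - (\<Sum>e\<in>B n. Mh (Suc n) c e * ?a e))) \<in> I'"
    using product_lift_1[OF \<phi> fin(1)] b by (intro decomposable_sum decomposable_left) (auto simp: Mh_carrier Mh_constant_coeff)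
  have "(\<Sum>c\<in>B (Suc n). ?m c * (\<Sum>e\<in>B n. Mh (Suc n) c e * ?a e)) = (\<Sum>e\<in>B n. ?N e * ?a e)"
    unfolding sum_distrib_left sum_distrib_right mult.assoc by (rule sum.swap)
  then have 3: "(\<Sum>z\<in>B (Suc (Suc 0)). ?q z * rel z) - (\<Sum>e\<in>B n. ?N e * ?a e) \<in> I'"
    using D(3)[OF 1 2] by (simp add: right_diff_distrib sum_subtractf)
  have 4: "(\<Sum>z\<in>B (Suc (Suc 0)). (?q z - const (constant_coeff (?q z))) * rel z) \<in> I'"
    using rep(1)[OF ca] rel_I by (intro decomposable_sum decomposable_left) (auto simp: lookup_minus)
  have 5: "(\<Sum>e\<in>B n. ?N e * (?a e - const (constant_coeff (?a e)))) \<in> I'"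
  proof (rule decomposable_sum)
    fix e assume e: "e \<in> B n"
    show "?N e * (?a e - const (constant_coeff (?a e))) \<in> I'"
      using right_multiplesI[OF product_matrix_I[OF fin(2) b e], of "?a e - const (constant_coeff (?a e))"]
        decomposable_right rep(1)[OF ca] by (auto simp: lookup_minus)
  qed
  have q: "(\<Sum>z\<in>B (Suc (Suc 0)). ?q z * rel z) =
      (\<Sum>z\<in>B (Suc (Suc 0)). const (aug A (cf (Suc (Suc 0)) (\<phi> (Suc (Suc 0)) b) z)) * rel z) +
      (\<Sum>z\<in>B (Suc (Suc 0)). (?q z - const (constant_coeff (?q z))) * rel z)"
    unfolding sum.distrib[symmetric] rep(3)[OF ca, symmetric] by (intro sum.cong refl split_constant)
  have a: "(\<Sum>e\<in>B n. ?N e * ?a e) = (\<Sum>e\<in>B n. const (g e / lam) * ?N e) +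
      (\<Sum>e\<in>B n. ?N e * (?a e - const (constant_coeff (?a e))))"
    unfolding sum.distrib[symmetric]
    by (intro sum.cong refl) (simp add: lift_coefficient[OF \<phi>, symmetric] split_constant(2)[symmetric])
  from D(3)[OF D(7)[OF 3 4] 5] show ?thesis unfolding q a by simp
qed

end


section \<open>Row rank and column rank\<close>

lemma function_space: "vector_space (\<lambda>c (f :: 'b \<Rightarrow> 'k::field) x. c * f x)"
  by standard (auto simp: algebra_simps fun_eq_iff)

text \<open>
  If some standard basis function \<open>\<delta> b0\<close> were outside the span of the columns, a linear functional \<open>\<psi>\<close>
  would vanish on the columns but not on \<open>\<delta> b0\<close>, and the scalars \<open>\<psi> (\<delta> b)\<close> would be a nontrivial relation
  between the rows.
\<close>

lemma independent_rows_span_columns: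
  fixes v :: "'b \<Rightarrow> 'j \<Rightarrow> 'k::field"
  assumes "finite S" and "finite J"
    and indep: "\<And>k. (\<And>j. j \<in> J \<Longrightarrow> (\<Sum>b\<in>S. k b * v b j) = 0) \<Longrightarrow> \<forall>b\<in>S. k b = 0"
  shows "\<exists>a. \<forall>b\<in>S. h b = (\<Sum>j\<in>J. a j * v b j)"
proof -
  interpret V: vector_space "\<lambda>c (f :: 'b \<Rightarrow> 'k) x. c * f x" by (rule function_space)
  interpret K: vector_space "\<lambda>c (x :: 'k). c * x" by standard (auto simp: algebra_simps)
  interpret VK: vector_space_pair "\<lambda>c (f :: 'b \<Rightarrow> 'k) x. c * f x" "\<lambda>c (x :: 'k). c * x" ..
  define w where "w = (\<lambda>j b. if b \<in> S then v b j else 0)"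
  define \<delta> where "\<delta> = (\<lambda>(b :: 'b) b'. if b' = b then 1 else (0 :: 'k))"
  define U where "U = {f. \<exists>a. \<forall>b\<in>S. f b = (\<Sum>j\<in>J. a j * v b j)}"
  have U: "V.subspace U"
  proof (rule V.subspaceI)
    show "0 \<in> U" unfolding U_def by (intro CollectI exI[of _ "\<lambda>_. 0"]) simp
    fix f g assume "f \<in> U" and g: "g \<in> U"
    then obtain a where a: "\<forall>b\<in>S. f b = (\<Sum>j\<in>J. a j * v b j)" unfolding U_def by blast
    obtain a' where a': "\<forall>b\<in>S. g b = (\<Sum>j\<in>J. a' j * v b j)" using g unfolding U_def by blast
    have "(f + g) b = (\<Sum>j\<in>J. (a j + a' j) * v b j)" if "b \<in> S" for b
      using bspec[OF a that] bspec[OF a' that] by (simp only: plus_fun_apply distrib_right sum.distrib)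
    then show "f + g \<in> U" unfolding U_def by (intro CollectI exI[of _ "\<lambda>j. a j + a' j"] ballI)
  next
    fix c f assume "f \<in> U"
    then obtain a where a: "\<forall>b\<in>S. f b = (\<Sum>j\<in>J. a j * v b j)" unfolding U_def by blast
    have "c * f b = (\<Sum>j\<in>J. (c * a j) * v b j)" if "b \<in> S" for b
      using bspec[OF a that] by (simp only: sum_distrib_left mult.assoc)
    then show "(\<lambda>x. c * f x) \<in> U" unfolding U_def by (intro CollectI exI[of _ "\<lambda>j. c * a j"] ballI)
  qed
  have "w j \<in> U" if "j \<in> J" for j
  proof -
    have "(\<Sum>i\<in>J. (if i = j then 1 else 0) * v b i) = v b j" for b
      using that \<open>finite J\<close> by (simp add: if_distrib[of "\<lambda>t. t * _"] cong: if_cong)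
    then show ?thesis unfolding U_def w_def by (intro CollectI exI[of _ "\<lambda>i. if i = j then 1 else 0"]) simp
  qed
  then have span_U: "V.span (w ` J) \<subseteq> U" using U by (intro V.span_minimal) auto
  have "\<delta> b0 \<in> V.span (w ` J)" if b0: "b0 \<in> S" for b0
  proof (rule ccontr)
    assume nin: "\<delta> b0 \<notin> V.span (w ` J)"
    obtain C where C: "C \<subseteq> w ` J" "V.independent C" "V.span C = V.span (w ` J)"
    proof (rule V.maximal_independent_subset[of "w ` J"])
      fix C assume "C \<subseteq> w ` J" "V.independent C" "w ` J \<subseteq> V.span C"
      then show thesis using that[of C] V.span_mono[of C "w ` J"] V.span_minimal[OF _ V.subspace_span, of "w ` J" C] by blast
    qed
    have ind: "V.independent (insert (\<delta> b0) C)" using C nin V.independent_insert by auto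
    obtain \<psi> where \<psi>: "Vector_Spaces.linear (\<lambda>c (f :: 'b \<Rightarrow> 'k) x. c * f x) (\<lambda>c (x :: 'k). c * x) \<psi>"
      and \<psi>C: "\<And>f. f \<in> insert (\<delta> b0) C \<Longrightarrow> \<psi> f = (if f = \<delta> b0 then 1 else 0)"
      using VK.linear_independent_extend[OF ind, of "\<lambda>f. if f = \<delta> b0 then 1 else 0"] by blast
    have "\<delta> b0 \<notin> C" using nin C(3) V.span_base by metis
    then have "\<psi> f = 0" if "f \<in> C" for f using \<psi>C[of f] that by auto
    then have \<psi>0: "\<psi> f = 0" if "f \<in> V.span (w ` J)" for f
      using VK.linear_eq_0_on_span[OF \<psi>, of C f] that C(3) by simp
    interpret \<psi>: Vector_Spaces.linear "\<lambda>c (f :: 'b \<Rightarrow> 'k) x. c * f x" "\<lambda>c (x :: 'k). c * x" \<psi> by (rule \<psi>)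
    have "(\<Sum>b\<in>S. \<psi> (\<delta> b) * v b j) = 0" if j: "j \<in> J" for j
    proof -
      have fs: "sum F D x = (\<Sum>b\<in>D. F b x)" for F :: "'b \<Rightarrow> 'b \<Rightarrow> 'k" and D x
        by (induction D rule: infinite_finite_induct) auto
      have "w j = (\<Sum>b\<in>S. (\<lambda>x. v b j * \<delta> b x))"
        using \<open>finite S\<close> by (auto simp: fs w_def \<delta>_def fun_eq_iff if_distrib[of "\<lambda>t. _ * t"] cong: if_cong)
      then have "\<psi> (w j) = (\<Sum>b\<in>S. v b j * \<psi> (\<delta> b))" by (simp add: \<psi>.sum \<psi>.scale)
      then show ?thesis using \<psi>0[OF V.span_base[OF imageI[OF j]]] by (simp add: mult.commute)
    qed
    then have "\<psi> (\<delta> b0) = 0" using indep[of "\<lambda>b. \<psi> (\<delta> b)"] b0 by blast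
    then show False using \<psi>C[of "\<delta> b0"] by simp
  qed
  then have "(\<Sum>b\<in>S. (\<lambda>x. h b * \<delta> b x)) \<in> U"
    using span_U by (intro V.subspace_sum[OF U] V.subspace_scale[OF U]) auto
  then obtain a where a: "\<forall>b\<in>S. (\<Sum>b\<in>S. (\<lambda>x. h b * \<delta> b x)) b = (\<Sum>j\<in>J. a j * v b j)" unfolding U_def by blast
  have fs: "sum F D x = (\<Sum>b\<in>D. F b x)" for F :: "'b \<Rightarrow> 'b \<Rightarrow> 'k" and D x
    by (induction D rule: infinite_finite_induct) auto
  have "(\<Sum>b\<in>S. (\<lambda>x. h b * \<delta> b x)) b = h b" if "b \<in> S" for b
    using that \<open>finite S\<close> by (simp add: fs \<delta>_def if_distrib[of "\<lambda>t. _ * t"] cong: if_cong)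
  with a have "\<forall>b\<in>S. h b = (\<Sum>j\<in>J. a j * v b j)" by simp
  then show ?thesis by (intro exI[of _ a])
qed

text \<open>
  The standard basis functions are linearly independent and lie in a space spanned by finitely
  many functions.
\<close>

lemma finite_if_columns_span:
  fixes v :: "'b \<Rightarrow> 'j \<Rightarrow> 'k::field"
  assumes "finite J" and span: "\<And>b. b \<in> S \<Longrightarrow> \<exists>a. \<forall>b'\<in>S. (if b' = b then 1 else 0) = (\<Sum>j\<in>J. a j * v b' j)"
  shows "finite S"
proof -
  interpret V: vector_space "\<lambda>c (f :: 'b \<Rightarrow> 'k) x. c * f x" by (rule function_space)
  define w where "w = (\<lambda>j b. if b \<in> S then v b j else 0)"
  define \<delta> where "\<delta> = (\<lambda>(b :: 'b) b'. if b' = b then 1 else (0 :: 'k))"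
  have inj: "\<delta> b = \<delta> b' \<longleftrightarrow> b = b'" for b b' by (auto simp: \<delta>_def fun_eq_iff)
  have fs: "sum F D x = (\<Sum>b\<in>D. F b x)" for F :: "'i \<Rightarrow> 'b \<Rightarrow> 'k" and D x
    by (induction D rule: infinite_finite_induct) auto
  have "V.independent (\<delta> ` S)"
  proof
    assume "V.dependent (\<delta> ` S)"
    then obtain D u f0 where D: "finite D" "D \<subseteq> \<delta> ` S" and f0: "f0 \<in> D" "u f0 \<noteq> 0"
      and z: "(\<Sum>f\<in>D. (\<lambda>x. u f * f x)) = 0"
      unfolding V.dependent_explicit by (elim exE conjE bexE) simp
    obtain b where "f0 = \<delta> b" using D f0 by blast
    with f0 have b: "\<delta> b \<in> D" "u (\<delta> b) \<noteq> 0" by simp_all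
    have "(\<Sum>f\<in>D. u f * f b) = (\<Sum>f\<in>D. if f = \<delta> b then u f else 0)"
    proof (rule sum.cong[OF refl])
      fix f assume "f \<in> D"
      then obtain b' where "f = \<delta> b'" using D by blast
      then show "u f * f b = (if f = \<delta> b then u f else 0)" by (auto simp: inj) (simp_all add: \<delta>_def)
    qed
    also have "\<dots> = u (\<delta> b)" using D b by simp
    finally show False using fun_cong[OF z, of b] b by (simp add: fs)
  qed
  moreover have "\<delta> ` S \<subseteq> V.span (w ` J)"
  proof clarify
    fix b assume "b \<in> S"
    then obtain a where a: "\<forall>b'\<in>S. (if b' = b then 1 else 0) = (\<Sum>j\<in>J. a j * v b' j)" using span by blast
    have "\<delta> b = (\<Sum>j\<in>J. (\<lambda>x. a j * w j x))"
    proof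
      fix x
      show "\<delta> b x = (\<Sum>j\<in>J. (\<lambda>x. a j * w j x)) x"
        using bspec[OF a, of x] \<open>b \<in> S\<close> by (cases "x \<in> S") (auto simp: fs w_def \<delta>_def)
    qed
    show "\<delta> b \<in> V.span (w ` J)"
      unfolding \<open>\<delta> b = _\<close> by (intro V.span_sum V.span_scale V.span_base imageI)
  qed
  ultimately have "finite (\<delta> ` S)" using V.independent_span_bound[OF finite_imageI[OF assms(1)]] by blast
  then show ?thesis by (rule finite_imageD) (auto simp: inj_on_def inj)
qed


section \<open>Decomposable classes and the rows of the matrices\<close>

context minimal_res
begin

lemma finitely_generated_iff: "finitely_generated A (res_mod Q n) \<longleftrightarrow> finite (B n)"
proof
  assume "finitely_generated A (res_mod Q n)"
  then obtain S where S: "finite S" "S \<subseteq> carrier (res_mod Q n)"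
    and span: "\<forall>x \<in> carrier (res_mod Q n). \<exists>a \<in> S \<rightarrow> carrier A. x = (\<Oplus>\<^bsub>res_mod Q n\<^esub>s\<in>S. a s \<odot>\<^bsub>res_mod Q n\<^esub> s)"
    unfolding finitely_generated_def by blast
  have "B n \<subseteq> (\<Union>s\<in>S. {b. cf n s b \<noteq> \<zero>\<^bsub>A\<^esub>})"
  proof
    fix b assume b: "b \<in> B n"
    show "b \<in> (\<Union>s\<in>S. {b. cf n s b \<noteq> \<zero>\<^bsub>A\<^esub>})"
    proof (rule ccontr)
      assume nb: "b \<notin> (\<Union>s\<in>S. {b. cf n s b \<noteq> \<zero>\<^bsub>A\<^esub>})"
      obtain a where a: "a \<in> S \<rightarrow> carrier A" "b = (\<Oplus>\<^bsub>res_mod Q n\<^esub>s\<in>S. a s \<odot>\<^bsub>res_mod Q n\<^esub> s)"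
        using span Qf.basis_carrier[OF b] by blast
      have ac: "\<And>s. s \<in> S \<Longrightarrow> a s \<in> carrier A" "\<And>s. s \<in> S \<Longrightarrow> s \<in> carrier (res_mod Q n)"
        using a(1) S(2) by auto
      have "dual n b b = finsum (trivial_module A) (\<lambda>s. dual n b (a s \<odot>\<^bsub>res_mod Q n\<^esub> s)) S"
        by (subst (2) a(2), rule lin_map_finsum[OF Q.is_abelian trivial_module_abelian Q.cochain_lin[OF dual_cochain[OF b]] S(1)])
          (use ac Qf.smult_closed in auto)
      also have "\<dots> = (\<Sum>s\<in>S. aug A (a s) * dual n b s)"
        using S(1) ac by (simp add: lin_map_smult[OF Q.cochain_lin[OF dual_cochain[OF b]]])
      also have "\<dots> = 0" using nb ac by (intro sum.neutral) (auto simp: dual_def)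
      finally show False using dual_basis[OF b b] by simp
    qed
  qed
  moreover have "finite (\<Union>s\<in>S. {b. cf n s b \<noteq> \<zero>\<^bsub>A\<^esub>})"
    using S Qf.coord_support by (intro finite_UN_I) auto
  ultimately show "finite (B n)" by (rule finite_subset)
next
  assume fin: "finite (B n)"
  show "finitely_generated A (res_mod Q n)"
    unfolding finitely_generated_def
  proof (intro exI[of _ "B n"] conjI ballI fin)
    show "B n \<subseteq> carrier (res_mod Q n)" using Qf.basis_carrier by blast
    fix x assume x: "x \<in> carrier (res_mod Q n)"
    show "\<exists>a \<in> B n \<rightarrow> carrier A. x = (\<Oplus>\<^bsub>res_mod Q n\<^esub>s\<in>B n. a s \<odot>\<^bsub>res_mod Q n\<^esub> s)"
    proof (rule bexI)
      show "x = (\<Oplus>\<^bsub>res_mod Q n\<^esub>s\<in>B n. cf n x s \<odot>\<^bsub>res_mod Q n\<^esub> s)"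
        using Qf.coord_support[OF x] by (intro Qf.coord_expansion[OF x fin]) auto
    qed (use Qf.coord_carrier[OF x] in auto)
  qed
qed

text \<open>
  The common form of \<open>product_1\<close> and \<open>product_2\<close>. The products with the dual basis cocycles supply the
  coefficients \<open>t\<close> of the matrix entries \<open>N b c\<close> in the family \<open>u\<close>. Every other product is a combination of
  these, since coefficients with respect to \<open>u\<close> are unique modulo \<open>W\<close>.
\<close>

lemma structure_constants:
  assumes W: "ideal W T" and fin: "finite (B r)" "finite (B n)"
    and indep: "\<And>k i. (\<Sum>i\<in>B r. const (k i) * u i) \<in> W \<Longrightarrow> i \<in> B r \<Longrightarrow> k i = 0"
    and prod: "\<And>g \<phi> b. chain_lift A Q n g \<phi> \<Longrightarrow> b \<in> S \<Longrightarrow>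
      (\<Sum>i\<in>B r. const (aug A (cf r (\<phi> r b) i)) * u i) - (\<Sum>c\<in>B n. const (g c / lam) * N b c) \<in> W"
  shows "\<exists>t. (\<forall>b\<in>S. \<forall>c\<in>B n. (\<Sum>i\<in>B r. const (t b i c) * u i) - N b c \<in> W) \<and>
    (\<forall>f g \<phi>. \<forall>b\<in>S. f \<in> cochains A Q r \<longrightarrow> chain_lift A Q n g \<phi> \<longrightarrow>
      f (\<phi> r b) = (\<Sum>i\<in>B r. \<Sum>c\<in>B n. f i * t b i c * g c) / lam)"
proof -
  note D = tensor_idealD[OF W]
  have "\<forall>c\<in>B n. \<exists>\<phi>. chain_lift A Q n (dual n c) \<phi>"
    by (intro ballI Q.chain_lift_exists cochain_cocycle dual_cochain)
  from bchoice[OF this] obtain \<Phi> where \<Phi>: "\<And>c. c \<in> B n \<Longrightarrow> chain_lift A Q n (dual n c) (\<Phi> c)" by blast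
  define t where "t = (\<lambda>b i c. lam * aug A (cf r (\<Phi> c r b) i))"
  have t: "(\<Sum>i\<in>B r. const (t b i c) * u i) - N b c \<in> W" if b: "b \<in> S" and c: "c \<in> B n" for b c
  proof -
    have "(\<Sum>c'\<in>B n. const (dual n c c' / lam) * N b c') = (\<Sum>c'\<in>B n. if c' = c then const (1 / lam) * N b c' else 0)"
      using dual_basis[OF c] by (intro sum.cong) auto
    then have s: "(\<Sum>c'\<in>B n. const (dual n c c' / lam) * N b c') = const (1 / lam) * N b c" using fin c by simp
    have l: "const lam * (const (1 / lam) * N b c) = N b c"
      using lam_nonzero by (simp add: mult.assoc[symmetric] const_mult[symmetric])
    show ?thesis
      using D(4)[OF tensor_const[of lam] prod[OF \<Phi>[OF c] b]]
      by (simp only: s l right_diff_distrib sum_distrib_left t_def const_mult mult.assoc)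
  qed
  have "f (\<phi> r b) = (\<Sum>i\<in>B r. \<Sum>c\<in>B n. f i * t b i c * g c) / lam"
    if f: "f \<in> cochains A Q r" and \<phi>: "chain_lift A Q n g \<phi>" and b: "b \<in> S" for f g \<phi> b
  proof -
    \<comment> \<open>the difference of the claimed and the actual coefficients, to be shown zero by independence of \<open>u\<close> modulo \<open>W\<close>\<close>
    define k where "k = (\<lambda>i. aug A (cf r (\<phi> r b) i) - (\<Sum>c\<in>B n. g c / lam * t b i c))"
    have "(\<Sum>i\<in>B r. const (\<Sum>c\<in>B n. g c / lam * t b i c) * u i) =
        (\<Sum>c\<in>B n. const (g c / lam) * (\<Sum>i\<in>B r. const (t b i c) * u i))"
    proof -
      show ?thesis
        unfolding const_sum sum_distrib_left sum_distrib_right by (subst sum.swap) (simp only: const_mult mult.assoc)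
    qed
    then have "(\<Sum>i\<in>B r. const (k i) * u i) =
        ((\<Sum>i\<in>B r. const (aug A (cf r (\<phi> r b) i)) * u i) - (\<Sum>c\<in>B n. const (g c / lam) * N b c)) -
        (\<Sum>c\<in>B n. const (g c / lam) * ((\<Sum>i\<in>B r. const (t b i c) * u i) - N b c))"
      by (simp add: k_def const_add[of "_" "- _", simplified const_uminus, simplified] left_diff_distrib
          right_diff_distrib sum_subtractf)
    also have "\<dots> \<in> W"
      by (rule D(7)[OF prod[OF \<phi> b] D(8)[OF D(4)[OF tensor_const t[OF b]]]])
    finally have kW: "(\<Sum>i\<in>B r. const (k i) * u i) \<in> W" .
    have "k i = 0" if "i \<in> B r" for i by (rule indep[OF kW that])
    then have "aug A (cf r (\<phi> r b) i) = (\<Sum>c\<in>B n. g c / lam * t b i c)" if "i \<in> B r" for i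
      using that by (simp add: k_def)
    then have "f (\<phi> r b) = (\<Sum>i\<in>B r. (\<Sum>c\<in>B n. g c / lam * t b i c) * f i)"
      using cochain_expansion[OF f fin(1), of "\<phi> r b"]
        lin_map_closed[OF Q.is_gmod graded_hom_lin[OF Q.is_gmod Q.is_gmod cross_liftD(1)[OF \<phi>[unfolded chain_lift_iff]]]] by simp
    then show ?thesis
      unfolding sum_distrib_right sum_divide_distrib by (simp add: mult_ac)
  qed
  with t show ?thesis by (intro exI[of _ t]) blast
qed

lemma combination_in_ideal_iff:
  assumes W: "ideal W T" and fin: "finite F"
    and indep: "\<And>k i. (\<Sum>i\<in>B r. const (k i) * u i) \<in> W \<Longrightarrow> i \<in> B r \<Longrightarrow> k i = 0"
    and t: "\<And>b. b \<in> F \<Longrightarrow> (\<Sum>i\<in>B r. const (t b i) * u i) - N b \<in> W"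
  shows "(\<Sum>b\<in>F. const (k b) * N b) \<in> W \<longleftrightarrow> (\<forall>i\<in>B r. (\<Sum>b\<in>F. k b * t b i) = 0)"
proof -
  note D = tensor_idealD[OF W]
  have e: "(\<Sum>i\<in>B r. const (\<Sum>b\<in>F. k b * t b i) * u i) = (\<Sum>b\<in>F. const (k b) * (\<Sum>i\<in>B r. const (t b i) * u i))"
    unfolding const_sum sum_distrib_left sum_distrib_right by (subst sum.swap) (simp only: const_mult mult.assoc)
  have d: "(\<Sum>b\<in>F. const (k b) * ((\<Sum>i\<in>B r. const (t b i) * u i) - N b)) \<in> W"
    by (rule D(8)[OF D(4)[OF tensor_const t]])
  then have d': "(\<Sum>i\<in>B r. const (\<Sum>b\<in>F. k b * t b i) * u i) - (\<Sum>b\<in>F. const (k b) * N b) \<in> W"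
    unfolding e by (simp add: right_diff_distrib sum_subtractf)
  show ?thesis
  proof
    assume "(\<Sum>b\<in>F. const (k b) * N b) \<in> W"
    from D(3)[OF d' this] have "(\<Sum>i\<in>B r. const (\<Sum>b\<in>F. k b * t b i) * u i) \<in> W" by simp
    then show "\<forall>i\<in>B r. (\<Sum>b\<in>F. k b * t b i) = 0" using indep[of "\<lambda>i. \<Sum>b\<in>F. k b * t b i"] by blast
  next
    assume "\<forall>i\<in>B r. (\<Sum>b\<in>F. k b * t b i) = 0"
    then have "(\<Sum>i\<in>B r. const (\<Sum>b\<in>F. k b * t b i) * u i) = 0" by simp
    then show "(\<Sum>b\<in>F. const (k b) * N b) \<in> W" using D(6)[OF d'] by simp
  qed
qed

abbreviation rows_indep :: "nat \<Rightarrow> bool"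
  where "rows_indep n \<equiv> rows_independent X R (B (Suc (Suc n))) (B (Suc n)) (B n) (linear_part X (Mh (Suc (Suc n))))
        (essential_part X R (B (Suc n)) (Mh (Suc (Suc n))) (Mh (Suc n)))"

text \<open>
  The matrix \<open>v\<close> of the coefficients of the rows of \<open>[L : E]\<close>: its rows are independent exactly if those
  of \<open>[L : E]\<close> are, and its columns span the decomposable cocycles as functions on the basis. The columns are
  indexed by the pairs of an entry of \<open>M\<^sub>1\<close> and a column of \<open>L\<close>, and by the pairs of a relation and a column
  of \<open>E\<close>.
\<close>

lemma coefficient_matrix:
  assumes fin: "finite (B n)" "finite (B (Suc n))"
  obtains J :: "('q \<times> 'q + 'q \<times> 'q) set" and v where "finite J"
    and "rows_indep n \<longleftrightarrow> (\<forall>F k. finite F \<and> F \<subseteq> B (Suc (Suc n)) \<and> (\<forall>j\<in>J. (\<Sum>b\<in>F. k b * v b j) = 0) \<longrightarrow> (\<forall>b\<in>F. k b = 0))"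
    and "\<forall>h\<in>decomposables A Q (Suc (Suc n)). \<exists>a. \<forall>b\<in>B (Suc (Suc n)). h b = (\<Sum>j\<in>J. a j * v b j)"
    and "\<forall>j\<in>J. \<exists>h\<in>decomposables A Q (Suc (Suc n)). \<forall>b\<in>B (Suc (Suc n)). h b = v b j"
proof -
  let ?L = "Suc (Suc n)" and ?Y = "B (Suc 0)" and ?Z = "B (Suc (Suc 0))"
  define N where "N = (\<lambda>b e. \<Sum>c\<in>B (Suc n). Mh ?L b c * Mh (Suc n) c e)"
  have N: "mat_mult (B (Suc n)) (Mh ?L) (Mh (Suc n)) b e = N b e" for b e
    unfolding mat_mult_def N_def using fin by (intro sum.mono_neutral_left) auto
  have "\<exists>t. (\<forall>b\<in>B ?L. \<forall>c\<in>B (Suc n). (\<Sum>i\<in>?Y. const (t b i c) * ent i) - Mh ?L b c \<in> tensor_ge2 X) \<and>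
    (\<forall>f g \<phi>. \<forall>b\<in>B ?L. f \<in> cochains A Q (Suc 0) \<longrightarrow> chain_lift A Q (Suc n) g \<phi> \<longrightarrow>
      f (\<phi> (Suc 0) b) = (\<Sum>i\<in>?Y. \<Sum>c\<in>B (Suc n). f i * t b i c * g c) / lam)"
    by (rule structure_constants[OF tensor_ge2_ideal finite_B1 fin(2)])
      (erule (1) ent_independent_ge2, erule product_1[OF _ fin(2)], assumption)
  then obtain t1 where
    t1: "\<And>b c. b \<in> B ?L \<Longrightarrow> c \<in> B (Suc n) \<Longrightarrow> (\<Sum>i\<in>?Y. const (t1 b i c) * ent i) - Mh ?L b c \<in> tensor_ge2 X"
    and t1p: "\<And>f g \<phi> b. f \<in> cochains A Q (Suc 0) \<Longrightarrow> chain_lift A Q (Suc n) g \<phi> \<Longrightarrow> b \<in> B ?L \<Longrightarrow>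
      f (\<phi> (Suc 0) b) = (\<Sum>i\<in>?Y. \<Sum>c\<in>B (Suc n). f i * t1 b i c * g c) / lam"
    by blast
  have "\<exists>t. (\<forall>b\<in>B ?L. \<forall>e\<in>B n. (\<Sum>i\<in>?Z. const (t b i e) * rel i) - N b e \<in> I') \<and>
    (\<forall>f g \<phi>. \<forall>b\<in>B ?L. f \<in> cochains A Q (Suc (Suc 0)) \<longrightarrow> chain_lift A Q n g \<phi> \<longrightarrow>
      f (\<phi> (Suc (Suc 0)) b) = (\<Sum>i\<in>?Z. \<Sum>e\<in>B n. f i * t b i e * g e) / lam)"
    by (rule structure_constants[OF I'_ideal finite_B2 fin(1)])
      (erule (1) rel_independent, unfold N_def, erule product_2[OF _ fin], assumption)
  then obtain t2 where t2: "\<And>b e. b \<in> B ?L \<Longrightarrow> e \<in> B n \<Longrightarrow> (\<Sum>i\<in>?Z. const (t2 b i e) * rel i) - N b e \<in> I'"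
    and t2p: "\<And>f g \<phi> b. f \<in> cochains A Q (Suc (Suc 0)) \<Longrightarrow> chain_lift A Q n g \<phi> \<Longrightarrow> b \<in> B ?L \<Longrightarrow>
      f (\<phi> (Suc (Suc 0)) b) = (\<Sum>i\<in>?Z. \<Sum>e\<in>B n. f i * t2 b i e * g e) / lam"
    by blast
  define J where "J = (?Y \<times> B (Suc n)) <+> (?Z \<times> B n)"
  define v where "v = (\<lambda>b. case_sum (\<lambda>(y, c). t1 b y c) (\<lambda>(z, e). t2 b z e))"
  have finJ: "finite (?Y \<times> B (Suc n))" "finite (?Z \<times> B n)" using finite_B1 finite_B2 fin by auto
  have J: "finite J" using finJ by (simp add: J_def)
  have sumJ: "(\<Sum>j\<in>J. a j * v b j) = (\<Sum>i\<in>?Y. \<Sum>c\<in>B (Suc n). a (Inl (i, c)) * t1 b i c) +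
      (\<Sum>i\<in>?Z. \<Sum>e\<in>B n. a (Inr (i, e)) * t2 b i e)" for a b
    unfolding J_def sum.Plus[OF finJ] by (simp add: v_def sum.cartesian_product split_def)
  have key: "(\<forall>c\<in>B (Suc n). quot_lincomb X (tensor_ge2 X) F k (\<lambda>b. linear_part X (Mh ?L) b c) = \<zero>\<^bsub>T Quot tensor_ge2 X\<^esub>) \<and>
        (\<forall>e\<in>B n. quot_lincomb X I' F k (\<lambda>b. essential_part X R (B (Suc n)) (Mh ?L) (Mh (Suc n)) b e) = \<zero>\<^bsub>T Quot I'\<^esub>)
      \<longleftrightarrow> (\<forall>j\<in>J. (\<Sum>b\<in>F. k b * v b j) = 0)" if F: "finite F" "F \<subseteq> B ?L" for F k
  proof -
    have 1: "quot_lincomb X (tensor_ge2 X) F k (\<lambda>b. linear_part X (Mh ?L) b c) = \<zero>\<^bsub>T Quot tensor_ge2 X\<^esub> \<longleftrightarrow>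
        (\<forall>i\<in>?Y. (\<Sum>b\<in>F. k b * t1 b i c) = 0)" if c: "c \<in> B (Suc n)" for c
    proof -
      have "quot_lincomb X (tensor_ge2 X) F k (\<lambda>b. linear_part X (Mh ?L) b c) = \<zero>\<^bsub>T Quot tensor_ge2 X\<^esub> \<longleftrightarrow>
          (\<Sum>b\<in>F. const (k b) * Mh ?L b c) \<in> tensor_ge2 X"
        unfolding linear_part_def using F c Mh_carrier by (intro tensor_quot_lincomb tensor_ge2_ideal) auto
      also have "\<dots> \<longleftrightarrow> (\<forall>i\<in>?Y. (\<Sum>b\<in>F. k b * t1 b i c) = 0)"
        by (rule combination_in_ideal_iff[OF tensor_ge2_ideal F(1)])
          (erule (1) ent_independent_ge2, rule t1[OF subsetD[OF F(2)] c])
      finally show ?thesis .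
    qed
    have 2: "quot_lincomb X I' F k (\<lambda>b. essential_part X R (B (Suc n)) (Mh ?L) (Mh (Suc n)) b e) = \<zero>\<^bsub>T Quot I'\<^esub> \<longleftrightarrow>
        (\<forall>i\<in>?Z. (\<Sum>b\<in>F. k b * t2 b i e) = 0)" if e: "e \<in> B n" for e
    proof -
      have "quot_lincomb X I' F k (\<lambda>b. essential_part X R (B (Suc n)) (Mh ?L) (Mh (Suc n)) b e) = \<zero>\<^bsub>T Quot I'\<^esub> \<longleftrightarrow>
          (\<Sum>b\<in>F. const (k b) * N b e) \<in> I'"
        unfolding essential_part_def N using F e product_matrix_I[OF fin(2)] I_rules(1)
        by (intro tensor_quot_lincomb I'_ideal) (auto simp: N_def)
      also have "\<dots> \<longleftrightarrow> (\<forall>i\<in>?Z. (\<Sum>b\<in>F. k b * t2 b i e) = 0)"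
        by (rule combination_in_ideal_iff[OF I'_ideal F(1)])
          (erule (1) rel_independent, rule t2[OF subsetD[OF F(2)] e])
      finally show ?thesis .
    qed
    have plus: "(\<forall>j\<in>C <+> D. G j) \<longleftrightarrow> (\<forall>c\<in>C. G (Inl c)) \<and> (\<forall>d\<in>D. G (Inr d))"
      for C D and G :: "'q \<times> 'q + 'q \<times> 'q \<Rightarrow> bool" by blast
    show ?thesis unfolding J_def plus by (auto simp: 1 2 v_def)
  qed
  have rows: "rows_indep n \<longleftrightarrow> (\<forall>F k. finite F \<and> F \<subseteq> B ?L \<and> (\<forall>j\<in>J. (\<Sum>b\<in>F. k b * v b j) = 0) \<longrightarrow> (\<forall>b\<in>F. k b = 0))"
    unfolding rows_independent_def Let_def
    by (intro iff_allI imp_cong refl) (simp only: key cong: conj_cong)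
  have dec: "\<exists>a. \<forall>b\<in>B ?L. h b = (\<Sum>j\<in>J. a j * v b j)" if "h \<in> decomposables A Q ?L" for h
    using that
  proof (induction rule: decomposables.induct)
    case (cob f)
    then show ?case using coboundary_zero[OF cob] by (intro exI[of _ "\<lambda>_. 0"]) simp
  next
    case (prod1 f g \<phi>)
    then have f: "f \<in> cochains A Q (Suc 0)" "chain_lift A Q (Suc n) g \<phi>" using Q.cocycleD(1) by auto
    show ?case
      by (intro exI[of _ "case_sum (\<lambda>(i, c). f i * g c / lam) (\<lambda>_. 0)"] ballI)
        (unfold sumJ, simp add: t1p[OF f] sum_divide_distrib mult_ac)
  next
    case (prod2 f g \<phi>)
    then have f: "f \<in> cochains A Q (Suc (Suc 0))" "chain_lift A Q n g \<phi>"
      using Q.cocycleD(1)[OF prod2(1)] by (auto simp: numeral_2_eq_2)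
    show ?case
      by (intro exI[of _ "case_sum (\<lambda>_. 0) (\<lambda>(i, c). f i * g c / lam)"] ballI)
        (unfold sumJ, simp add: t2p[OF f] sum_divide_distrib mult_ac numeral_2_eq_2)
  next
    case (add f g)
    then obtain a a' where "\<forall>b\<in>B ?L. f b = (\<Sum>j\<in>J. a j * v b j)" "\<forall>b\<in>B ?L. g b = (\<Sum>j\<in>J. a' j * v b j)" by blast
    then show ?case by (intro exI[of _ "\<lambda>j. a j + a' j"]) (simp add: distrib_right sum.distrib)
  qed
  have col: "\<exists>h\<in>decomposables A Q ?L. \<forall>b\<in>B ?L. h b = v b j" if j: "j \<in> J" for j
  proof -
    have single: "(\<Sum>i\<in>U. \<Sum>c\<in>C. (if i = i0 then 1 else 0) * t i c * (if c = c0 then 1 else 0)) = (t i0 c0 :: 'k)"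
      if "finite U" "finite C" "i0 \<in> U" "c0 \<in> C" for U C t and i0 c0 :: 'q
      using that by (simp add: if_distrib[of "\<lambda>x. _ * x"] if_distrib[of "\<lambda>x. x * _"] cong: if_cong)
    consider y c where "y \<in> ?Y" "c \<in> B (Suc n)" "j = Inl (y, c)" | z e where "z \<in> ?Z" "e \<in> B n" "j = Inr (z, e)"
      using j unfolding J_def by blast
    then show ?thesis
    proof cases
      case 1
      obtain \<phi> where \<phi>: "chain_lift A Q (Suc n) (dual (Suc n) c) \<phi>"
        using Q.chain_lift_exists[OF cochain_cocycle[OF dual_cochain[OF 1(2)]]] by blast
      have "dual 1 y \<circ> \<phi> 1 \<in> decomposables A Q ?L"
        using cochain_cocycle[OF dual_cochain[OF 1(1)]] cochain_cocycle[OF dual_cochain[OF 1(2)]] \<phi>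
        by (intro decomposables.prod1[where g = "dual (Suc n) c"]) auto
      then have d: "(\<lambda>x. lam * dual (Suc 0) y (\<phi> (Suc 0) x)) \<in> decomposables A Q ?L"
        using Q.decomposables_scale[of "dual 1 y \<circ> \<phi> 1" ?L lam] by simp
      have "lam * dual (Suc 0) y (\<phi> (Suc 0) b) = v b j" if b: "b \<in> B ?L" for b
      proof -
        have "(\<Sum>i\<in>?Y. \<Sum>c'\<in>B (Suc n). dual (Suc 0) y i * t1 b i c' * dual (Suc n) c c') =
            (\<Sum>i\<in>?Y. \<Sum>c'\<in>B (Suc n). (if i = y then 1 else 0) * t1 b i c' * (if c' = c then 1 else 0))"
          using 1 by (intro sum.cong refl) (simp add: dual_basis)
        then show ?thesis using t1p[OF dual_cochain[OF 1(1)] \<phi> b] single[OF finite_B1 fin(2) 1(1,2), of "t1 b"] lam_nonzero 1(3)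
          by (simp add: v_def)
      qed
      then show ?thesis by (intro bexI[OF _ d] ballI)
    next
      case 2
      obtain \<phi> where \<phi>: "chain_lift A Q n (dual n e) \<phi>"
        using Q.chain_lift_exists[OF cochain_cocycle[OF dual_cochain[OF 2(2)]]] by blast
      have "dual 2 z \<circ> \<phi> 2 \<in> decomposables A Q ?L"
        using cochain_cocycle[OF dual_cochain[OF 2(1)]] cochain_cocycle[OF dual_cochain[OF 2(2)]] \<phi>
        by (intro decomposables.prod2[where g = "dual n e"]) (auto simp: numeral_2_eq_2)
      then have d: "(\<lambda>x. lam * dual (Suc (Suc 0)) z (\<phi> (Suc (Suc 0)) x)) \<in> decomposables A Q ?L"
        using Q.decomposables_scale[of "dual 2 z \<circ> \<phi> 2" ?L lam] by (simp add: numeral_2_eq_2)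
      have "lam * dual (Suc (Suc 0)) z (\<phi> (Suc (Suc 0)) b) = v b j" if b: "b \<in> B ?L" for b
      proof -
        have "(\<Sum>i\<in>?Z. \<Sum>c'\<in>B n. dual (Suc (Suc 0)) z i * t2 b i c' * dual n e c') =
            (\<Sum>i\<in>?Z. \<Sum>c'\<in>B n. (if i = z then 1 else 0) * t2 b i c' * (if c' = e then 1 else 0))"
          using 2 by (intro sum.cong refl) (simp add: dual_basis)
        then show ?thesis using t2p[OF dual_cochain[OF 2(1)] \<phi> b] single[OF finite_B2 fin(1) 2(1,2), of "t2 b"] lam_nonzero 2(3)
          by (simp add: v_def)
      qed
      then show ?thesis by (intro bexI[OF _ d] ballI)
    qed
  qed
  show ?thesis using that[OF J rows] dec col by blast
qed

lemma decomposables_if_rows_indep: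
  assumes fin: "finite (B n)" "finite (B (Suc n))" "finite (B (Suc (Suc n)))" and rows: "rows_indep n"
  shows "cocycles A Q (Suc (Suc n)) \<subseteq> decomposables A Q (Suc (Suc n))"
proof
  let ?L = "Suc (Suc n)"
  fix f assume f: "f \<in> cocycles A Q ?L"
  obtain J :: "('q \<times> 'q + 'q \<times> 'q) set" and v where J: "finite J"
    and r: "rows_indep n \<longleftrightarrow> (\<forall>F k. finite F \<and> F \<subseteq> B ?L \<and> (\<forall>j\<in>J. (\<Sum>b\<in>F. k b * v b j) = 0) \<longrightarrow> (\<forall>b\<in>F. k b = 0))"
    and "\<forall>h\<in>decomposables A Q ?L. \<exists>a. \<forall>b\<in>B ?L. h b = (\<Sum>j\<in>J. a j * v b j)"
    and col: "\<forall>j\<in>J. \<exists>h\<in>decomposables A Q ?L. \<forall>b\<in>B ?L. h b = v b j"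
    by (rule coefficient_matrix[OF fin(1,2)]) (rule that; assumption)
  have "\<forall>b\<in>B ?L. k b = 0" if "\<And>j. j \<in> J \<Longrightarrow> (\<Sum>b\<in>B ?L. k b * v b j) = 0" for k
    using r rows fin(3) that by blast
  from independent_rows_span_columns[OF fin(3) J this, where h = f]
  obtain a where a: "\<forall>b\<in>B ?L. f b = (\<Sum>j\<in>J. a j * v b j)" by blast
  obtain H where H: "\<And>j. j \<in> J \<Longrightarrow> H j \<in> decomposables A Q ?L" "\<And>j b. j \<in> J \<Longrightarrow> b \<in> B ?L \<Longrightarrow> H j b = v b j"
    using col by metis
  have d: "(\<lambda>x. \<Sum>j\<in>J. a j * H j x) \<in> decomposables A Q ?L"
    using H(1) by (intro Q.decomposables_sum Q.decomposables_scale)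
  have "f = (\<lambda>x. \<Sum>j\<in>J. a j * H j x)"
    using a H(2) by (intro cochain_eqI[OF Q.cocycleD(1)[OF f] Q.cocycleD(1)[OF Q.decomposables_cocycles[OF d]]]) auto
  then show "f \<in> decomposables A Q ?L" using d by simp
qed

text \<open>
  The dual basis consists of decomposable cocycles, so each of its elements is a combination of columns.
  Pairing such a combination with a relation between the rows yields a coefficient of the relation on one
  side and zero on the other.
\<close>

lemma rows_indep_if_decomposables:
  assumes fin: "finite (B n)" "finite (B (Suc n))"
    and dec: "cocycles A Q (Suc (Suc n)) \<subseteq> decomposables A Q (Suc (Suc n))"
  shows "finite (B (Suc (Suc n)))" "rows_indep n"
proof -
  let ?L = "Suc (Suc n)"
  obtain J :: "('q \<times> 'q + 'q \<times> 'q) set" and v where J: "finite J"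
    and r: "rows_indep n \<longleftrightarrow> (\<forall>F k. finite F \<and> F \<subseteq> B ?L \<and> (\<forall>j\<in>J. (\<Sum>b\<in>F. k b * v b j) = 0) \<longrightarrow> (\<forall>b\<in>F. k b = 0))"
    and d: "\<forall>h\<in>decomposables A Q ?L. \<exists>a. \<forall>b\<in>B ?L. h b = (\<Sum>j\<in>J. a j * v b j)"
    and "\<forall>j\<in>J. \<exists>h\<in>decomposables A Q ?L. \<forall>b\<in>B ?L. h b = v b j"
    by (rule coefficient_matrix[OF fin]) (rule that; assumption)
  have dual: "\<exists>a. \<forall>b'\<in>B ?L. (if b' = b then 1 else 0) = (\<Sum>j\<in>J. a j * v b' j)" if b: "b \<in> B ?L" for b
  proof -
    have "dual ?L b \<in> decomposables A Q ?L" using cochain_cocycle[OF dual_cochain[OF b]] dec by blast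
    from bspec[OF d this] obtain a where "\<forall>b'\<in>B ?L. dual ?L b b' = (\<Sum>j\<in>J. a j * v b' j)" by blast
    then show ?thesis using dual_basis[OF b] by (intro exI[of _ a]) simp
  qed
  show "finite (B ?L)" by (rule finite_if_columns_span[OF J dual])
  have "k b = 0" if F: "finite F" "F \<subseteq> B ?L" and z: "\<forall>j\<in>J. (\<Sum>b\<in>F. k b * v b j) = 0" and b: "b \<in> F" for F k b
  proof -
    obtain a where a: "\<forall>b'\<in>B ?L. (if b' = b then 1 else 0) = (\<Sum>j\<in>J. a j * v b' j)" using dual F b by blast
    have "k b = (\<Sum>b'\<in>F. if b' = b then k b' else 0)" using F b by simp
    also have "\<dots> = (\<Sum>b'\<in>F. k b' * (\<Sum>j\<in>J. a j * v b' j))"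
    proof (rule sum.cong[OF refl])
      fix b' assume "b' \<in> F"
      then have eq: "(if b' = b then 1 else 0) = (\<Sum>j\<in>J. a j * v b' j)" using a F by blast
      show "(if b' = b then k b' else 0) = k b' * (\<Sum>j\<in>J. a j * v b' j)" unfolding eq[symmetric] by simp
    qed
    also have "\<dots> = (\<Sum>j\<in>J. a j * (\<Sum>b'\<in>F. k b' * v b' j))"
      unfolding sum_distrib_left by (subst sum.swap) (simp add: mult_ac)
    also have "\<dots> = 0" using z by simp
    finally show ?thesis .
  qed
  then show "rows_indep n" unfolding r by blast
qed

text \<open>
  Induction on the degree, starting from the bases of \<open>Q\<^sup>0\<close>, \<open>Q\<^sup>1\<close> and \<open>Q\<^sup>2\<close>, which have the sizes of a point,
  of a basis of \<open>V\<close> and of the set of relations.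
\<close>

lemma all_finite:
  assumes "\<And>n. n > 2 \<Longrightarrow> cocycles A Q n \<subseteq> decomposables A Q n"
  shows "finite (B n)"
proof (induction n rule: less_induct)
  case (less n)
  consider "n = 0" | "n = Suc 0" | "n = Suc (Suc 0)" | "n > 2" by linarith
  then show ?case
  proof cases
    case 4
    then obtain m where m: "n = Suc (Suc m)" by (metis Suc_lessE numeral_2_eq_2)
    show ?thesis using rows_indep_if_decomposables(1)[of m] less assms[OF 4] unfolding m by simp
  qed (use B0 finite_B1 finite_B2 in auto)
qed

end


section \<open>The criterion\<close>

theorem theorem4p4:
  fixes X :: "'x set"
    and R :: "('x, 'k::field) free_alg set"
    and A :: "(('x, 'k) free_alg set, 'k) graded_algebra"
    and P :: "(('x, 'k) free_alg set, 'p, 'k) resolution"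
    and Q :: "(('x, 'k) free_alg set, 'q, 'k) resolution"
    and B :: "nat \<Rightarrow> 'q set"
    and M :: "nat \<Rightarrow> 'q \<Rightarrow> 'q \<Rightarrow> ('x, 'k) free_alg set"
    and Mh :: "nat \<Rightarrow> 'q \<Rightarrow> 'q \<Rightarrow> ('x, 'k) free_alg"
  assumes "finite X"
    and "minimal_relations X R"
    and "A = presented_algebra X R"
    and "graded_projective_resolution A P"
    and "minimal_graded_projective_resolution A Q"
    and "\<And>n. homogeneous_basis A (res_mod Q n) (B n)"
    and "\<And>n. n \<ge> 1 \<Longrightarrow> represents A (res_mod Q (n - 1)) (B n) (B (n - 1)) (res_diff Q n) (M n)"
    and "\<And>n. n \<ge> 1 \<Longrightarrow> homogeneous_lift X R (B n) (B (n - 1)) (M n) (Mh n)"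
    and "entries_basis_of_V X (B 1) (B 0) (Mh 1)"
    and "\<And>e. e \<in> B 0 \<Longrightarrow> bij_betw (\<lambda>b. mat_mult (B 1) (Mh 2) (Mh 1) b e) (B 2) R"
  shows "K2 A P \<longleftrightarrow>
    (\<forall>n. 2 < n \<and> enat n \<le> proj_dim A \<longrightarrow>
      finitely_generated A (res_mod Q n) \<and>
      rows_independent X R (B n) (B (n - 1)) (B (n - 2))
        (linear_part X (Mh n))
        (essential_part X R (B (n - 1)) (Mh n) (Mh (n - 1))))"
proof -
  interpret minimal_res X R Q B M Mh
    by unfold_locales (use assms in auto)
  have A: "A = presented_algebra X R" by (rule assms(3))
  interpret P: resol A P
    unfolding A by (rule resol.intro[OF A_graded_alg]) (use assms(3,4) in \<open>simp add: resol_axioms_def\<close>)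
  interpret PQ: two_resol A P Q
    using P.resol_axioms Q.resol_axioms unfolding A by (rule two_resol.intro)
  interpret QP: two_resol A Q P
    using P.resol_axioms Q.resol_axioms unfolding A by (intro two_resol.intro)
  have shift: "\<exists>m. n = Suc (Suc m)" if "n > 2" for n :: nat
    using that by (intro exI[of _ "n - 2"]) auto
  show ?thesis
  proof
    assume "K2 A P"
    then have dec: "cocycles A Q n \<subseteq> decomposables A Q n" if "n > 2" for n
      using that P.K2_iff_decomposables QP.transfer_decomposables[of n] by simp
    have fin: "finite (B n)" for n using all_finite dec unfolding A by blast
    show "\<forall>n. 2 < n \<and> enat n \<le> proj_dim A \<longrightarrow> finitely_generated A (res_mod Q n) \<and>
      rows_independent X R (B n) (B (n - 1)) (B (n - 2)) (linear_part X (Mh n))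
        (essential_part X R (B (n - 1)) (Mh n) (Mh (n - 1)))"
    proof (intro allI impI)
      fix n assume "2 < n \<and> enat n \<le> proj_dim A"
      then obtain m where m: "n = Suc (Suc m)" and n: "n > 2" using shift by blast
      show "finitely_generated A (res_mod Q n) \<and>
          rows_independent X R (B n) (B (n - 1)) (B (n - 2)) (linear_part X (Mh n))
            (essential_part X R (B (n - 1)) (Mh n) (Mh (n - 1)))"
        using rows_indep_if_decomposables(2)[OF fin fin, of m] dec[OF n] finitely_generated_iff[of n] fin[of n]
        unfolding A by (simp add: m)
    qed
  next
    assume rows: "\<forall>n. 2 < n \<and> enat n \<le> proj_dim A \<longrightarrow> finitely_generated A (res_mod Q n) \<and>
      rows_independent X R (B n) (B (n - 1)) (B (n - 2)) (linear_part X (Mh n))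
        (essential_part X R (B (n - 1)) (Mh n) (Mh (n - 1)))"
    have fin: "finite (B n)" if "enat n \<le> proj_dim A" for n
    proof -
      consider "n = 0" | "n = Suc 0" | "n = Suc (Suc 0)" | "n > 2" by linarith
      then show ?thesis
        using B0 finite_B1 finite_B2 rows that finitely_generated_iff[of n] unfolding A by cases auto
    qed
    have "cocycles A P n \<subseteq> decomposables A P n" if n: "n > 2" for n
    proof (cases "enat n \<le> proj_dim A")
      case True
      obtain m where m: "n = Suc (Suc m)" using shift n by blast
      have "enat k \<le> proj_dim A" if "k \<le> n" for k using True that by (meson enat_ord_simps(1) order_trans)
      then have "finite (B m)" "finite (B (Suc m))" "finite (B (Suc (Suc m)))" using fin m by auto
      moreover have "rows_indep m" using rows[rule_format, of n] n True unfolding m by simp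
      ultimately have "cocycles A Q n \<subseteq> decomposables A Q n"
        using decomposables_if_rows_indep[of m] unfolding A m by blast
      then show ?thesis using PQ.transfer_decomposables n by simp
    next
      case False
      then show ?thesis using P.cocycles_above_proj_dim[of n] decomposables.cob by fastforce
    qed
    then show "K2 A P" using P.K2_iff_decomposables by blast
  qed
qed


end
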